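(* Let $G$ be the $xy$-sum of connected graphs $G_1,G_2\in\mathcal G_{xy}^\circ$. The subgraph $G_1$ is $\widehat g$-tight in $G$ if and only if the following hold: (i) if $\eta(G_1,G_2)=0$, then $G_1\in\mathcal C^\circ(\widehat g^+)$; (ii) if $\eta(G_1,G_2)=1$, then $G_1\in\mathcal C^\circ(\widehat g^+)\cup\mathcal H^w(\widehat g)$; (iii) if $\eta(G_1,G_2)=2$, then $G_1\in\mathcal C^\circ(\widehat g^+)\cup\mathcal C^\circ(\widehat g)\cup\mathcal S$; (iv) if $\eta(G_1,G_2)=3$, then $G_1\in\mathcal C^\circ(\widehat g)\cup\mathcal H^w(\widehat g^+)$; (v) if $\eta(G_1,G_2)=4$, then $G_1\in\mathcal C^\circ(\widehat g)$.
   Context: All graphs are finite and simple; after contracting an edge, parallel edges are replaced by single edges. The Euler genus $\widehat g(G)$ is the minimum Euler genus of a surface into which $G$ embeds. $\mathcal G_{xy}$ is the class of simple graphs with two distinguished vertices $x,y$ (terminals); $\mathcal G_{xy}^\circ$ the subclass with $x,y$ non-adjacent. The set $\mathcal M(G)$ of minor-operations consists of deletion of any edge and contraction of any edge other than $xy$ (contracting an edge incident with a terminal yields a terminal); $\mu G$ is the result. For a subgraph $H$ of $G$, $\mathcal M(H)\subseteq\mathcal M(G)$ are the minor-operations on edges of $H$. $G^+$ is $G$ with edge $xy$ added, $\widehat g^+(G)=\widehat g(G^+)$, $\theta(G)=\widehat g^+(G)-\widehat g(G)$. For $G_1,G_2\in\mathcal G_{xy}$ with $V(G_1)\cap V(G_2)=\{x,y\}$,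 their $xy$-sum has vertex set $V(G_1)\cup V(G_2)$, edge set $E(G_1)\cup E(G_2)$ and terminals $x,y$; $\eta(G_1,G_2)=\theta(G_1)+\theta(G_2)$. For a parameter $\mathcal P$ and $k\ge1$, $\Delta_k(\mathcal P)=\{\mu\in\mathcal M(G):\mathcal P(\mu G)\le\mathcal P(G)-k\}$. $G$ is $\mathcal P$-critical if $\mathcal M(G)=\Delta_1(\mathcal P)$; $\mathcal C^\circ(\mathcal P)$ is the class of $\mathcal P$-critical graphs in $\mathcal G_{xy}^\circ$. A subgraph $H$ of $G$ is $\mathcal P$-tight if $\mathcal P(\mu G)<\mathcal P(G)$ for every $\mu\in\mathcal M(H)$. A cascade is $G\in\mathcal G_{xy}^\circ$ with $\mathcal M(G)=\Delta_1(\widehat g)\cup\Delta_1(\widehat g^+)$, $G\notin\mathcal C^\circ(\widehat g)$, $G\notin\mathcal C^\circ(\widehat g^+)$; $\mathcal S$ is the class of cascades. $\mathcal H^w(\widehat g)$ (weak $\widehat g$-hoppers) is the class of $G\in\mathcal G_{xy}^\circ$ with $G\notin\mathcal C^\circ(\widehat g^+)$ and $\mathcal M(G)=\Delta_1(\widehat g^+)\cup\Delta_2(\widehat g)$; $\mathcal H^w(\widehat g^+)$ (weak $\widehat g^+$-hoppers) is the class of $G\in\mathcal G_{xy}^\circ$ with $G\notin\mathcal C^\circ(\widehat g)$ and $\mathcal M(G)=\Delta_1(\widehat g)\cup\Delta_2(\widehat g^+)$. *)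

theory Defs
  imports Main
begin

section \<open>Finite simple graphs with two terminals\<close>

datatype 'a graph = Graph (verts: "'a set") (edges: "'a set set")

definition simple_graph :: "'a graph \<Rightarrow> bool" where
  "simple_graph G \<longleftrightarrow> finite (verts G) \<and> (\<forall>e\<in>edges G. e \<subseteq> verts G \<and> card e = 2)"

definition connected_graph :: "'a graph \<Rightarrow> bool" where
  "connected_graph G \<longleftrightarrow> verts G \<noteq> {} \<and>
     (\<forall>u\<in>verts G. \<forall>v\<in>verts G. (u, v) \<in> {(a, b). {a, b} \<in> edges G}\<^sup>*)"

definition subgraph :: "'a graph \<Rightarrow> 'a graph \<Rightarrow> bool" where
  "subgraph H G \<longleftrightarrow> verts H \<subseteq> verts G \<and> edges H \<subseteq> edges G"

definition terminal_graphs :: "'a \<Rightarrow> 'a \<Rightarrow> 'a graph set" where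
  "terminal_graphs x y = {G. simple_graph G \<and> x \<in> verts G \<and> y \<in> verts G \<and> x \<noteq> y}"

definition terminal_graphs_nonadj :: "'a \<Rightarrow> 'a \<Rightarrow> 'a graph set" where
  "terminal_graphs_nonadj x y = {G \<in> terminal_graphs x y. {x, y} \<notin> edges G}"

definition is_xy_sum :: "'a \<Rightarrow> 'a \<Rightarrow> 'a graph \<Rightarrow> 'a graph \<Rightarrow> 'a graph \<Rightarrow> bool" where
  "is_xy_sum x y G G1 G2 \<longleftrightarrow>
     verts G1 \<inter> verts G2 = {x, y} \<and>
     G = Graph (verts G1 \<union> verts G2) (edges G1 \<union> edges G2)"

definition add_xy :: "'a \<Rightarrow> 'a \<Rightarrow> 'a graph \<Rightarrow> 'a graph" where
  "add_xy x y G = Graph (verts G) (insert {x, y} (edges G))"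


section \<open>Minor-operations\<close>

datatype 'a minor_op = Delete "'a set" | Contract "'a set"

definition minor_ops :: "'a \<Rightarrow> 'a \<Rightarrow> 'a graph \<Rightarrow> 'a minor_op set" where
  "minor_ops x y G = Delete ` edges G \<union> Contract ` (edges G - {{x, y}})"

text \<open>
  The vertex obtained by contracting \<open>e\<close> is named after one of the two ends of \<open>e\<close>: after the
  terminal if \<open>e\<close> contains one, so that \<open>x\<close> and \<open>y\<close> remain the terminals, and after an arbitrary
  end otherwise. The choice depends only on \<open>e\<close>, not on the graph.
\<close>

definition merged_vertex :: "'a \<Rightarrow> 'a \<Rightarrow> 'a set \<Rightarrow> 'a" where
  "merged_vertex x y e = (if x \<in> e then x else if y \<in> e then y else (SOME v. v \<in> e))"

definition merge :: "'a \<Rightarrow> 'a \<Rightarrow> 'a set \<Rightarrow> 'a \<Rightarrow> 'a" where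
  "merge x y e v = (if v \<in> e then merged_vertex x y e else v)"

text \<open>
  Since the edges form a set, parallel edges arising from a contraction are identified
  automatically; removing \<open>e\<close> itself before taking images removes the only possible loop.
\<close>

fun apply_op :: "'a \<Rightarrow> 'a \<Rightarrow> 'a minor_op \<Rightarrow> 'a graph \<Rightarrow> 'a graph" where
  "apply_op x y (Delete e) G = Graph (verts G) (edges G - {e})"
| "apply_op x y (Contract e) G =
     Graph (merge x y e ` verts G) ((\<lambda>d. merge x y e ` d) ` (edges G - {e}))"


section \<open>Closed surfaces and the Euler genus\<close>

text \<open>
  A closed connected surface, orientable or not, is presented by a finite cell decomposition,
  encoded by its flags (the triangles of the barycentric subdivision, each of which belongs to
  exactly one vertex, one edge and one face). The involution \<open>flip\<close>\<open>i\<close> sends a flag to the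
  adjacent flag with a different \<open>i\<close>-cell and the same cells of the other two dimensions. No flip
  has a fixed point because the surface has no boundary. The \<open>i\<close>-cells are the orbits of the two
  flips other than \<open>flip\<close>\<open>i\<close>.
\<close>

record cell_surface =
  flags :: "nat set"
  flip0 :: "nat \<Rightarrow> nat"
  flip1 :: "nat \<Rightarrow> nat"
  flip2 :: "nat \<Rightarrow> nat"

definition flip_rel :: "nat set \<Rightarrow> (nat \<Rightarrow> nat) \<Rightarrow> (nat \<times> nat) set" where
  "flip_rel D f = {(d, f d) | d. d \<in> D}"

definition free_involution_on :: "nat set \<Rightarrow> (nat \<Rightarrow> nat) \<Rightarrow> bool" where
  "free_involution_on D f \<longleftrightarrow> (\<forall>d\<in>D. f d \<in> D \<and> f (f d) = d \<and> f d \<noteq> d)"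

definition closed_surface :: "cell_surface \<Rightarrow> bool" where
  "closed_surface M \<longleftrightarrow>
     finite (flags M) \<and> flags M \<noteq> {} \<and>
     free_involution_on (flags M) (flip0 M) \<and>
     free_involution_on (flags M) (flip1 M) \<and>
     free_involution_on (flags M) (flip2 M) \<and>
     (\<forall>d\<in>flags M. flip0 M (flip2 M d) = flip2 M (flip0 M d) \<and> flip0 M (flip2 M d) \<noteq> d) \<and>
     (\<forall>d\<in>flags M. \<forall>d'\<in>flags M.
        (d, d') \<in> (flip_rel (flags M) (flip0 M) \<union> flip_rel (flags M) (flip1 M) \<union>
                   flip_rel (flags M) (flip2 M))\<^sup>*)"

definition orbits :: "nat set \<Rightarrow> (nat \<Rightarrow> nat) \<Rightarrow> (nat \<Rightarrow> nat) \<Rightarrow> nat set set" where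
  "orbits D f g = D // (flip_rel D f \<union> flip_rel D g)\<^sup>*"

definition cells0 :: "cell_surface \<Rightarrow> nat set set" where
  "cells0 M = orbits (flags M) (flip1 M) (flip2 M)"

definition cells1 :: "cell_surface \<Rightarrow> nat set set" where
  "cells1 M = orbits (flags M) (flip0 M) (flip2 M)"

definition cells2 :: "cell_surface \<Rightarrow> nat set set" where
  "cells2 M = orbits (flags M) (flip0 M) (flip1 M)"

definition euler_char :: "cell_surface \<Rightarrow> int" where
  "euler_char M = int (card (cells0 M)) - int (card (cells1 M)) + int (card (cells2 M))"

definition surface_euler_genus :: "cell_surface \<Rightarrow> int" where
  "surface_euler_genus M = 2 - euler_char M"

text \<open>
  An embedding of a graph in a surface is a realisation as a subgraph of the 1-skeleton of some
  cell decomposition of the surface; the 1-skeleton may contain further vertices and edges, so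
  the embedding need not be cellular and the graph need not be connected. The 1-skeleton may
  have loops and multiple edges, but as the graph is simple, distinct edges have distinct
  pairs of ends and it suffices to give the images of the vertices. The 1-cell of a flag \<open>d\<close>
  joins the 0-cell of \<open>d\<close> to the 0-cell of \<open>flip0 M d\<close>.
\<close>

definition embeds_in :: "'a graph \<Rightarrow> cell_surface \<Rightarrow> bool" where
  "embeds_in G M \<longleftrightarrow>
     (\<exists>\<phi>. inj_on \<phi> (verts G) \<and> \<phi> ` verts G \<subseteq> cells0 M \<and>
          (\<forall>u v. {u, v} \<in> edges G \<longrightarrow> (\<exists>d\<in>flags M. d \<in> \<phi> u \<and> flip0 M d \<in> \<phi> v)))"

definition euler_genus :: "'a graph \<Rightarrow> nat" where
  "euler_genus G =
     (LEAST k. \<exists>M. closed_surface M \<and> surface_euler_genus M = int k \<and> embeds_in G M)"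

definition euler_genus_plus :: "'a \<Rightarrow> 'a \<Rightarrow> 'a graph \<Rightarrow> nat" where
  "euler_genus_plus x y G = euler_genus (add_xy x y G)"

definition theta :: "'a \<Rightarrow> 'a \<Rightarrow> 'a graph \<Rightarrow> int" where
  "theta x y G = int (euler_genus_plus x y G) - int (euler_genus G)"

definition eta :: "'a \<Rightarrow> 'a \<Rightarrow> 'a graph \<Rightarrow> 'a graph \<Rightarrow> int" where
  "eta x y G1 G2 = theta x y G1 + theta x y G2"


section \<open>Criticality, tightness, cascades and hoppers\<close>

definition decreasing_ops ::
  "'a \<Rightarrow> 'a \<Rightarrow> nat \<Rightarrow> ('a graph \<Rightarrow> nat) \<Rightarrow> 'a graph \<Rightarrow> 'a minor_op set" where
  "decreasing_ops x y k P G =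
     {\<mu> \<in> minor_ops x y G. int (P (apply_op x y \<mu> G)) \<le> int (P G) - int k}"

definition critical :: "'a \<Rightarrow> 'a \<Rightarrow> ('a graph \<Rightarrow> nat) \<Rightarrow> 'a graph \<Rightarrow> bool" where
  "critical x y P G \<longleftrightarrow> minor_ops x y G = decreasing_ops x y 1 P G"

definition critical_nonadj :: "'a \<Rightarrow> 'a \<Rightarrow> ('a graph \<Rightarrow> nat) \<Rightarrow> 'a graph set" where
  "critical_nonadj x y P = {G \<in> terminal_graphs_nonadj x y. critical x y P G}"

definition tight_in :: "'a \<Rightarrow> 'a \<Rightarrow> ('a graph \<Rightarrow> nat) \<Rightarrow> 'a graph \<Rightarrow> 'a graph \<Rightarrow> bool" where
  "tight_in x y P H G \<longleftrightarrow>
     subgraph H G \<and> (\<forall>\<mu>\<in>minor_ops x y H. P (apply_op x y \<mu> G) < P G)"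

definition cascades :: "'a \<Rightarrow> 'a \<Rightarrow> 'a graph set" where
  "cascades x y = {G \<in> terminal_graphs_nonadj x y.
     minor_ops x y G =
       decreasing_ops x y 1 euler_genus G \<union> decreasing_ops x y 1 (euler_genus_plus x y) G \<and>
     G \<notin> critical_nonadj x y euler_genus \<and>
     G \<notin> critical_nonadj x y (euler_genus_plus x y)}"

definition weak_genus_hoppers :: "'a \<Rightarrow> 'a \<Rightarrow> 'a graph set" where
  "weak_genus_hoppers x y = {G \<in> terminal_graphs_nonadj x y.
     G \<notin> critical_nonadj x y (euler_genus_plus x y) \<and>
     minor_ops x y G =
       decreasing_ops x y 1 (euler_genus_plus x y) G \<union> decreasing_ops x y 2 euler_genus G}"

definition weak_genus_plus_hoppers :: "'a \<Rightarrow> 'a \<Rightarrow> 'a graph set" where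
  "weak_genus_plus_hoppers x y = {G \<in> terminal_graphs_nonadj x y.
     G \<notin> critical_nonadj x y euler_genus \<and>
     minor_ops x y G =
       decreasing_ops x y 1 euler_genus G \<union> decreasing_ops x y 2 (euler_genus_plus x y) G}"

end

theory Submission
  imports Defs
begin

text \<open>
  An embedding is a system of flags together with a third involution, the rotation, which matches
  flags at the same vertex. If a vertex may carry several rotation cycles, the Euler genus of a
  connected graph is \<open>2 + |E| - 2 |V|\<close> minus the maximum of (faces - rotation cycles), and this
  excess changes in a controlled way when two pairs of the rotation are recombined. Separating
  the two sides of an \<open>xy\<close>-sum by such recombinations either costs nothing, or costs 2 and leaves
  \<open>x\<close> and \<open>y\<close> on a common face on both sides. Hence the Euler genus of the sum is the minimum of
  \<open>g(G1) + g(G2) + 2\<close> and \<open>g\<^sup>+(G1) + g\<^sup>+(G2)\<close>. As \<open>0 \<le> \<theta> \<le> 2\<close>, a minor-operation that keeps \<open>G1\<close>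
  connected lowers the genus of the sum iff it satisfies the condition listed for the value of
  \<open>\<eta>\<close>. If some deletion disconnects \<open>G1\<close>, then the deleted edge is a bridge, its contraction
  lowers neither parameter of \<open>G1\<close>, and both sides of the equivalence fail.
\<close>

text \<open>No curve is cut and no surface is glued: every topological step is a switch of two pairs
  of an involution, whose four flags lie on at most two cycles, so each count changes by at most 1.
  The constant 2 arises as follows. Faces shared by the two sides pass between them at
  \<open>x\<close> or \<open>y\<close>. Once every piece of such a face leads from one terminal to
  the other, each shared face uses a flag at \<open>x\<close> on either side, and closing up both
  sides regains one face for every cut pair at \<open>x\<close>. The only loss is that rotation
  cycles at \<open>x\<close> and at \<open>y\<close> are now needed twice. A chord \<open>xy\<close>
  drawn on each side repays it. The genus formula needs connected sides, which a deletion can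
  destroy; hence the detour over bridges. There the difficulty is \<open>xy\<close>: after it is
  added, a bridge may belong to a cut of two edges. The separation argument still applies, with the
  merged vertex and an end of the other cut edge in place of the terminals, and it undoes the
  contraction.\<close>

abbreviation fi :: "nat set \<Rightarrow> (nat \<Rightarrow> nat) \<Rightarrow> bool" where
  "fi \<equiv> free_involution_on"

abbreviation fr :: "nat set \<Rightarrow> (nat \<Rightarrow> nat) \<Rightarrow> (nat \<times> nat) set" where
  "fr \<equiv> flip_rel"

abbreviation reach :: "nat set \<Rightarrow> (nat \<Rightarrow> nat) \<Rightarrow> (nat \<Rightarrow> nat) \<Rightarrow> (nat \<times> nat) set" where
  "reach D f g \<equiv> (fr D f \<union> fr D g)\<^sup>*"

definition nclass :: "nat set \<Rightarrow> (nat \<times> nat) set \<Rightarrow> nat" where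
  "nclass D r = card (D // r\<^sup>*)"

abbreviation ncyc :: "nat set \<Rightarrow> (nat \<Rightarrow> nat) \<Rightarrow> (nat \<Rightarrow> nat) \<Rightarrow> nat" where
  "ncyc D f g \<equiv> nclass D (fr D f \<union> fr D g)"

section \<open>Involutions without fixed points\<close>

lemma fiD:
  assumes "fi D f" "d \<in> D"
  shows "f d \<in> D" "f (f d) = d" "f d \<noteq> d"
  using assms by (auto simp: free_involution_on_def)

lemma in_fr [simp]: "(u, v) \<in> fr D f \<longleftrightarrow> u \<in> D \<and> v = f u"
  by (auto simp: flip_rel_def)

lemma fr_sub: "fi D f \<Longrightarrow> fr D f \<subseteq> D \<times> D"
  by (auto simp: fiD)

lemma fr_sym: "fi D f \<Longrightarrow> sym (fr D f)"
  by (auto simp: sym_def fiD)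

lemma fr_Un: "fr (A \<union> B) f = fr A f \<union> fr B f"
  by auto

lemma fi_subset: "fi D f \<Longrightarrow> A \<subseteq> D \<Longrightarrow> (\<And>d. d \<in> A \<Longrightarrow> f d \<in> A) \<Longrightarrow> fi A f"
  by (auto simp: free_involution_on_def)

lemma fi_Un: "fi A f \<Longrightarrow> fi B f \<Longrightarrow> fi (A \<union> B) f"
  by (auto simp: free_involution_on_def)

lemma fi_cong: "(\<And>d. d \<in> D \<Longrightarrow> f d = g d) \<Longrightarrow> fi D f \<longleftrightarrow> fi D g"
  unfolding free_involution_on_def by metis

lemma fr_cong: "(\<And>d. d \<in> D \<Longrightarrow> f d = g d) \<Longrightarrow> fr D f = fr D g"
  by auto

lemma even_card_fi:
  assumes "finite A" "fi A f" shows "even (card A)"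
  using assms
proof (induction "card A" arbitrary: A rule: less_induct)
  case less
  show ?case
  proof (cases "A = {}")
    case False
    then obtain d where d: "d \<in> A" by auto
    have fd: "f d \<in> A" "f d \<noteq> d" "f (f d) = d" using less.prems d by (auto simp: fiD)
    have "fi (A - {d, f d}) f"
      using less.prems(2) d fd unfolding free_involution_on_def by (metis DiffE DiffI insert_iff singletonD)
    moreover have c: "card A = card (A - {d, f d}) + 2"
      using card_Diff_subset[of "{d, f d}" A] card_mono[of A "{d, f d}"] d fd less.prems by auto
    ultimately have "even (card (A - {d, f d}))"
      using less.hyps[of "A - {d, f d}"] less.prems by auto
    then show ?thesis using c by simp
  qed simp
qed

subsection \<open>Classes of a symmetric relation\<close>

lemma rtrancl_closed:
  assumes "(a, b) \<in> r\<^sup>*" "a \<in> C" "\<And>u v. (u, v) \<in> r \<Longrightarrow> u \<in> C \<Longrightarrow> v \<in> C"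
  shows "b \<in> C"
  using assms by (induction rule: rtrancl_induct) auto

lemma rtrancl_step2: "(a, u) \<in> r\<^sup>* \<Longrightarrow> (u, v) \<in> r \<Longrightarrow> (v, w) \<in> r \<Longrightarrow> (a, w) \<in> r\<^sup>*"
  by (blast intro: rtrancl.rtrancl_into_rtrancl)

lemma rtrancl_sub_rtrancl:
  assumes "r \<subseteq> s\<^sup>*" shows "r\<^sup>* \<subseteq> s\<^sup>*"
  using assms rtrancl_subset_rtrancl by blast

lemma class_eq_iff: "sym r \<Longrightarrow> r\<^sup>* `` {a} = r\<^sup>* `` {b} \<longleftrightarrow> (a, b) \<in> r\<^sup>*"
  by (auto dest: sym_rtrancl symD intro: rtrancl_trans)
     (meson rtrancl_trans symD sym_rtrancl)

lemma quotient_image: "D // r = (\<lambda>d. r `` {d}) ` D"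
  by (auto simp: quotient_def)

lemma finite_quotient_image: "finite D \<Longrightarrow> finite (D // r)"
  by (simp add: quotient_image)

text \<open>A pair of \<open>X\<close> can be used only after \<open>T\<close> has been reached, so
  a class that never meets \<open>T\<close> does not notice it. This confines a local change to the
  classes through the changed flags.\<close>

lemma avoiding_classes:
  assumes "X \<subseteq> T \<times> T"
  shows "{c \<in> D // (r \<union> X)\<^sup>*. c \<inter> T = {}} = {c \<in> D // r\<^sup>*. c \<inter> T = {}}"
proof -
  have m: "r\<^sup>* \<subseteq> (r \<union> X)\<^sup>*" by (simp add: rtrancl_mono)
  have eq: "(r \<union> X)\<^sup>* `` {d} = r\<^sup>* `` {d}" if "r\<^sup>* `` {d} \<inter> T = {}" for d
  proof -
    have "(d, z) \<in> r\<^sup>*" if "(d, z) \<in> (r \<union> X)\<^sup>*" for z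
      using that
    proof (induction rule: rtrancl_induct)
      case (step y z)
      then have "y \<notin> T" using \<open>r\<^sup>* `` {d} \<inter> T = {}\<close> by auto
      then show ?case using step assms by (meson UnE mem_Sigma_iff rtrancl.rtrancl_into_rtrancl subsetD)
    qed simp
    then show ?thesis using m by auto
  qed
  have av: "r\<^sup>* `` {d} \<inter> T = {}" if "(r \<union> X)\<^sup>* `` {d} \<inter> T = {}" for d
    using that m by auto
  have "c \<in> D // (r \<union> X)\<^sup>* \<longleftrightarrow> c \<in> D // r\<^sup>*" if "c \<inter> T = {}" for c
    unfolding quotient_image image_iff using that eq av by metis
  then show ?thesis by blast
qed

text \<open>Together with \<open>avoiding_classes\<close> this reduces the comparison of two class
  counts to the few classes that pass through \<open>T\<close>.\<close>

lemma nclass_split: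
  assumes "finite D" "sym r" "r \<subseteq> D \<times> D" "T \<subseteq> D"
  shows "nclass D r = card {c \<in> D // r\<^sup>*. c \<inter> T = {}} + card ((\<lambda>t. r\<^sup>* `` {t}) ` T)"
proof -
  have "{c \<in> D // r\<^sup>*. c \<inter> T \<noteq> {}} = (\<lambda>t. r\<^sup>* `` {t}) ` T"
  proof (intro equalityI subsetI)
    fix c assume "c \<in> {c \<in> D // r\<^sup>*. c \<inter> T \<noteq> {}}"
    then obtain d t where "c = r\<^sup>* `` {d}" "t \<in> T" "(d, t) \<in> r\<^sup>*"
      by (auto simp: quotient_image)
    then show "c \<in> (\<lambda>t. r\<^sup>* `` {t}) ` T" using class_eq_iff[OF assms(2)] by blast
  next
    fix c assume "c \<in> (\<lambda>t. r\<^sup>* `` {t}) ` T"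
    then show "c \<in> {c \<in> D // r\<^sup>*. c \<inter> T \<noteq> {}}"
      using assms(4) by (auto simp: quotient_image)
  qed
  moreover have "D // r\<^sup>* = {c \<in> D // r\<^sup>*. c \<inter> T = {}} \<union> {c \<in> D // r\<^sup>*. c \<inter> T \<noteq> {}}" by auto
  moreover have "card ({c \<in> D // r\<^sup>*. c \<inter> T = {}} \<union> {c \<in> D // r\<^sup>*. c \<inter> T \<noteq> {}})
      = card {c \<in> D // r\<^sup>*. c \<inter> T = {}} + card {c \<in> D // r\<^sup>*. c \<inter> T \<noteq> {}}"
    using finite_quotient_image[OF assms(1), of "r\<^sup>*"] by (intro card_Un_disjoint) auto
  ultimately show ?thesis unfolding nclass_def by simp
qed

lemma class_Un:
  assumes "A \<inter> B = {}" "r \<subseteq> A \<times> A" "s \<subseteq> B \<times> B" "d \<in> A"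
  shows "(r \<union> s)\<^sup>* `` {d} = r\<^sup>* `` {d}"
proof -
  have "(d, z) \<in> r\<^sup>* \<and> z \<in> A" if "(d, z) \<in> (r \<union> s)\<^sup>*" for z
    using that
  proof (induction rule: rtrancl_induct)
    case (step y z)
    then have "(y, z) \<in> r" using assms by auto
    then show ?case using step assms by auto
  qed (use assms in auto)
  then show ?thesis using rtrancl_mono[of r "r \<union> s"] by auto
qed

lemma nclass_Un:
  assumes "finite A" "finite B" "A \<inter> B = {}" "r \<subseteq> A \<times> A" "s \<subseteq> B \<times> B"
  shows "nclass (A \<union> B) (r \<union> s) = nclass A r + nclass B s"
proof -
  have 1: "(r \<union> s)\<^sup>* `` {d} = r\<^sup>* `` {d}" if "d \<in> A" for d
    using class_Un[OF assms(3-5) that] .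
  have 2: "(r \<union> s)\<^sup>* `` {d} = s\<^sup>* `` {d}" if "d \<in> B" for d
    using class_Un[of B A s r d] assms that by (simp add: Un_commute Int_commute)
  have "(A \<union> B) // (r \<union> s)\<^sup>* = A // r\<^sup>* \<union> B // s\<^sup>*"
    unfolding quotient_image image_Un using 1 2 by simp
  moreover have "A // r\<^sup>* \<inter> B // s\<^sup>* = {}"
  proof -
    have "c \<noteq> {} \<and> c \<subseteq> A" if "c \<in> A // r\<^sup>*" for c
      using that assms(4) by (auto simp: quotient_image intro: rtrancl_closed)
    moreover have "c \<subseteq> B" if "c \<in> B // s\<^sup>*" for c
      using that assms(5) by (auto simp: quotient_image intro: rtrancl_closed)
    ultimately show ?thesis using assms(3) by blast
  qed
  ultimately show ?thesis unfolding nclass_def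
    using assms by (simp add: card_Un_disjoint finite_quotient_image)
qed

lemma ncyc_Un:
  assumes "finite A" "finite B" "A \<inter> B = {}" "fi A f" "fi A g" "fi B f" "fi B g"
  shows "ncyc (A \<union> B) f g = ncyc A f g + ncyc B f g"
proof -
  have "fr (A \<union> B) f \<union> fr (A \<union> B) g = (fr A f \<union> fr A g) \<union> (fr B f \<union> fr B g)"
    by auto
  then show ?thesis
    using nclass_Un[of A B "fr A f \<union> fr A g" "fr B f \<union> fr B g"] assms
    by (simp add: fr_sub)
qed

text \<open>A component is an alternating path or cycle, so one that meets \<open>K\<close> has exactly two ends.\<close>

lemma path_end:
  assumes "finite D" "fi D g" "K \<subseteq> D" "fi (D - K) f" "a \<in> K"
  obtains b where "b \<in> K" "b \<noteq> a" "(fr D g \<union> fr (D - K) f)\<^sup>* `` {a} \<inter> K = {a, b}"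
proof -
  define p where "p = (\<lambda>d. f (g d))"
  have pS: "(p ^^ Suc k) a = f (g ((p ^^ k) a))" for k by (simp add: p_def)
  define r where "r = fr D g \<union> fr (D - K) f"
  \<comment> \<open>Iterating \<open>p\<close> follows the alternating path two steps at a time. If
    it never met \<open>K\<close> again, its iterates would all be distinct, because
    \<open>f\<close> and \<open>g\<close> are injective and only the start lies in \<open>K\<close>;
    but \<open>D\<close> is finite.\<close>
  have ex: "\<exists>k. g ((p ^^ k) a) \<in> K"
  proof (rule ccontr)
    assume "\<not> ?thesis"
    then have no: "g ((p ^^ k) a) \<notin> K" for k by auto
    have inD: "(p ^^ k) a \<in> D" for k
    proof (induction k)
      case 0 then show ?case using assms by auto
    next
      case (Suc k)
      then have "g ((p ^^ k) a) \<in> D - K" using no assms by (simp add: fiD)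
      then have "f (g ((p ^^ k) a)) \<in> D - K" using assms(4) by (rule fiD(1)[rotated])
      then show ?case unfolding pS by simp
    qed
    have gDK: "g ((p ^^ k) a) \<in> D - K" for k using inD no assms by (simp add: fiD)
    have neq: "(p ^^ i) a \<noteq> (p ^^ (i + Suc j)) a" for i j
    proof (induction i)
      case 0
      have "f (g ((p ^^ j) a)) \<in> D - K" using fiD(1)[OF assms(4) gDK] .
      then show ?case using assms(5) by (auto simp del: funpow.simps simp: pS)
    next
      case (Suc i)
      show ?case
      proof
        assume "(p ^^ Suc i) a = (p ^^ (Suc i + Suc j)) a"
        then have "f (g ((p ^^ i) a)) = f (g ((p ^^ (i + Suc j)) a))"
          unfolding pS add_Suc by simp
        then have "g ((p ^^ i) a) = g ((p ^^ (i + Suc j)) a)"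
          using fiD(2)[OF assms(4) gDK] by metis
        then have "(p ^^ i) a = (p ^^ (i + Suc j)) a"
          using fiD(2)[OF assms(2) inD] by metis
        then show False using Suc by simp
      qed
    qed
    have "inj (\<lambda>k. (p ^^ k) a)"
    proof (rule injI)
      fix i j assume e: "(p ^^ i) a = (p ^^ j) a"
      show "i = j"
      proof (rule ccontr)
        assume "i \<noteq> j"
        then consider k where "j = i + Suc k" | k where "i = j + Suc k"
          by (metis add_Suc_right less_imp_Suc_add linorder_neqE_nat)
        then show False using e neq by (cases; metis)
      qed
    qed
    then have "infinite (range (\<lambda>k. (p ^^ k) a))" using finite_imageD infinite_UNIV_nat by blast
    moreover have "range (\<lambda>k. (p ^^ k) a) \<subseteq> D" using inD by auto
    ultimately show False using assms(1) finite_subset by blast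
  qed
  define k where "k = (LEAST k. g ((p ^^ k) a) \<in> K)"
  have k: "g ((p ^^ k) a) \<in> K" unfolding k_def using ex by (rule LeastI_ex)
  have min: "g ((p ^^ i) a) \<notin> K" if "i < k" for i using that not_less_Least unfolding k_def by blast
  have inD: "(p ^^ i) a \<in> D" "i \<noteq> 0 \<Longrightarrow> (p ^^ i) a \<in> D - K" "(a, (p ^^ i) a) \<in> r\<^sup>*" if "i \<le> k" for i
    using that
  proof (induction i)
    case 0
    { case 1 then show ?case using assms by auto
    next case 2 then show ?case by auto
    next case 3 then show ?case by auto }
  next
    case (Suc i)
    { case 1
      then have i: "(p ^^ i) a \<in> D" "g ((p ^^ i) a) \<in> D - K" using Suc min assms by (auto simp: fiD)
      then have "f (g ((p ^^ i) a)) \<in> D - K" using fiD(1)[OF assms(4)] by blast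
      then show ?case unfolding pS by simp
    next case 2
      then have i: "(p ^^ i) a \<in> D" "g ((p ^^ i) a) \<in> D - K" using Suc min assms by (auto simp: fiD)
      then have "f (g ((p ^^ i) a)) \<in> D - K" using fiD(1)[OF assms(4)] by blast
      then show ?case unfolding pS by simp
    next case 3
      then have i: "(p ^^ i) a \<in> D" "g ((p ^^ i) a) \<in> D - K" using Suc min assms by (auto simp: fiD)
      then have e: "((p ^^ i) a, g ((p ^^ i) a)) \<in> r" "(g ((p ^^ i) a), (p ^^ Suc i) a) \<in> r"
        unfolding pS by (auto simp: r_def)
      have "(a, (p ^^ i) a) \<in> r\<^sup>*" by (rule Suc.IH(3)[OF Suc_leD[OF 3]])
      then show ?case by (rule rtrancl_step2[OF _ e]) }
  qed
  \<comment> \<open>\<open>C\<close> is the path up to its first return to \<open>K\<close>. It is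
    closed under both matchings, so it contains the whole class of \<open>a\<close>.\<close>
  define C where "C = {z. \<exists>i\<le>k. z = (p ^^ i) a \<or> z = g ((p ^^ i) a)}"
  have Cp: "(p ^^ i) a \<in> C" "g ((p ^^ i) a) \<in> C" if "i \<le> k" for i
    unfolding C_def mem_Collect_eq using that by metis+
  have CE: "\<exists>i\<le>k. z = (p ^^ i) a \<or> z = g ((p ^^ i) a)" if "z \<in> C" for z
    using that unfolding C_def mem_Collect_eq .
  have closed: "v \<in> C" if uv: "(u, v) \<in> r" and uC: "u \<in> C" for u v
  proof -
    consider i where "i \<le> k" "u = (p ^^ i) a" | i where "i \<le> k" "u = g ((p ^^ i) a)"
      using CE[OF uC] by metis
    then show ?thesis
    proof cases
      case 1
      show ?thesis
      proof (cases "v = g u")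
        case True then show ?thesis using 1 Cp by auto
      next
        case False
        then have v: "u \<in> D - K" "v = f u" using uv by (auto simp: r_def)
        then obtain j where j: "i = Suc j" using 1 assms(5) by (cases i) auto
        then have "g ((p ^^ j) a) \<in> D - K" using inD(1)[of j] min[of j] 1 assms(2) by (auto simp: fiD)
        then have "v = g ((p ^^ j) a)" using v 1 fiD(2)[OF assms(4)] unfolding j pS by simp
        then show ?thesis using j 1 Cp(2)[of j] by simp
      qed
    next
      case 2
      have "g u = (p ^^ i) a" using 2 inD assms(2) by (simp add: fiD)
      moreover have "f u = (p ^^ Suc i) a" unfolding pS using 2 by simp
      moreover have "i < k" if "u \<notin> K" using 2 k that by (metis nat_less_le)
      ultimately consider "v = (p ^^ i) a" | "v = (p ^^ Suc i) a" "Suc i \<le> k"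
        using uv by (auto simp: r_def simp del: funpow.simps)
      then show ?thesis using Cp 2(1) by cases metis+
    qed
  qed
  have CD: "C \<subseteq> D" using CE inD(1) fiD(1)[OF assms(2)] by (metis subsetI)
  let ?R = "r\<^sup>* `` {a}"
  have sub: "?R \<subseteq> C"
  proof
    fix z assume "z \<in> ?R"
    moreover have "a \<in> C" using Cp(1)[of 0] by simp
    ultimately show "z \<in> C" using rtrancl_closed[of a z r C] closed by auto
  qed
  define b where "b = g ((p ^^ k) a)"
  have "(a, b) \<in> r\<^sup>*" using inD(1,3)[of k] by (auto simp: b_def r_def intro: rtrancl.rtrancl_into_rtrancl)
  moreover have "C \<inter> K \<subseteq> {a, b}"
  proof
    fix z assume z: "z \<in> C \<inter> K"
    then consider i where "i \<le> k" "z = (p ^^ i) a" | i where "i \<le> k" "z = g ((p ^^ i) a)"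
      using CE by (metis IntD1)
    then show "z \<in> {a, b}"
    proof cases
      case 1 then show ?thesis using inD(2)[of i] z by (cases i) auto
    next
      case 2 then show ?thesis using min[of i] z by (cases "i = k") (auto simp: b_def)
    qed
  qed
  ultimately have RK: "?R \<inter> K = {a, b}" using sub k assms(5) by (auto simp: b_def)
  \<comment> \<open>Parity: \<open>g\<close> pairs up the whole class. If \<open>a\<close> were its
    only flag in \<open>K\<close>, then \<open>f\<close> would pair up all of it but
    \<open>a\<close>, and two consecutive numbers would be even.\<close>
  have "b \<noteq> a"
  proof
    assume ba: "b = a"
    have fin: "finite ?R" using sub CD assms(1) by (meson finite_subset)
    have RD: "?R \<subseteq> D" using sub CD by (rule order_trans)
    have "fi ?R g"
    proof (rule fi_subset[OF assms(2) RD])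
      fix d assume d: "d \<in> ?R"
      then have "(a, d) \<in> r\<^sup>*" "(d, g d) \<in> r" using RD by (auto simp: r_def)
      then show "g d \<in> ?R" by (meson Image_singleton_iff rtrancl.rtrancl_into_rtrancl)
    qed
    then have 1: "even (card ?R)" using fin even_card_fi by blast
    have "?R - {a} = ?R - K" using RK ba by auto
    moreover have "fi (?R - K) f"
    proof (rule fi_subset[OF assms(4)])
      show "?R - K \<subseteq> D - K" using RD by (rule Diff_mono) simp
      fix d assume d: "d \<in> ?R - K"
      then have "d \<in> D - K" using RD by blast
      then have "(d, f d) \<in> r" "f d \<in> D - K" using fiD(1)[OF assms(4)] by (auto simp: r_def)
      moreover have "(a, d) \<in> r\<^sup>*" using d by simp
      ultimately have "(a, f d) \<in> r\<^sup>*" by (meson rtrancl.rtrancl_into_rtrancl)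
      then show "f d \<in> ?R - K" using \<open>f d \<in> D - K\<close> by simp
    qed
    ultimately have "even (card (?R - {a}))" using even_card_fi[of "?R - K" f] fin by simp
    moreover have "card ?R = Suc (card (?R - {a}))" using card.remove[OF fin, of a] by blast
    ultimately show False using 1 by (metis even_Suc)
  qed
  moreover have "b \<in> K" unfolding b_def by (rule k)
  ultimately show thesis using that RK unfolding r_def by metis
qed

subsection \<open>Recombining two pairs of an involution\<close>

lemma fi_remove_pair:
  assumes "fi D f" "a \<in> D" shows "fi (D - {a, f a}) f"
  using assms unfolding free_involution_on_def by (metis DiffE DiffI insert_iff singletonD)

text \<open>The usual switch of a perfect matching. On a rotation it opens two corners and glues the
  four halves crosswise; a cycle through them may be split, merged with another one or merely
  traversed differently.\<close>

definition join :: "(nat \<Rightarrow> nat) \<Rightarrow> nat \<Rightarrow> nat \<Rightarrow> nat \<Rightarrow> nat" where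
  "join f a b = f(a := b, b := a, f a := f b, f b := f a)"

locale joinable =
  fixes D :: "nat set" and f :: "nat \<Rightarrow> nat" and a b :: nat
  assumes fin: "finite D" and fi: "fi D f" and a: "a \<in> D" and b: "b \<in> D"
    and ab: "a \<noteq> b" and fab: "f a \<noteq> b"
begin

lemma distinct4: "f a \<in> D" "f b \<in> D" "f a \<noteq> a" "f b \<noteq> b" "f (f a) = a" "f (f b) = b" "f b \<noteq> a" "f a \<noteq> f b"
  using fiD[OF fi a] fiD[OF fi b] ab fab by metis+

lemma join_apply: "join f a b a = b" "join f a b b = a" "join f a b (f a) = f b" "join f a b (f b) = f a"
  using distinct4 ab fab by (auto simp: join_def)

lemma join_other: "d \<notin> {a, f a, b, f b} \<Longrightarrow> join f a b d = f d"
  by (simp add: join_def)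

lemma fi_join: "fi D (join f a b)"
  unfolding free_involution_on_def
proof (intro ballI)
  fix d assume d: "d \<in> D"
  show "join f a b d \<in> D \<and> join f a b (join f a b d) = d \<and> join f a b d \<noteq> d"
  proof (cases "d \<in> {a, f a, b, f b}")
    case True
    then show ?thesis using join_apply distinct4 a b ab by auto
  next
    case False
    then have "f d \<notin> {a, f a, b, f b}" using fiD[OF fi d] distinct4 by (metis insertE insert_iff singletonD)
    then show ?thesis using False join_other fiD[OF fi d] by simp
  qed
qed

lemma join_sym: "join f b a = join f a b"
  using distinct4 ab fab by (intro ext) (simp add: join_def)

lemma joinable_sym: "joinable D f b a"
  using fin fi a b ab distinct4 by unfold_locales auto

lemma joinable_back: "joinable D (join f a b) a (f a)"
  using fin fi_join a distinct4 join_apply fab by unfold_locales auto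

text \<open>A switch is undone by a switch, so results about splitting a class follow from those
  about merging two classes.\<close>

lemma join_back: "join (join f a b) a (f a) = f"
proof
  fix d
  show "join (join f a b) a (f a) d = f d"
    unfolding join_def[of "join f a b"] fun_upd_apply join_apply
    using join_other[of d] by (simp add: distinct4(5,6))
qed

end

locale joinable_rel = joinable +
  fixes Q :: "(nat \<times> nat) set"
  assumes Qsym: "sym Q" and Qsub: "Q \<subseteq> D \<times> D"
begin

abbreviation "R \<equiv> (fr D f \<union> Q)\<^sup>*"
abbreviation "R' \<equiv> (fr D (join f a b) \<union> Q)\<^sup>*"

lemma sym_rel: "sym (fr D f \<union> Q)" and sym_rel': "sym (fr D (join f a b) \<union> Q)"
  by (simp_all add: sym_Un fr_sym fi fi_join Qsym)

lemma sub_rel: "fr D f \<union> Q \<subseteq> D \<times> D" and sub_rel': "fr D (join f a b) \<union> Q \<subseteq> D \<times> D"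
  by (simp_all only: Un_subset_iff fr_sub fi fi_join Qsub)

lemma sym_R: "sym R" and sym_R': "sym R'"
  by (simp_all add: sym_rtrancl sym_rel sym_rel')

text \<open>Before the switch the four flags fall into the classes of \<open>a\<close> and
  \<open>b\<close>, afterwards into those of \<open>a\<close> and \<open>f a\<close>; the classes
  that avoid them are the same. Each side of the equation adds the number belonging to the other
  side, which avoids subtraction of natural numbers.\<close>

lemma switch:
  "nclass D (fr D f \<union> Q) + (if (a, f a) \<in> R' then 1 else 2)
   = nclass D (fr D (join f a b) \<union> Q) + (if (a, b) \<in> R then 1 else 2)"
proof -
  define T where "T = {a, f a, b, f b}"
  define r0 where "r0 = fr (D - T) f \<union> Q"
  define X where "X = fr T f"
  define X' where "X' = fr T (join f a b)"
  have TD: "T \<subseteq> D" using a b distinct4 by (auto simp: T_def)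
  have eq: "fr D f \<union> Q = r0 \<union> X" using TD by (auto simp: r0_def X_def)
  have eq': "fr D (join f a b) \<union> Q = r0 \<union> X'"
    using TD join_other by (auto simp: r0_def X'_def T_def)
  have XT: "X \<subseteq> T \<times> T" "X' \<subseteq> T \<times> T"
    unfolding X_def X'_def T_def using distinct4(5,6) join_apply by fastforce+
  note s = sym_rel sym_rel'
  note sub = sub_rel sub_rel'
  define A where "A = card {c \<in> D // r0\<^sup>*. c \<inter> T = {}}"
  have edge: "R `` {f a} = R `` {a}" "R `` {f b} = R `` {b}" "R' `` {b} = R' `` {a}" "R' `` {f b} = R' `` {f a}"
    unfolding class_eq_iff[OF s(1)] class_eq_iff[OF s(2)]
    by (rule r_into_rtrancl, simp add: a b distinct4(1,2,5,6) join_apply)+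
  have img: "(\<lambda>t. R `` {t}) ` T = {R `` {a}, R `` {b}}" "(\<lambda>t. R' `` {t}) ` T = {R' `` {a}, R' `` {f a}}"
    unfolding T_def using edge by auto
  have cR: "card {R `` {a}, R `` {b}} = (if (a, b) \<in> R then 1 else 2)"
    using class_eq_iff[OF s(1), of a b] by (auto simp: card_insert_if)
  have cR': "card {R' `` {a}, R' `` {f a}} = (if (a, f a) \<in> R' then 1 else 2)"
    using class_eq_iff[OF s(2), of a "f a"] by (auto simp: card_insert_if)
  have "nclass D (fr D f \<union> Q) = A + (if (a, b) \<in> R then 1 else 2)"
    using nclass_split[OF fin s(1) sub(1) TD] avoiding_classes[OF XT(1), of D r0] cR img(1)
    by (simp add: eq[symmetric] A_def)
  moreover have "nclass D (fr D (join f a b) \<union> Q) = A + (if (a, f a) \<in> R' then 1 else 2)"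
    using nclass_split[OF fin s(2) sub(2) TD] avoiding_classes[OF XT(2), of D r0] cR' img(2)
    by (simp add: eq'[symmetric] A_def)
  ultimately show ?thesis by simp
qed

lemma nclass_join_le: "nclass D (fr D (join f a b) \<union> Q) \<le> nclass D (fr D f \<union> Q) + 1"
  and nclass_join_ge: "nclass D (fr D f \<union> Q) \<le> nclass D (fr D (join f a b) \<union> Q) + 1"
  using switch by (auto split: if_splits)

lemma join_sub: "(a, b) \<in> R \<Longrightarrow> R' \<subseteq> R"
proof (rule rtrancl_sub_rtrancl, rule subsetI)
  fix e assume ab: "(a, b) \<in> R" and e: "e \<in> fr D (join f a b) \<union> Q"
  have s: "sym R" by (rule sym_R)
  have 1: "(a, f a) \<in> R" "(b, f b) \<in> R" using a b by auto
  then have 2: "(f a, f b) \<in> R" using ab s by (meson rtrancl_trans symD)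
  have 3: "(d, join f a b d) \<in> R" if "d \<in> D" for d
  proof (cases "d \<in> {a, f a, b, f b}")
    case True
    then consider "d = a" | "d = b" | "d = f a" | "d = f b" by blast
    then show ?thesis by cases (simp_all add: join_apply ab 2 symD[OF s ab] symD[OF s 2])
  next
    case False
    then have "(d, join f a b d) \<in> fr D f" using that join_other by simp
    then show ?thesis by blast
  qed
  obtain u v where uv: "e = (u, v)" by (cases e)
  show "e \<in> R"
  proof (cases "e \<in> Q")
    case False
    then show ?thesis using e 3 uv by simp
  qed blast
qed

end

text \<open>The second matching \<open>g\<close> provides the alternating paths, while
  \<open>Q\<close> may contain more than \<open>g\<close>, for instance both \<open>t0\<close> and
  \<open>t2\<close> when components are counted.\<close>

locale joinable_rel2 = joinable_rel +
  fixes g :: "nat \<Rightarrow> nat"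
  assumes fi_g: "fi D g" and gQ: "fr D g \<subseteq> Q"
begin

text \<open>Without the pair of \<open>a\<close>, the alternating path that starts at
  \<open>a\<close> must end at \<open>f a\<close>. It stays in the old class of \<open>a\<close>, so
  it avoids \<open>b\<close> and \<open>f b\<close> and survives the switch.\<close>

lemma join_reconnect:
  assumes "(a, b) \<notin> R"
  shows "(a, f a) \<in> R'"
proof -
  let ?K = "{a, f a}"
  have "fi (D - ?K) f"
    using fi_remove_pair[OF fi a] .
  then obtain c where c: "c \<in> ?K" "c \<noteq> a" "(fr D g \<union> fr (D - ?K) f)\<^sup>* `` {a} \<inter> ?K = {a, c}"
    using path_end[OF fin fi_g, of ?K f a] a distinct4 by blast
  have "(a, z) \<in> R' \<and> (a, z) \<in> R" if "(a, z) \<in> (fr D g \<union> fr (D - ?K) f)\<^sup>*" for z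
    using that
  proof (induction rule: rtrancl_induct)
    case (step y z)
    show ?case
    proof (cases "(y, z) \<in> fr D g")
      case True
      then have "(y, z) \<in> fr D (join f a b) \<union> Q" "(y, z) \<in> fr D f \<union> Q" using gQ by blast+
      then show ?thesis using step.IH rtrancl.rtrancl_into_rtrancl by metis
    next
      case False
      then have y: "y \<in> D" "y \<notin> ?K" "z = f y" using step.hyps(2) by auto
      have "y \<noteq> b" using assms step.IH by auto
      moreover have "y \<noteq> f b"
      proof
        assume "y = f b"
        then have "(y, b) \<in> fr D f \<union> Q" using distinct4(2,6) by simp
        then show False using assms step.IH rtrancl.rtrancl_into_rtrancl by metis
      qed
      ultimately have "join f a b y = f y" using y join_other by auto
      then have "(y, z) \<in> fr D (join f a b) \<union> Q" "(y, z) \<in> fr D f \<union> Q" using y by simp_all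
      then show ?thesis using step.IH rtrancl.rtrancl_into_rtrancl by metis
    qed
  qed simp
  then show ?thesis using c by blast
qed

lemma nclass_join_merge: "(a, b) \<notin> R \<Longrightarrow> nclass D (fr D (join f a b) \<union> Q) + 1 = nclass D (fr D f \<union> Q)"
  using switch join_reconnect by (auto split: if_splits)

end

context joinable_rel2
begin

lemma rel2_sym: "joinable_rel2 D f b a Q g"
  using joinable_sym Qsym Qsub fi_g gQ
  by (simp add: joinable_rel2_def joinable_rel_def joinable_rel_axioms_def joinable_rel2_axioms_def)

lemma rel2_back: "joinable_rel2 D (join f a b) a (f a) Q g"
  using joinable_back Qsym Qsub fi_g gQ
  by (simp add: joinable_rel2_def joinable_rel_def joinable_rel_axioms_def joinable_rel2_axioms_def)

lemma nclass_join_split: "(a, f a) \<notin> R' \<Longrightarrow> nclass D (fr D (join f a b) \<union> Q) = nclass D (fr D f \<union> Q) + 1"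
  using joinable_rel2.nclass_join_merge[OF rel2_back] join_back by simp

lemma join_merge_sub:
  assumes "(a, b) \<notin> R" shows "R \<subseteq> R'"
proof (rule rtrancl_sub_rtrancl, rule subsetI)
  fix e assume e: "e \<in> fr D f \<union> Q"
  have s': "sym R'" "sym R" by (rule sym_R', rule sym_R)
  have 1: "(a, f a) \<in> R'" using join_reconnect assms by simp
  have "(b, a) \<notin> R" using assms s'(2) by (meson symD)
  then have 2: "(b, f b) \<in> R'" using joinable_rel2.join_reconnect[OF rel2_sym] join_sym by simp
  have 3: "(d, f d) \<in> R'" if d: "d \<in> D" for d
  proof (cases "d \<in> {a, f a, b, f b}")
    case True
    then consider "d = a" | "d = b" | "d = f a" | "d = f b" by blast
    then show ?thesis by cases (simp_all add: distinct4(5,6) 1 2 symD[OF s'(1) 1] symD[OF s'(1) 2])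
  next
    case False
    then have "(d, f d) \<in> fr D (join f a b)" using d join_other by simp
    then show ?thesis by blast
  qed
  obtain u v where uv: "e = (u, v)" by (cases e)
  show "e \<in> R'"
  proof (cases "e \<in> Q")
    case False
    then show ?thesis using e 3 uv by simp
  qed blast
qed

lemma join_merge_connects:
  assumes "(a, b) \<notin> R" "(a, p) \<in> R" "(b, q) \<in> R" shows "(p, q) \<in> R'"
proof -
  have s': "sym R'" by (rule sym_R')
  have 1: "(a, b) \<in> R'" by (rule r_into_rtrancl) (simp add: join_apply a)
  have "(a, p) \<in> R'" "(b, q) \<in> R'" using join_merge_sub[OF assms(1)] assms(2,3) by blast+
  then show ?thesis using 1 s' by (meson rtrancl_trans symD)
qed

end

lemma joinable_relI:
  assumes "joinable D f a b" "fi D g" shows "joinable_rel2 D f a b (fr D g) g"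
  using assms by (simp add: joinable_rel2_def joinable_rel_def joinable_rel_axioms_def
      joinable_rel2_axioms_def fr_sym fr_sub)

lemma joinable_relI2:
  assumes "joinable D f a b" "fi D g" "fi D h" shows "joinable_rel2 D f a b (fr D g \<union> fr D h) g"
  using assms by (simp add: joinable_rel2_def joinable_rel_def joinable_rel_axioms_def
      joinable_rel2_axioms_def fr_sym fr_sub sym_Un)

text \<open>The set \<open>C\<close> is left only through \<open>a\<close> and \<open>b\<close>.
  Once these two are matched with each other, \<open>C\<close> is closed under both involutions and
  breaks off from \<open>f a\<close> and \<open>f b\<close>.\<close>

lemma join_close:
  assumes "finite D" "fi D f" "fi D g" "C \<subseteq> D" "a \<in> C" "b \<in> C" "a \<noteq> b"
    and g: "\<And>d. d \<in> C \<Longrightarrow> g d \<in> C"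
    and f: "\<And>d. d \<in> C \<Longrightarrow> d \<noteq> a \<Longrightarrow> d \<noteq> b \<Longrightarrow> f d \<in> C"
    and out: "f a \<notin> C" "f b \<notin> C"
  shows "joinable D f a b" "ncyc D (join f a b) g = ncyc D f g + 1"
proof -
  show j: "joinable D f a b" using assms by unfold_locales auto
  interpret joinable D f a b by (rule j)
  interpret r: joinable_rel2 D f a b "fr D g" g by (rule joinable_relI[OF j assms(3)])
  have "(a, f a) \<notin> r.R'"
  proof
    assume "(a, f a) \<in> r.R'"
    then have "f a \<in> C"
    proof (rule rtrancl_closed[OF _ \<open>a \<in> C\<close>])
      fix u v assume uv: "(u, v) \<in> fr D (join f a b) \<union> fr D g" and u: "u \<in> C"
      consider "v = g u" | "v = join f a b u" using uv by auto
      then show "v \<in> C"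
      proof cases
        case 2
        have "u \<noteq> f a" "u \<noteq> f b" using u out by auto
        then show ?thesis using 2 join_apply(1,2) join_other[of u] f[OF u] assms(5,6)
          by (cases "u = a"; cases "u = b") auto
      qed (simp add: g u)
    qed
    then show False using out by simp
  qed
  then show "ncyc D (join f a b) g = ncyc D f g + 1" by (rule r.nclass_join_split)
qed

text \<open>Opening both pairs cuts the cycle into paths. The one starting at \<open>a\<close>
  cannot end at \<open>f a\<close>, since the cycle also passes through \<open>b\<close>. Its actual
  end, \<open>b\<close> or \<open>f b\<close>, tells which of the two switches closes it up.\<close>

lemma join_split_either:
  assumes j: "joinable D f a b" and g: "fi D g" and conn: "(a, b) \<in> reach D f g"
  shows "joinable D f a (f b)"
    and "ncyc D (join f a b) g = ncyc D f g + 1 \<or> ncyc D (join f a (f b)) g = ncyc D f g + 1"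
proof -
  interpret joinable D f a b by (rule j)
  show j2: "joinable D f a (f b)" using fin fi a b distinct4 by unfold_locales auto
  let ?K = "{a, f a, b, f b}"
  have K: "?K \<subseteq> D" using a b distinct4 by simp
  have "D - ?K = (D - {a, f a}) - {b, f b}" by auto
  then have fiK: "fi (D - ?K) f"
    using fi_remove_pair[OF fi_remove_pair[OF fi a], of b] b ab fab by simp
  then obtain c where c: "c \<in> ?K" "c \<noteq> a" "(fr D g \<union> fr (D - ?K) f)\<^sup>* `` {a} \<inter> ?K = {a, c}"
    using path_end[OF fin g K fiK, of a] by blast
  define C where "C = (fr D g \<union> fr (D - ?K) f)\<^sup>* `` {a}"
  have CK: "C \<inter> ?K = {a, c}" using c C_def by simp
  have CD: "C \<subseteq> D"
  proof
    fix z assume "z \<in> C"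
    then have "(a, z) \<in> (fr D g \<union> fr (D - ?K) f)\<^sup>*" by (simp add: C_def)
    then show "z \<in> D" using a
      by (rule rtrancl_closed) (use fiD(1)[OF g] fiD(1)[OF fi] in auto)
  qed
  have Cg: "g d \<in> C" if "d \<in> C" for d
  proof -
    have "(d, g d) \<in> fr D g \<union> fr (D - ?K) f" using that CD by auto
    then show ?thesis using that unfolding C_def Image_singleton_iff by (rule rtrancl.rtrancl_into_rtrancl[rotated])
  qed
  have Cf: "f d \<in> C" if "d \<in> C" "d \<notin> ?K" for d
  proof -
    have "(d, f d) \<in> fr D g \<union> fr (D - ?K) f" using that CD by auto
    then show ?thesis using that(1) unfolding C_def Image_singleton_iff by (rule rtrancl.rtrancl_into_rtrancl[rotated])
  qed
  have Cf': "f d \<in> C" if "d \<in> C" "d \<noteq> a" "d \<noteq> c" for d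
    using Cf that CK by blast
  have aC: "a \<in> C" by (simp add: C_def)
  have cC: "c \<in> C" using CK by auto
  consider "c = f a" | "c = b" | "c = f b" using c by auto
  then show "ncyc D (join f a b) g = ncyc D f g + 1 \<or> ncyc D (join f a (f b)) g = ncyc D f g + 1"
  proof cases
    case 1
    have "b \<in> C" using conn aC
    proof (rule rtrancl_closed)
      fix u v assume uv: "(u, v) \<in> fr D f \<union> fr D g" and u: "u \<in> C"
      consider "v = g u" | "v = f u" using uv by auto
      then show "v \<in> C"
      proof cases
        case 2
        then show ?thesis using Cf'[OF u] aC cC 1 distinct4(5) by (cases "u = a"; cases "u = c") auto
      qed (simp add: Cg u)
    qed
    then have "b \<in> C \<inter> ?K" by simp
    then have "b = a \<or> b = c" unfolding CK by simp
    then show ?thesis using 1 ab fab by simp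
  next
    case 2
    have "z \<notin> C" if "z \<in> ?K" "z \<noteq> a" "z \<noteq> b" for z using CK 2 that by blast
    then have "f a \<notin> C" "f b \<notin> C" using distinct4 fab by simp_all
    then show ?thesis using join_close(2)[OF fin fi g CD aC cC c(2)[symmetric] Cg Cf'] 2 by simp
  next
    case 3
    have "z \<notin> C" if "z \<in> ?K" "z \<noteq> a" "z \<noteq> c" for z using CK that by blast
    then have "f a \<notin> C" "f c \<notin> C" using 3 distinct4 ab by simp_all
    then show ?thesis using join_close(2)[OF fin fi g CD aC cC c(2)[symmetric] Cg Cf'] 3 by simp
  qed
qed

subsection \<open>Flag systems\<close>

text \<open>Edges without a rotation. The commutation and the inequality force every edge to consist
  of exactly four flags, see \<open>card_edge_class\<close>.\<close>

definition flag_system :: "nat set \<Rightarrow> (nat \<Rightarrow> nat) \<Rightarrow> (nat \<Rightarrow> nat) \<Rightarrow> bool" where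
  "flag_system D t0 t2 \<longleftrightarrow> finite D \<and> fi D t0 \<and> fi D t2 \<and>
     (\<forall>d\<in>D. t0 (t2 d) = t2 (t0 d) \<and> t0 (t2 d) \<noteq> d)"

definition rotation :: "nat set \<Rightarrow> (nat \<Rightarrow> 'a) \<Rightarrow> (nat \<Rightarrow> nat) \<Rightarrow> bool" where
  "rotation D l t1 \<longleftrightarrow> fi D t1 \<and> (\<forall>d\<in>D. l (t1 d) = l d)"

definition excess :: "nat set \<Rightarrow> (nat \<Rightarrow> nat) \<Rightarrow> (nat \<Rightarrow> nat) \<Rightarrow> (nat \<Rightarrow> nat) \<Rightarrow> int" where
  "excess D t0 t1 t2 = int (ncyc D t1 t0) - int (ncyc D t1 t2)"

text \<open>The sum of the Euler genera of all components, with rotation cycles as vertices: twice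
  the number of components minus the Euler characteristic.\<close>

definition flag_genus :: "nat set \<Rightarrow> (nat \<Rightarrow> nat) \<Rightarrow> (nat \<Rightarrow> nat) \<Rightarrow> (nat \<Rightarrow> nat) \<Rightarrow> int" where
  "flag_genus D t0 t1 t2 = 2 * int (nclass D (fr D t1 \<union> (fr D t0 \<union> fr D t2)))
     - int (ncyc D t1 t2) + int (ncyc D t0 t2) - int (ncyc D t1 t0)"

lemma flag_systemD:
  assumes "flag_system D t0 t2"
  shows "finite D" "fi D t0" "fi D t2" "\<And>d. d \<in> D \<Longrightarrow> t0 (t2 d) = t2 (t0 d)"
    "\<And>d. d \<in> D \<Longrightarrow> t0 (t2 d) \<noteq> d"
  using assms by (auto simp: flag_system_def)

lemma flag_system_subset:
  assumes "flag_system D t0 t2" "S \<subseteq> D" "\<And>d. d \<in> S \<Longrightarrow> t0 d \<in> S" "\<And>d. d \<in> S \<Longrightarrow> t2 d \<in> S"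
  shows "flag_system S t0 t2"
  using assms fi_subset[of D t0 S] fi_subset[of D t2 S] finite_subset[of S D]
  unfolding flag_system_def by blast

lemma rotationD: "rotation D l t1 \<Longrightarrow> fi D t1" "rotation D l t1 \<Longrightarrow> d \<in> D \<Longrightarrow> l (t1 d) = l d"
  by (auto simp: rotation_def)

lemma rotation_join:
  assumes "rotation D l t1" "joinable D t1 a b" "l a = l b"
  shows "rotation D l (join t1 a b)"
proof -
  interpret joinable D t1 a b by (rule assms(2))
  have e: "l (t1 a) = l a" "l (t1 b) = l a" using rotationD(2)[OF assms(1)] a b assms(3) by auto
  have "l (join t1 a b d) = l d" if "d \<in> D" for d
  proof (cases "d \<in> {a, t1 a, b, t1 b}")
    case True
    then consider "d = a" | "d = b" | "d = t1 a" | "d = t1 b" by blast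
    then show ?thesis by cases (simp_all add: join_apply e assms(3) flip: assms(3))
  next
    case False
    then show ?thesis using join_other rotationD(2)[OF assms(1) that] by simp
  qed
  then show ?thesis using fi_join by (simp add: rotation_def)
qed

lemma class_subset:
  assumes "r \<subseteq> D \<times> D" "d \<in> D" shows "r\<^sup>* `` {d} \<subseteq> D"
  using assms by (auto intro: rtrancl_closed[of d _ r D])

lemma nclass_uniform:
  assumes "finite D" "sym r" "r \<subseteq> D \<times> D" "\<And>d. d \<in> D \<Longrightarrow> card (r\<^sup>* `` {d}) = k"
  shows "k * nclass D r = card D"
proof -
  have U: "\<Union> (D // r\<^sup>*) = D" using class_subset[OF assms(3)] by (auto simp: quotient_image)
  have "k * card (D // r\<^sup>*) = card (\<Union> (D // r\<^sup>*))"
  proof (rule card_partition)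
    show "finite (D // r\<^sup>*)" using assms(1) by (rule finite_quotient_image)
    show "finite (\<Union> (D // r\<^sup>*))" using U assms(1) by simp
    show "\<And>c. c \<in> D // r\<^sup>* \<Longrightarrow> card c = k" using assms(4) by (auto simp: quotient_image)
    show "c \<inter> c' = {}" if c: "c \<in> D // r\<^sup>*" "c' \<in> D // r\<^sup>*" "c \<noteq> c'" for c c'
    proof (rule ccontr)
      obtain d d' where d: "c = r\<^sup>* `` {d}" "c' = r\<^sup>* `` {d'}" using c by (auto simp: quotient_image)
      assume "c \<inter> c' \<noteq> {}"
      then obtain z where "(d, z) \<in> r\<^sup>*" "(d', z) \<in> r\<^sup>*" using d by auto
      then have "(d, d') \<in> r\<^sup>*" using sym_rtrancl[OF assms(2)] by (meson rtrancl_trans symD)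
      then show False using class_eq_iff[OF assms(2)] d c(3) by blast
    qed
  qed
  then show ?thesis using U by (simp add: nclass_def)
qed

lemma class_pair: "fi D t \<Longrightarrow> d \<in> D \<Longrightarrow> reach D t t `` {d} = {d, t d}"
proof (intro equalityI subsetI)
  assume a: "fi D t" "d \<in> D"
  fix z assume "z \<in> reach D t t `` {d}"
  then have "(d, z) \<in> reach D t t" by simp
  then show "z \<in> {d, t d}"
    by (rule rtrancl_closed) (use fiD[OF a] in auto)
qed auto

lemma ncyc_same:
  assumes "finite D" "fi D t" shows "2 * ncyc D t t = card D"
proof (rule nclass_uniform)
  fix d assume d: "d \<in> D"
  then have "t d \<noteq> d" using fiD(3)[OF assms(2)] by simp
  then show "card (reach D t t `` {d}) = 2" unfolding class_pair[OF assms(2) d] by simp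
qed (use assms in \<open>simp_all add: fr_sym fr_sub\<close>)

lemma class_edge:
  assumes "flag_system D t0 t2" "d \<in> D"
  shows "reach D t0 t2 `` {d} = {d, t0 d, t2 d, t0 (t2 d)}"
proof (intro equalityI subsetI)
  note F = flag_systemD[OF assms(1)]
  note d = fiD[OF F(2) assms(2)] fiD[OF F(3) assms(2)] fiD[OF F(2) fiD(1)[OF F(3) assms(2)]]
    fiD[OF F(3) fiD(1)[OF F(2) assms(2)]] F(4)[OF assms(2)]
  fix z assume "z \<in> reach D t0 t2 `` {d}"
  then have "(d, z) \<in> reach D t0 t2" by simp
  then show "z \<in> {d, t0 d, t2 d, t0 (t2 d)}"
  proof (rule rtrancl_closed)
    fix u v assume uv: "(u, v) \<in> fr D t0 \<union> fr D t2" and u: "u \<in> {d, t0 d, t2 d, t0 (t2 d)}"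
    have v: "v = t0 u \<or> v = t2 u" using uv by auto
    consider "u = d" | "u = t0 d" | "u = t2 d" | "u = t0 (t2 d)" using u by blast
    then show "v \<in> {d, t0 d, t2 d, t0 (t2 d)}"
      by cases (use v d in \<open>elim disjE; simp\<close>)+
  qed simp
next
  note F = flag_systemD[OF assms(1)]
  fix z assume "z \<in> {d, t0 d, t2 d, t0 (t2 d)}"
  moreover have "(d, t0 d) \<in> reach D t0 t2" "(d, t2 d) \<in> reach D t0 t2"
    "(t2 d, t0 (t2 d)) \<in> reach D t0 t2"
    by (rule r_into_rtrancl, simp add: assms(2) fiD(1)[OF F(3)])+
  ultimately show "z \<in> reach D t0 t2 `` {d}" by (auto intro: rtrancl_trans)
qed

lemma card_edge_class:
  assumes "flag_system D t0 t2" "d \<in> D" shows "card {d, t0 d, t2 d, t0 (t2 d)} = 4"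
proof -
  note F = flag_systemD[OF assms(1)]
  have "t0 d \<noteq> d" "t2 d \<noteq> d" "t0 (t2 d) \<noteq> d" "t0 (t2 d) \<noteq> t2 d"
    using fiD(3)[OF F(2)] fiD(3)[OF F(3)] F(5) assms(2) fiD(1)[OF F(3)] by blast+
  moreover have "t0 d \<noteq> t2 d"
    using F(5)[OF assms(2)] fiD(2)[OF F(2) assms(2)] by metis
  moreover have "t0 (t2 d) \<noteq> t0 d"
    using fiD(2)[OF F(2) assms(2)] fiD(2)[OF F(2) fiD(1)[OF F(3) assms(2)]] \<open>t2 d \<noteq> d\<close> by metis
  ultimately show ?thesis by (simp add: card_insert_if)
qed

lemma ncyc_edges: "flag_system D t0 t2 \<Longrightarrow> 4 * ncyc D t0 t2 = card D"
  using nclass_uniform[of D "fr D t0 \<union> fr D t2" 4] class_edge[of D t0 t2] card_edge_class[of D t0 t2]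
    flag_systemD[of D t0 t2]
  by (simp add: fr_sym fr_sub sym_Un)

section \<open>Pulling edge ends off their vertices\<close>

lemma map_rtrancl:
  assumes "(u, v) \<in> r\<^sup>*" "\<And>y z. (y, z) \<in> r \<Longrightarrow> (\<pi> y, \<pi> z) \<in> s\<^sup>*"
  shows "(\<pi> u, \<pi> v) \<in> s\<^sup>*"
  using assms(1) by (induction rule: rtrancl_induct) (auto dest: assms(2) intro: rtrancl_trans)

text \<open>Matching \<open>a\<close> with \<open>t2 a\<close> pulls one end of an edge off its
  vertex and makes it a vertex of degree one. The assumption \<open>ne\<close> says that this end is
  not yet alone.\<close>

locale detach =
  fixes D t0 t1 t2 a
  assumes F: "flag_system D t0 t2" and f1: "fi D t1" and aD: "a \<in> D" and ne: "t1 a \<noteq> t2 a"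
begin

abbreviation "b \<equiv> t2 a"
abbreviation "t1' \<equiv> join t1 a b"

lemma joinable: "joinable D t1 a b"
  using F f1 aD ne fiD[OF flag_systemD(3)[OF F] aD] by unfold_locales (auto simp: flag_systemD)

sublocale J: joinable D t1 a b by (rule joinable)
sublocale V: joinable_rel2 D t1 a b "fr D t2" t2
  by (rule joinable_relI[OF joinable]) (simp add: flag_systemD[OF F])
sublocale W: joinable_rel2 D t1 a b "fr D t0" t0
  by (rule joinable_relI[OF joinable]) (simp add: flag_systemD[OF F])
sublocale A: joinable_rel2 D t1 a b "fr D t0 \<union> fr D t2" t0
  by (rule joinable_relI2[OF joinable]) (simp_all add: flag_systemD[OF F])

lemma t2b: "t2 b = a" using fiD(2)[OF flag_systemD(3)[OF F] aD] .

lemma vertices: "ncyc D t1' t2 = ncyc D t1 t2 + 1"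
proof (rule V.nclass_join_split, rule notI)
  assume "(a, t1 a) \<in> V.R'"
  then have "t1 a \<in> {a, b}"
    by (rule rtrancl_closed) (use J.join_apply t2b in auto)
  then show False using ne J.distinct4 by auto
qed

text \<open>One vertex is gained. If the component stays whole, at most one face is lost. If it
  splits, the face at \<open>a\<close> splits too, and the additional vertex and face compensate for
  the 2 contributed by the new component.\<close>

lemma flag_genus_le: "flag_genus D t0 t1' t2 \<le> flag_genus D t0 t1 t2"
proof -
  have ab: "(a, b) \<in> A.R" by (rule r_into_rtrancl) (simp add: aD)
  show ?thesis
  proof (cases "(a, t1 a) \<in> A.R'")
    case True
    then have "nclass D (fr D t1' \<union> (fr D t0 \<union> fr D t2)) = nclass D (fr D t1 \<union> (fr D t0 \<union> fr D t2))"
      using A.switch ab by simp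
    then show ?thesis using vertices W.nclass_join_ge unfolding flag_genus_def by linarith
  next
    case False
    then have 1: "nclass D (fr D t1' \<union> (fr D t0 \<union> fr D t2)) = nclass D (fr D t1 \<union> (fr D t0 \<union> fr D t2)) + 1"
      using A.switch ab by simp
    have "W.R' \<subseteq> A.R'" by (rule rtrancl_mono) auto
    then have "ncyc D t1' t0 = ncyc D t1 t0 + 1" using False W.nclass_join_split by blast
    then show ?thesis using vertices 1 unfolding flag_genus_def by simp
  qed
qed

text \<open>Sending \<open>a\<close> and \<open>b\<close> to their former partners
  \<open>t1 a\<close> and \<open>t1 b\<close> turns a walk around the vertex into one that bypasses
  the detached end.\<close>

lemma vertex_class:
  assumes d: "d \<noteq> a" "d \<noteq> b" "d' \<noteq> a" "d' \<noteq> b"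
  shows "(d, d') \<in> V.R' \<longleftrightarrow> (d, d') \<in> V.R"
proof
  have "(a, b) \<in> V.R" by (rule r_into_rtrancl) (simp add: aD)
  then show "(d, d') \<in> V.R' \<Longrightarrow> (d, d') \<in> V.R" using V.join_sub by blast
next
  assume *: "(d, d') \<in> V.R"
  define \<pi> where "\<pi> = (\<lambda>z. if z = a then t1 a else if z = b then t1 b else z)"
  have link: "(t1 a, t1 b) \<in> V.R'" "(t1 b, t1 a) \<in> V.R'"
    by (rule r_into_rtrancl, simp add: J.join_apply J.distinct4)+
  have "(\<pi> d, \<pi> d') \<in> V.R'"
  proof (rule map_rtrancl[OF *])
    fix y z assume yz: "(y, z) \<in> fr D t1 \<union> fr D t2"
    have pi: "\<pi> a = t1 a" "\<pi> b = t1 b" "\<pi> (t1 a) = t1 a" "\<pi> (t1 b) = t1 b"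
      using J.distinct4 ne J.ab by (auto simp: \<pi>_def)
    consider "y \<in> {a, t1 a, b, t1 b}" "z = t1 y" | "y \<notin> {a, t1 a, b, t1 b}" "y \<in> D" "z = t1 y"
      | "y \<in> {a, b}" "z = t2 y" | "y \<notin> {a, b}" "y \<in> D" "z = t2 y" using yz by auto
    then show "(\<pi> y, \<pi> z) \<in> V.R'"
    proof cases
      case 1
      then have "\<pi> y = \<pi> z" using pi J.distinct4(5,6) by auto
      then show ?thesis by simp
    next
      case 2
      have "t1 (t1 y) = y" using fiD(2)[OF f1 2(2)] .
      then have "t1 y \<noteq> a" "t1 y \<noteq> b" using 2(1) by auto
      then have "\<pi> y = y" "\<pi> z = z" "t1' y = z" using 2 J.join_other by (auto simp: \<pi>_def)
      then show ?thesis using 2 by (auto intro!: r_into_rtrancl)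
    next
      case 3
      then show ?thesis using pi link t2b by auto
    next
      case 4
      have "t2 (t2 y) = y" using fiD(2)[OF flag_systemD(3)[OF F] 4(2)] .
      then have "t2 y \<noteq> a" "t2 y \<noteq> b" using 4(1) t2b by auto
      then have "\<pi> y = y" "\<pi> z = z" using 4 by (auto simp: \<pi>_def)
      then show ?thesis using 4 by (auto intro!: r_into_rtrancl)
    qed
  qed
  then show "(d, d') \<in> V.R'" using d by (simp add: \<pi>_def)
qed

end

text \<open>Deletion of edges in disguise: if \<open>J\<close> consists of the flags of some edges,
  these become isolated edges instead of being removed, and the rotation cycles of the other flags
  stay recognizable.\<close>

lemma detach_all:
  assumes F: "flag_system D t0 t2" and J: "J \<subseteq> D" "\<And>d. d \<in> J \<Longrightarrow> t2 d \<in> J" and f1: "fi D t1"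
  shows "\<exists>t1'. fi D t1' \<and> (\<forall>d\<in>J. t1' d = t2 d) \<and> flag_genus D t0 t1' t2 \<le> flag_genus D t0 t1 t2 \<and>
    (\<forall>d d'. d \<notin> J \<longrightarrow> d' \<notin> J \<longrightarrow>
      (d, d') \<in> reach D t1' t2 \<longleftrightarrow> (d, d') \<in> reach D t1 t2)"
  using f1
proof (induction "card {d \<in> J. t1 d \<noteq> t2 d}" arbitrary: t1 rule: less_induct)
  case less
  let ?bad = "\<lambda>t. {d \<in> J. t d \<noteq> t2 d}"
  show ?case
  proof (cases "?bad t1 = {}")
    case True
    then show ?thesis using less.prems by blast
  next
    case False
    then obtain a where a: "a \<in> J" "t1 a \<noteq> t2 a" by auto
    interpret detach D t0 t1 t2 a using F less.prems a J by unfold_locales auto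
    have "?bad t1' \<subseteq> ?bad t1 - {a}"
    proof
      fix d assume d: "d \<in> ?bad t1'"
      have "d \<noteq> a" "d \<noteq> b" using d J.join_apply t2b by auto
      moreover have "t1 d \<noteq> t2 d"
      proof (cases "d = t1 a \<or> d = t1 b")
        case True
        have "t2 (t2 d) = d" using fiD(2)[OF flag_systemD(3)[OF F]] d J by auto
        moreover have "t1 d = a \<or> t1 d = b" using True J.distinct4(5,6) by auto
        ultimately show ?thesis using \<open>d \<noteq> a\<close> \<open>d \<noteq> b\<close> t2b by auto
      next
        case False
        then show ?thesis using d J.join_other[of d] \<open>d \<noteq> a\<close> \<open>d \<noteq> b\<close> by auto
      qed
      ultimately show "d \<in> ?bad t1 - {a}" using d by simp
    qed
    moreover have fin: "finite (?bad t1)" using finite_subset[OF J(1) J.fin] by simp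
    ultimately have "card (?bad t1') \<le> card (?bad t1 - {a})" by (intro card_mono) auto
    also have "\<dots> < card (?bad t1)" using a fin by (intro card_Diff1_less) auto
    finally obtain s where s: "fi D s" "\<forall>d\<in>J. s d = t2 d" "flag_genus D t0 s t2 \<le> flag_genus D t0 t1' t2"
      "\<forall>d d'. d \<notin> J \<longrightarrow> d' \<notin> J \<longrightarrow>
        (d, d') \<in> reach D s t2 \<longleftrightarrow> (d, d') \<in> reach D t1' t2"
      using less.hyps[OF _ J.fi_join] by blast
    have "b \<in> J" using a J by simp
    then have "\<forall>d d'. d \<notin> J \<longrightarrow> d' \<notin> J \<longrightarrow>
        (d, d') \<in> reach D s t2 \<longleftrightarrow> (d, d') \<in> reach D t1 t2"
      using s(4) vertex_class a(1) by metis
    then show ?thesis using s flag_genus_le by (meson order_trans)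
  qed
qed

text \<open>Every edge is then a sphere of its own, with two vertices, one edge and one
  face.\<close>

lemma flag_genus_detached:
  assumes F: "flag_system D t0 t2" and eq: "\<And>d. d \<in> D \<Longrightarrow> t1 d = t2 d"
  shows "flag_genus D t0 t1 t2 = 0"
proof -
  note G = flag_systemD[OF F]
  have "fr D t1 = fr D t2" using eq by (rule fr_cong)
  then have "flag_genus D t0 t1 t2 = 2 * int (ncyc D t0 t2) - int (ncyc D t2 t2)"
    unfolding flag_genus_def by (simp add: Un_commute Un_left_commute)
  then show ?thesis using ncyc_same[OF G(1,3)] ncyc_edges[OF F] by linarith
qed

text \<open>Euler's inequality: detaching all edge ends does not raise the genus and leads to
  0.\<close>

lemma flag_genus_nonneg:
  assumes F: "flag_system D t0 t2" and "fi D t1" shows "flag_genus D t0 t1 t2 \<ge> 0"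
  using detach_all[OF F, of D t1] assms(2) flag_genus_detached[OF F] fiD(1)[OF flag_systemD(3)[OF F]]
  by force

section \<open>Labelled flags and the addition of edges\<close>

definition flag_graph ::
  "nat set \<Rightarrow> (nat \<Rightarrow> nat) \<Rightarrow> (nat \<Rightarrow> nat) \<Rightarrow> (nat \<Rightarrow> nat) \<Rightarrow> (nat \<Rightarrow> 'a) \<Rightarrow> bool" where
  "flag_graph D t0 t1 t2 l \<longleftrightarrow> flag_system D t0 t2 \<and> rotation D l t1 \<and> (\<forall>d\<in>D. l (t2 d) = l d)"

text \<open>
  One vertex may carry several cycles of the rotation. For a connected graph with \<open>m\<close> edges and
  exactly one cycle for every vertex in \<open>V\<close>, the Euler genus is \<open>2 + m - 2 |V| - excess\<close>, and
  merging two cycles of the same vertex never lowers the excess.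
\<close>

definition edge_set :: "nat set \<Rightarrow> (nat \<Rightarrow> nat) \<Rightarrow> (nat \<Rightarrow> 'a) \<Rightarrow> 'a set set" where
  "edge_set D t0 l = (\<lambda>d. {l d, l (t0 d)}) ` D"

text \<open>The number \<open>m\<close> counts edges with multiplicity while \<open>E\<close>
  forgets it, so parallel copies of an edge are allowed. Vertices exist only as labels of flags;
  hence isolated vertices cannot be represented.\<close>

definition realizable :: "'a set \<Rightarrow> 'a set set \<Rightarrow> nat \<Rightarrow> int \<Rightarrow> bool" where
  "realizable V E m p \<longleftrightarrow> (\<exists>D t0 t1 t2 l. flag_graph D t0 t1 t2 l \<and> l ` D = V \<and>
     edge_set D t0 l = E \<and> card D = 4 * m \<and> excess D t0 t1 t2 = p)"

lemma flag_graphD: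
  assumes "flag_graph D t0 t1 t2 l"
  shows "flag_system D t0 t2" "rotation D l t1" "finite D" "fi D t0" "fi D t1" "fi D t2"
    "\<And>d. d \<in> D \<Longrightarrow> l (t2 d) = l d" "\<And>d. d \<in> D \<Longrightarrow> l (t1 d) = l d"
  using assms by (auto simp: flag_graph_def flag_systemD rotationD)

lemma excess_Un:
  assumes "finite A" "finite B" "A \<inter> B = {}" "fi A t0" "fi A t1" "fi A t2" "fi B t0" "fi B t1" "fi B t2"
  shows "excess (A \<union> B) t0 t1 t2 = excess A t0 t1 t2 + excess B t0 t1 t2"
  unfolding excess_def using assms by (simp add: ncyc_Un)

lemma excess_cong:
  assumes "\<And>d. d \<in> D \<Longrightarrow> t0 d = s0 d" "\<And>d. d \<in> D \<Longrightarrow> t1 d = s1 d" "\<And>d. d \<in> D \<Longrightarrow> t2 d = s2 d"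
  shows "excess D t0 t1 t2 = excess D s0 s1 s2"
  unfolding excess_def using fr_cong[of D t0 s0] fr_cong[of D t1 s1] fr_cong[of D t2 s2] assms by simp

lemma flag_genus_Un:
  assumes "finite A" "finite B" "A \<inter> B = {}" "fi A t0" "fi A t1" "fi A t2" "fi B t0" "fi B t1" "fi B t2"
  shows "flag_genus (A \<union> B) t0 t1 t2 = flag_genus A t0 t1 t2 + flag_genus B t0 t1 t2"
proof -
  have "fr (A \<union> B) t1 \<union> (fr (A \<union> B) t0 \<union> fr (A \<union> B) t2)
      = (fr A t1 \<union> (fr A t0 \<union> fr A t2)) \<union> (fr B t1 \<union> (fr B t0 \<union> fr B t2))" unfolding fr_Un by blast
  then have "nclass (A \<union> B) (fr (A \<union> B) t1 \<union> (fr (A \<union> B) t0 \<union> fr (A \<union> B) t2))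
      = nclass A (fr A t1 \<union> (fr A t0 \<union> fr A t2)) + nclass B (fr B t1 \<union> (fr B t0 \<union> fr B t2))"
    using nclass_Un[of A B "fr A t1 \<union> (fr A t0 \<union> fr A t2)" "fr B t1 \<union> (fr B t0 \<union> fr B t2)"] assms
    by (simp add: fr_sub)
  then show ?thesis unfolding flag_genus_def using assms by (simp add: ncyc_Un)
qed

lemma flag_system_cong:
  assumes "\<And>d. d \<in> D \<Longrightarrow> t0 d = s0 d" "\<And>d. d \<in> D \<Longrightarrow> t2 d = s2 d" "flag_system D t0 t2"
  shows "flag_system D s0 s2"
proof -
  note F = flag_systemD[OF assms(3)]
  have "fi D s0" "fi D s2" using F fi_cong[of D t0 s0] fi_cong[of D t2 s2] assms by simp_all
  moreover have "s0 (s2 d) = s2 (s0 d) \<and> s0 (s2 d) \<noteq> d" if "d \<in> D" for d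
    using F(4,5)[OF that] assms(1,2) fiD(1)[OF F(2) that] fiD(1)[OF F(3) that] that by metis
  ultimately show ?thesis using F(1) unfolding flag_system_def by blast
qed

lemma flag_graph_cong:
  assumes "\<And>d. d \<in> D \<Longrightarrow> t0 d = s0 d" "\<And>d. d \<in> D \<Longrightarrow> t1 d = s1 d" "\<And>d. d \<in> D \<Longrightarrow> t2 d = s2 d"
    "\<And>d. d \<in> D \<Longrightarrow> l d = k d" "flag_graph D t0 t1 t2 l"
  shows "flag_graph D s0 s1 s2 k"
proof -
  note G = flag_graphD[OF assms(5)]
  have "flag_system D s0 s2" by (rule flag_system_cong[OF assms(1,3) G(1)])
  moreover have "fi D s1" using G(5) fi_cong[of D t1 s1] assms(2) by simp
  moreover have "k (s1 d) = k d \<and> k (s2 d) = k d" if "d \<in> D" for d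
    using G(7,8)[OF that] assms(2,3,4) fiD(1)[OF G(5) that] fiD(1)[OF G(6) that] that by metis
  ultimately show ?thesis by (simp add: flag_graph_def rotation_def)
qed

lemma flag_graph_Un:
  assumes "flag_graph A t0 t1 t2 l" "flag_graph B t0 t1 t2 l"
  shows "flag_graph (A \<union> B) t0 t1 t2 l"
  using assms unfolding flag_graph_def flag_system_def rotation_def by (auto intro: fi_Un)

lemma edge_set_cong:
  assumes "\<And>d. d \<in> D \<Longrightarrow> t0 d = s0 d" "\<And>d. d \<in> D \<Longrightarrow> l d = k d" "fi D t0"
  shows "edge_set D t0 l = edge_set D s0 k"
  unfolding edge_set_def using assms fiD(1)[OF assms(3)] by (intro image_cong) auto

lemma edge_set_Un: "edge_set (A \<union> B) t0 l = edge_set A t0 l \<union> edge_set B t0 l"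
  by (auto simp: edge_set_def)

definition piecewise :: "nat set \<Rightarrow> (nat \<Rightarrow> 'b) \<Rightarrow> (nat \<Rightarrow> 'b) \<Rightarrow> nat \<Rightarrow> 'b" where
  "piecewise A f g d = (if d \<in> A then f d else g d)"

lemma disjoint_union:
  assumes "flag_graph A t0 t1 t2 l" "flag_graph B s0 s1 s2 k" "A \<inter> B = {}"
  defines "u0 \<equiv> piecewise A t0 s0" and "u1 \<equiv> piecewise A t1 s1" and "u2 \<equiv> piecewise A t2 s2" and "h \<equiv> piecewise A l k"
  shows "flag_graph A u0 u1 u2 h" "flag_graph B u0 u1 u2 h" "flag_graph (A \<union> B) u0 u1 u2 h"
    "excess (A \<union> B) u0 u1 u2 = excess A t0 t1 t2 + excess B s0 s1 s2"
    "edge_set (A \<union> B) u0 h = edge_set A t0 l \<union> edge_set B s0 k" "h ` (A \<union> B) = l ` A \<union> k ` B"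
proof -
  have A: "u0 d = t0 d" "u1 d = t1 d" "u2 d = t2 d" "h d = l d" if "d \<in> A" for d
    using that by (simp_all add: piecewise_def u0_def u1_def u2_def h_def)
  have B: "u0 d = s0 d" "u1 d = s1 d" "u2 d = s2 d" "h d = k d" if "d \<in> B" for d
    using that assms(3) by (auto simp: piecewise_def u0_def u1_def u2_def h_def)
  show 1: "flag_graph A u0 u1 u2 h" by (rule flag_graph_cong[OF _ _ _ _ assms(1)]) (simp_all add: A)
  show 2: "flag_graph B u0 u1 u2 h" by (rule flag_graph_cong[OF _ _ _ _ assms(2)]) (simp_all add: B)
  show "flag_graph (A \<union> B) u0 u1 u2 h" by (rule flag_graph_Un[OF 1 2])
  have "excess A u0 u1 u2 = excess A t0 t1 t2" "excess B u0 u1 u2 = excess B s0 s1 s2"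
    by (rule excess_cong; simp add: A B)+
  then show "excess (A \<union> B) u0 u1 u2 = excess A t0 t1 t2 + excess B s0 s1 s2"
    using excess_Un[of A B u0 u1 u2] assms(3) flag_graphD[OF 1] flag_graphD[OF 2] by simp
  have "edge_set A u0 h = edge_set A t0 l" "edge_set B u0 h = edge_set B s0 k"
    using flag_graphD(4)[OF 1] flag_graphD(4)[OF 2] by (intro edge_set_cong; simp add: A B)+
  then show "edge_set (A \<union> B) u0 h = edge_set A t0 l \<union> edge_set B s0 k" by (simp add: edge_set_Un)
  show "h ` (A \<union> B) = l ` A \<union> k ` B" unfolding image_Un using A(4) B(4) by (simp cong: image_cong)
qed

text \<open>An edge on the sphere has one face and two vertices, hence excess -1. The parameter
  \<open>n\<close> serves to place the four flags beyond a given finite set.\<close>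

lemma single_edge:
  fixes n :: nat and p q :: 'a
  obtains t0 t2 l where "flag_graph {n, n+1, n+2, n+3} t0 t2 t2 l" "l n = p" "l (t0 n) = q"
    "edge_set {n, n+1, n+2, n+3} t0 l = {{p, q}}" "l ` {n, n+1, n+2, n+3} = {p, q}"
    "excess {n, n+1, n+2, n+3} t0 t2 t2 = -1" 
proof -
  let ?N = "{n, n+1, n+2, n+3}"
  define t0 where "t0 = (\<lambda>d. if d < n+2 then d + 2 else d - 2)"
  define t2 where "t2 = (\<lambda>d. if d = n then n+1 else if d = n+1 then n else if d = n+2 then n+3 else n+2)"
  define l where "l = (\<lambda>d. if d < n+2 then p else q)"
  have f: "fi ?N t0" "fi ?N t2" by (auto simp: free_involution_on_def t0_def t2_def)
  have F: "flag_system ?N t0 t2" unfolding flag_system_def using f by (auto simp: t0_def t2_def)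
  have G: "flag_graph ?N t0 t2 t2 l"
    unfolding flag_graph_def rotation_def using F f by (auto simp: l_def t2_def)
  have c: "card ?N = 4" by simp
  have "4 * ncyc ?N t0 t2 = 4" "2 * ncyc ?N t2 t2 = 4"
    using ncyc_edges[OF F] ncyc_same[OF _ f(2)] c by simp_all
  then have "ncyc ?N t2 t0 = 1" "ncyc ?N t2 t2 = 2" by (simp_all add: Un_commute)
  then have P: "excess ?N t0 t2 t2 = -1" by (simp add: excess_def)
  have E: "edge_set ?N t0 l = {{p, q}}" by (auto simp: edge_set_def l_def t0_def)
  have L: "l ` ?N = {p, q}" by (auto simp: l_def)
  show thesis by (rule that[OF G _ _ E L P]) (auto simp: l_def t0_def)
qed

lemma add_single_edge:
  assumes G: "flag_graph D t0 t1 t2 l"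
  obtains n N u0 u1 u2 h where "n \<in> N" "N \<inter> D = {}" "card N = 4" "finite N"
    "flag_graph N u0 u1 u2 h" "flag_graph (D \<union> N) u0 u1 u2 h" "flag_graph D u0 u1 u2 h"
    "\<forall>d\<in>D. u0 d = t0 d \<and> u1 d = t1 d \<and> u2 d = t2 d \<and> h d = l d"
    "\<forall>d\<in>N. u1 d = u2 d" "h n = p" "h (u0 n) = q"
    "edge_set (D \<union> N) u0 h = insert {p, q} (edge_set D t0 l)" "h ` (D \<union> N) = l ` D \<union> {p, q}"
    "excess (D \<union> N) u0 u1 u2 = excess D t0 t1 t2 - 1"
proof -
  \<comment> \<open>Inserting 0 keeps \<open>Max\<close> meaningful when \<open>D\<close> is
    empty.\<close>
  define n where "n = Suc (Max (insert 0 D))"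
  have fin: "finite D" using flag_graphD[OF G] by simp
  have lt: "d < n" if "d \<in> D" for d using that fin by (simp add: n_def less_Suc_eq_le)
  let ?N = "{n, n+1, n+2, n+3}"
  obtain s0 s2 k where s: "flag_graph ?N s0 s2 s2 k" "k n = p" "k (s0 n) = q"
    "edge_set ?N s0 k = {{p, q}}" "k ` ?N = {p, q}" "excess ?N s0 s2 s2 = -1" by (rule single_edge)
  have dis: "D \<inter> ?N = {}" using lt by fastforce
  note U = disjoint_union[OF G s(1) dis]
  have nD: "n \<notin> D" using lt by blast
  have s0n: "s0 n \<in> ?N" using fiD(1)[OF flag_graphD(4)[OF s(1)], of n] by simp
  show thesis
  proof (rule that[of n ?N, OF _ _ _ _ U(2,3,1)])
    show "?N \<inter> D = {}" using dis by blast
    show "\<forall>d\<in>D. piecewise D t0 s0 d = t0 d \<and> piecewise D t1 s2 d = t1 d \<and> piecewise D t2 s2 d = t2 d \<and> piecewise D l k d = l d"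
      by (simp add: piecewise_def)
    show "\<forall>d\<in>?N. piecewise D t1 s2 d = piecewise D t2 s2 d" using dis by (auto simp: piecewise_def)
    show "piecewise D l k n = p" using nD s(2) by (simp add: piecewise_def)
    have "s0 n \<notin> D" using s0n dis by blast
    then show "piecewise D l k (piecewise D t0 s0 n) = q" using nD s(3) by (simp add: piecewise_def)
  qed (use U(4,5,6) s(4,5,6) in auto)
qed

text \<open>The new edge is a separate component with rotation cycles of its own, even if its ends
  already occur as labels. It contributes one face and two cycles.\<close>

lemma realizable_add_edge:
  assumes "realizable V E m \<phi>"
  shows "realizable (V \<union> {p, q}) (insert {p, q} E) (m + 1) (\<phi> - 1)"
proof -
  obtain D t0 t1 t2 l where D: "flag_graph D t0 t1 t2 l" "l ` D = V" "edge_set D t0 l = E"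
    "card D = 4 * m" "excess D t0 t1 t2 = \<phi>" using assms by (auto simp: realizable_def)
  obtain n N u0 u1 u2 h where N: "N \<inter> D = {}" "card N = 4" "finite N" "flag_graph (D \<union> N) u0 u1 u2 h"
    "edge_set (D \<union> N) u0 h = insert {p, q} (edge_set D t0 l)" "h ` (D \<union> N) = l ` D \<union> {p, q}"
    "excess (D \<union> N) u0 u1 u2 = excess D t0 t1 t2 - 1" using add_single_edge[OF D(1), of p q] by metis
  have "D \<inter> N = {}" using N(1) by blast
  then have "card (D \<union> N) = 4 * (m + 1)"
    using card_Un_disjoint[of D N] N(2,3) D(4) flag_graphD(3)[OF D(1)] by simp
  then show ?thesis using N D unfolding realizable_def by metis
qed

text \<open>Flags on different sides lie in different rotation cycles and in different faces. The
  switch merges one pair of each kind, so the difference of the counts is unchanged.\<close>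

lemma join_across:
  assumes G: "flag_graph D t0 t1 t2 l" and S: "S \<subseteq> D" "t0 ` S \<subseteq> S" "t1 ` S \<subseteq> S" "t2 ` S \<subseteq> S"
    and q: "q \<in> S" "q' \<in> D - S" "l q = l q'"
  shows "flag_graph D t0 (join t1 q q') t2 l" "excess D t0 (join t1 q q') t2 = excess D t0 t1 t2"
    "joinable D t1 q q'"
    "\<And>p p'. (q, p) \<in> reach D t1 t0 \<Longrightarrow> (q', p') \<in> reach D t1 t0 \<Longrightarrow>
      (p, p') \<in> reach D (join t1 q q') t0"
proof -
  note g = flag_graphD[OF G]
  have "t1 q \<in> S" using q(1) S(3) by blast
  then show j: "joinable D t1 q q'" using g(3,5) q(1,2) S(1) by unfold_locales auto
  interpret V: joinable_rel2 D t1 q q' "fr D t2" t2 by (rule joinable_relI[OF j g(6)])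
  interpret F: joinable_rel2 D t1 q q' "fr D t0" t0 by (rule joinable_relI[OF j g(4)])
  have sep: "(q, q') \<notin> reach D t1 u" if "u ` S \<subseteq> S" for u
  proof
    assume "(q, q') \<in> reach D t1 u"
    then have "q' \<in> S" using q(1) by (rule rtrancl_closed) (use that S(3) in auto)
    then show False using q(2) by simp
  qed
  show "flag_graph D t0 (join t1 q q') t2 l"
    using G rotation_join[OF g(2) j q(3)] by (simp add: flag_graph_def)
  show "excess D t0 (join t1 q q') t2 = excess D t0 t1 t2"
    using V.nclass_join_merge[OF sep[OF S(4)]] F.nclass_join_merge[OF sep[OF S(2)]]
    unfolding excess_def by linarith
  show "\<And>p p'. (q, p) \<in> reach D t1 t0 \<Longrightarrow> (q', p') \<in> reach D t1 t0 \<Longrightarrow>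
      (p, p') \<in> reach D (join t1 q q') t0"
    by (rule F.join_merge_connects[OF sep[OF S(2)]])
qed

text \<open>One of the two ways of recombining the pairs of \<open>a\<close> and \<open>b\<close> splits their common face.\<close>

lemma join_cofacial:
  assumes G: "flag_graph D t0 t1 t2 l" and ab: "a \<in> D" "b \<in> D" "l a = l b"
    and f: "(a, b) \<in> reach D t1 t0" and v: "(a, b) \<notin> reach D t1 t2"
  shows "\<exists>s. flag_graph D t0 s t2 l \<and> excess D t0 s t2 = excess D t0 t1 t2 + 2"
proof -
  note g = flag_graphD[OF G]
  have "(a, t1 a) \<in> reach D t1 t2" by (rule r_into_rtrancl) (simp add: ab)
  then have "t1 a \<noteq> b" "a \<noteq> b" using v by auto
  then have j: "joinable D t1 a b" using g(3,5) ab by unfold_locales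
  have "(t1 b, b) \<in> fr D t1 \<union> fr D t2" using fiD[OF g(5) ab(2)] by simp
  then have v': "(a, t1 b) \<notin> reach D t1 t2" using v rtrancl.rtrancl_into_rtrancl by metis
  obtain c where c: "c = b \<or> c = t1 b" "joinable D t1 a c" "ncyc D (join t1 a c) t0 = ncyc D t1 t0 + 1"
    using join_split_either[OF j g(4) f] j by blast
  have "(a, c) \<notin> reach D t1 t2" "l a = l c" using c(1) v v' ab g(8) by auto
  then show ?thesis
    using joinable_rel2.nclass_join_merge[OF joinable_relI[OF c(2) g(6)]] c(3) G rotation_join[OF g(2) c(2)]
    by (intro exI[of _ "join t1 a c"]) (simp add: flag_graph_def excess_def)
qed

text \<open>The budget is -1 for an isolated new edge, 0 for attaching its first end at
  \<open>a\<close>, and +2 for attaching its second end at \<open>b\<close>, which by then lies on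
  the same face but in another rotation cycle.\<close>

lemma realizable_add_chord:
  assumes D: "flag_graph D t0 t1 t2 l" "card D = 4 * m" and ab: "a \<in> D" "b \<in> D"
    "(a, b) \<in> reach D t1 t0"
  shows "realizable (l ` D) (insert {l a, l b} (edge_set D t0 l)) (m + 1) (excess D t0 t1 t2 + 1)"
proof -
  obtain n N u0 u1 u2 h where N: "n \<in> N" "N \<inter> D = {}" "card N = 4" "finite N"
    "flag_graph N u0 u1 u2 h" "flag_graph (D \<union> N) u0 u1 u2 h" "flag_graph D u0 u1 u2 h"
    "\<forall>d\<in>D. u0 d = t0 d \<and> u1 d = t1 d \<and> u2 d = t2 d \<and> h d = l d"
    "\<forall>d\<in>N. u1 d = u2 d" "h n = l a" "h (u0 n) = l b"
    "edge_set (D \<union> N) u0 h = insert {l a, l b} (edge_set D t0 l)" "h ` (D \<union> N) = l ` D \<union> {l a, l b}"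
    "excess (D \<union> N) u0 u1 u2 = excess D t0 t1 t2 - 1" by (rule add_single_edge[OF D(1), where p = "l a" and q = "l b"])
  let ?D = "D \<union> N"
  note GN = flag_graphD[OF N(5)] and GD = flag_graphD[OF N(7)]
  have dis: "d \<in> D \<Longrightarrow> d \<notin> N" for d using N(2) by blast
  have cl: "u0 ` D \<subseteq> D" "u1 ` D \<subseteq> D" "u2 ` D \<subseteq> D"
    using fiD(1)[OF GD(4)] fiD(1)[OF GD(5)] fiD(1)[OF GD(6)] by auto
  have n: "n \<in> ?D - D" "h a = h n" using N(1,2,10) N(8)[rule_format, OF ab(1)] by auto
  note J = join_across[OF N(6) Un_upper1 cl ab(1) n]
  let ?f = "join u1 a n"
  interpret J1: joinable ?D u1 a n by (rule J(3))
  define c where "c = u0 n"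
  have cN: "c \<in> N" "c \<noteq> n" "u2 c \<in> N"
    using fiD[OF GN(4) N(1)] fiD(1)[OF GN(6), of "u0 n"] by (simp_all add: c_def)
  have "c \<noteq> u2 n"
  proof
    assume "c = u2 n"
    then have "u0 (u2 n) = n" using fiD(2)[OF GN(4) N(1)] unfolding c_def by metis
    then show False using flag_systemD(5)[OF GN(1) N(1)] by simp
  qed
  then have "c \<notin> {a, u1 a, n, u1 n}" using cN N(1,9) dis ab cl(2) by auto
  then have fc: "?f c = u2 c" using J1.join_other N(9) cN(1) by simp
  have ffc: "?f (u2 c) = c" using fiD(2)[OF J1.fi_join, of c] cN fc by simp
  have "fr D t1 \<union> fr D t0 \<subseteq> fr ?D u1 \<union> fr ?D u0" using N(8) by auto
  then have "(a, b) \<in> reach ?D u1 u0" using ab(3) rtrancl_mono by blast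
  moreover have "(n, c) \<in> reach ?D u1 u0" by (rule r_into_rtrancl) (simp add: c_def N(1))
  ultimately have bc: "(c, b) \<in> reach ?D ?f u0"
    using J(4) flag_graphD(4,5)[OF J(1)] by (meson fr_sym sym_Un sym_rtrancl symD)
  \<comment> \<open>The far end of the new edge is still unattached: its rotation cycle consists of
    \<open>c\<close> and \<open>u2 c\<close>.\<close>
  have vsep: "(c, b) \<notin> reach ?D ?f u2"
  proof
    assume "(c, b) \<in> reach ?D ?f u2"
    then have "b \<in> {c, u2 c}"
      by (rule rtrancl_closed) (use fc ffc fiD(2)[OF GN(6) cN(1)] in auto)
    then show False using cN dis ab by auto
  qed
  have hcb: "h c = h b" using N(11) N(8)[rule_format, OF ab(2)] by (simp add: c_def)
  have "c \<in> ?D" "b \<in> ?D" using cN(1) ab(2) by simp_all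
  then obtain s where s: "flag_graph ?D u0 s u2 h" "excess ?D u0 s u2 = excess ?D u0 ?f u2 + 2"
    using join_cofacial[OF J(1) _ _ hcb bc vsep] by blast
  have "excess ?D u0 s u2 = excess D t0 t1 t2 + 1" using s(2) J(2) N(14) by simp
  moreover have "card ?D = 4 * (m + 1)"
    using card_Un_disjoint[of D N] N(2,3,4) D(2) flag_graphD(3)[OF D(1)] by (simp add: Int_commute)
  moreover have "h ` ?D = l ` D" using N(13) ab by auto
  ultimately show ?thesis using s(1) N(12) unfolding realizable_def by metis
qed

subsection \<open>Flag graphs and the Euler genus\<close>

text \<open>A merge removes one rotation cycle and at most one face; the number of cycles is the
  measure of the induction.\<close>

lemma merge_vertices:
  assumes "flag_graph D t0 t1 t2 l"
  shows "\<exists>s. flag_graph D t0 s t2 l \<and> excess D t0 t1 t2 \<le> excess D t0 s t2 \<and>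
    (\<forall>d\<in>D. \<forall>d'\<in>D. l d = l d' \<longrightarrow> (d, d') \<in> reach D s t2)"
  using assms
proof (induction "ncyc D t1 t2" arbitrary: t1 rule: less_induct)
  case less
  note G = flag_graphD[OF less.prems]
  show ?case
  proof (cases "\<forall>d\<in>D. \<forall>d'\<in>D. l d = l d' \<longrightarrow> (d, d') \<in> reach D t1 t2")
    case False
    then obtain a b where ab: "a \<in> D" "b \<in> D" "l a = l b" "(a, b) \<notin> reach D t1 t2" by blast
    have "(a, t1 a) \<in> reach D t1 t2" by (rule r_into_rtrancl) (simp add: ab)
    then have "t1 a \<noteq> b" using ab(4) by metis
    moreover have "a \<noteq> b" using ab(4) by blast
    ultimately have j: "joinable D t1 a b" using G(3,5) ab by unfold_locales auto
    interpret V: joinable_rel2 D t1 a b "fr D t2" t2 by (rule joinable_relI[OF j G(6)])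
    interpret F: joinable_rel2 D t1 a b "fr D t0" t0 by (rule joinable_relI[OF j G(4)])
    have v: "ncyc D (join t1 a b) t2 + 1 = ncyc D t1 t2" by (rule V.nclass_join_merge[OF ab(4)])
    then have P: "excess D t0 t1 t2 \<le> excess D t0 (join t1 a b) t2"
      using F.nclass_join_ge unfolding excess_def by linarith
    have "flag_graph D t0 (join t1 a b) t2 l"
      using less.prems rotation_join[OF G(2) j ab(3)] by (simp add: flag_graph_def)
    moreover have "ncyc D (join t1 a b) t2 < ncyc D t1 t2" using v by simp
    ultimately show ?thesis using less.hyps P by (meson order_trans)
  qed (use less.prems in blast)
qed

lemma vertex_class_label:
  assumes G: "flag_graph D t0 t1 t2 l" and d: "d \<in> D"
    and conn: "\<And>d'. d' \<in> D \<Longrightarrow> l d' = l d \<Longrightarrow> (d, d') \<in> reach D t1 t2"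
  shows "reach D t1 t2 `` {d} = {d' \<in> D. l d' = l d}"
proof (intro equalityI subsetI)
  note g = flag_graphD[OF G]
  fix z assume "z \<in> reach D t1 t2 `` {d}"
  then have "(d, z) \<in> reach D t1 t2" by simp
  then show "z \<in> {d' \<in> D. l d' = l d}"
  proof (rule rtrancl_closed)
    fix u v assume "(u, v) \<in> fr D t1 \<union> fr D t2" "u \<in> {d' \<in> D. l d' = l d}"
    then show "v \<in> {d' \<in> D. l d' = l d}" using g(7,8) fiD(1)[OF g(5)] fiD(1)[OF g(6)] by auto
  qed (use d in simp)
qed (use conn in auto)

lemma vertex_classes:
  assumes G: "flag_graph D t0 t1 t2 l"
    and conn: "\<And>d d'. d \<in> D \<Longrightarrow> d' \<in> D \<Longrightarrow> l d' = l d \<Longrightarrow> (d, d') \<in> reach D t1 t2"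
  shows "D // reach D t1 t2 = (\<lambda>v. {d \<in> D. l d = v}) ` l ` D"
    and "ncyc D t1 t2 = card (l ` D)"
proof -
  show 1: "D // reach D t1 t2 = (\<lambda>v. {d \<in> D. l d = v}) ` l ` D"
    unfolding quotient_image image_image
    by (rule image_cong[OF refl]) (rule vertex_class_label[OF G _ conn])
  have "inj_on (\<lambda>v. {d \<in> D. l d = v}) (l ` D)" by (rule inj_onI) blast
  then show "ncyc D t1 t2 = card (l ` D)" unfolding nclass_def 1 by (rule card_image)
qed

lemma nclass_connected:
  assumes "D \<noteq> {}" "\<And>d d'. d \<in> D \<Longrightarrow> d' \<in> D \<Longrightarrow> (d, d') \<in> r\<^sup>*" "r \<subseteq> D \<times> D"
  shows "nclass D r = 1"
proof -
  have "r\<^sup>* `` {d} = D" if "d \<in> D" for d using assms(2)[OF that] class_subset[OF assms(3) that] by blast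
  then have "D // r\<^sup>* = {D}" using assms(1) unfolding quotient_image by auto
  then show ?thesis by (simp add: nclass_def)
qed

text \<open>After the cycles of every vertex have been merged, connectedness of \<open>H\<close>
  makes the flags a connected surface, and Euler's inequality turns its genus into a natural number.
  \<open>H\<close> may omit edges of \<open>E\<close>, so auxiliary edges in a realization do no
  harm.\<close>

lemma realizable_surface:
  assumes R: "realizable V E m \<phi>" and H: "connected_graph H" "verts H = V" "edges H \<subseteq> E"
  shows "\<exists>M k. closed_surface M \<and> surface_euler_genus M = int k \<and> embeds_in H M \<and>
    int k \<le> 2 + int m - 2 * int (card V) - \<phi>"
proof -
  obtain D t0 t t2 l where D: "flag_graph D t0 t t2 l" "l ` D = V" "edge_set D t0 l = E"
    "card D = 4 * m" "excess D t0 t t2 = \<phi>" using R by (auto simp: realizable_def)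
  obtain t1 where G: "flag_graph D t0 t1 t2 l" and P: "excess D t0 t t2 \<le> excess D t0 t1 t2"
    and conn: "\<And>d d'. d \<in> D \<Longrightarrow> d' \<in> D \<Longrightarrow> l d = l d' \<Longrightarrow> (d, d') \<in> reach D t1 t2"
    using merge_vertices[OF D(1)] by blast
  have conn': "\<And>d d'. d \<in> D \<Longrightarrow> d' \<in> D \<Longrightarrow> l d' = l d \<Longrightarrow> (d, d') \<in> reach D t1 t2"
    using conn by metis
  note g = flag_graphD[OF G]
  let ?r = "fr D t0 \<union> fr D t1 \<union> fr D t2"
  have sub: "fr D t1 \<union> fr D t2 \<subseteq> ?r" by blast
  have lift: "(d, d') \<in> ?r\<^sup>*" if "(d, d') \<in> reach D t1 t2" for d d'
    using that rtrancl_mono[OF sub] by blast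
  have edge: "\<exists>d\<in>D. l d = u \<and> l (t0 d) = v" if uv: "{u, v} \<in> edges H" for u v
  proof -
    have "{u, v} \<in> edge_set D t0 l" using uv H(3) D(3) by blast
    then obtain d where d: "d \<in> D" "{u, v} = {l d, l (t0 d)}" unfolding edge_set_def by blast
    then consider "l d = u \<and> l (t0 d) = v" | "l d = v \<and> l (t0 d) = u" by (auto simp: doubleton_eq_iff)
    then show ?thesis
    proof cases
      case 2
      then have "l (t0 d) = u \<and> l (t0 (t0 d)) = v" using fiD(2)[OF g(4) d(1)] by simp
      then show ?thesis using fiD(1)[OF g(4) d(1)] by blast
    qed (use d in blast)
  qed
  \<comment> \<open>A step of a walk in \<open>H\<close> lifts to a step along \<open>t0\<close>,
    and flags with the same label are connected by the rotation at their vertex.\<close>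
  have walk: "\<forall>d\<in>D. \<forall>d'\<in>D. l d = u \<longrightarrow> l d' = v \<longrightarrow> (d, d') \<in> ?r\<^sup>*"
    if "(u, v) \<in> {(a, b). {a, b} \<in> edges H}\<^sup>*" for u v
    using that
  proof (induction rule: rtrancl_induct)
    case base
    then show ?case using conn lift by metis
  next
    case (step v w)
    show ?case
    proof (intro ballI impI)
      fix d d' assume d: "d \<in> D" "d' \<in> D" "l d = u" "l d' = w"
      obtain e where e: "e \<in> D" "l e = v" "l (t0 e) = w" using edge step.hyps(2) by blast
      have 1: "(d, e) \<in> ?r\<^sup>*" using step.IH d e by blast
      have 2: "(e, t0 e) \<in> ?r\<^sup>*" by (rule r_into_rtrancl) (simp add: e)
      have 3: "(t0 e, d') \<in> ?r\<^sup>*" using lift[OF conn[OF fiD(1)[OF g(4) e(1)] d(2)]] e d by simp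
      show "(d, d') \<in> ?r\<^sup>*" using 1 2 3 by (meson rtrancl_trans)
    qed
  qed
  have all: "(d, d') \<in> ?r\<^sup>*" if "d \<in> D" "d' \<in> D" for d d'
  proof -
    have "l d \<in> verts H" "l d' \<in> verts H" using that D(2) H(2) by auto
    then have "(l d, l d') \<in> {(a, b). {a, b} \<in> edges H}\<^sup>*" using H(1) by (simp add: connected_graph_def)
    then show ?thesis using walk that by blast
  qed
  have ne: "D \<noteq> {}" using H(1,2) D(2) by (auto simp: connected_graph_def)
  define M where "M = \<lparr>flags = D, flip0 = t0, flip1 = t1, flip2 = t2\<rparr>"
  have M: "closed_surface M"
    unfolding closed_surface_def M_def using g ne all flag_systemD(4,5)[OF g(1)] by simp
  have c0: "cells0 M = (\<lambda>v. {d \<in> D. l d = v}) ` V"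
    unfolding D(2)[symmetric] cells0_def orbits_def M_def cell_surface.simps
    by (rule vertex_classes(1)[OF G]) (rule conn')
  have n0: "ncyc D t1 t2 = card V"
    unfolding D(2)[symmetric] by (rule vertex_classes(2)[OF G]) (rule conn')
  have k0: "card (cells0 M) = card V" using n0 by (simp add: cells0_def orbits_def M_def nclass_def)
  have n1: "ncyc D t0 t2 = m" using ncyc_edges[OF g(1)] D(4) by simp
  have k1: "card (cells1 M) = m" using n1 by (simp add: cells1_def orbits_def M_def nclass_def)
  have "cells2 M = D // reach D t1 t0"
    by (subst Un_commute) (simp only: cells2_def orbits_def M_def cell_surface.simps)
  then have k2: "card (cells2 M) = ncyc D t1 t0" by (simp only: nclass_def)
  have "nclass D (fr D t1 \<union> (fr D t0 \<union> fr D t2)) = 1"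
  proof (rule nclass_connected[OF ne])
    have "fr D t1 \<union> (fr D t0 \<union> fr D t2) = ?r" by blast
    then show "(d, d') \<in> (fr D t1 \<union> (fr D t0 \<union> fr D t2))\<^sup>*" if "d \<in> D" "d' \<in> D" for d d'
      using all[OF that] by simp
    show "fr D t1 \<union> (fr D t0 \<union> fr D t2) \<subseteq> D \<times> D" using g by (simp add: fr_sub)
  qed
  then have flag_genus: "flag_genus D t0 t1 t2 = surface_euler_genus M"
    using n0 n1 k0 k1 k2 unfolding flag_genus_def surface_euler_genus_def euler_char_def by simp
  then have "surface_euler_genus M \<ge> 0" using flag_genus_nonneg[OF g(1,5)] by simp
  then obtain k where k: "surface_euler_genus M = int k" using nonneg_int_cases by blast
  have "embeds_in H M"
    unfolding embeds_in_def
  proof (intro exI conjI allI impI)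
    let ?\<phi> = "\<lambda>v. {d \<in> D. l d = v}"
    show "inj_on ?\<phi> (verts H)"
    proof (rule inj_onI)
      fix u v assume uv: "u \<in> verts H" "v \<in> verts H" "?\<phi> u = ?\<phi> v"
      then obtain d where "d \<in> D" "l d = u" using D(2) H(2) by auto
      then show "u = v" using uv(3) by blast
    qed
    show "?\<phi> ` verts H \<subseteq> cells0 M" using c0 H(2) by simp
    fix u v assume "{u, v} \<in> edges H"
    then obtain d where "d \<in> D" "l d = u" "l (t0 d) = v" using edge by blast
    then show "\<exists>d\<in>flags M. d \<in> ?\<phi> u \<and> flip0 M d \<in> ?\<phi> v"
      using fiD(1)[OF g(4)] by (auto simp: M_def)
  qed
  moreover have "int k \<le> 2 + int m - 2 * int (card V) - \<phi>"
    using k P D(5) n0 k0 k1 k2 unfolding surface_euler_genus_def euler_char_def excess_def by linarith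
  ultimately show ?thesis using M k by blast
qed

lemma euler_genus_upper:
  assumes "realizable V E m \<phi>" "connected_graph H" "verts H = V" "edges H \<subseteq> E"
  shows "int (euler_genus H) \<le> 2 + int m - 2 * int (card V) - \<phi>"
proof -
  obtain M k where "closed_surface M \<and> surface_euler_genus M = int k \<and> embeds_in H M"
    "int k \<le> 2 + int m - 2 * int (card V) - \<phi>" using realizable_surface[OF assms] by blast
  moreover from this(1) have "euler_genus H \<le> k" unfolding euler_genus_def by (intro Least_le) blast
  ultimately show ?thesis by linarith
qed

lemma connected_incident:
  assumes "connected_graph H" "v \<in> verts H" "u \<in> verts H" "u \<noteq> v"
  shows "\<exists>w. {v, w} \<in> edges H"
proof -
  have "(v, u) \<in> {(a, b). {a, b} \<in> edges H}\<^sup>*" using assms by (simp add: connected_graph_def)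
  then show ?thesis using assms(4) by (cases rule: converse_rtranclE) auto
qed

text \<open>A second vertex and connectedness exclude isolated vertices, which no flag would
  see.\<close>

lemma verts_union:
  assumes "simple_graph H" "connected_graph H" "v \<in> verts H" "u \<in> verts H" "u \<noteq> v"
  shows "\<Union> (edges H) = verts H"
proof (intro equalityI subsetI)
  fix w assume "w \<in> verts H"
  then obtain z where "{w, z} \<in> edges H" using connected_incident[OF assms(2)] assms(3,4,5) by metis
  then show "w \<in> \<Union> (edges H)" by blast
qed (use assms(1) in \<open>auto simp: simple_graph_def\<close>)

text \<open>All edges as separate components. Nothing is claimed about the genus; the point is that
  the \<open>LEAST\<close> in \<open>euler_genus\<close> ranges over a nonempty set.\<close>

lemma realizable_exists:
  assumes "finite E" "\<And>e. e \<in> E \<Longrightarrow> card e = 2"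
  shows "\<exists>\<phi>. realizable (\<Union> E) E (card E) \<phi>"
  using assms
proof (induction E rule: finite_induct)
  case empty
  have "realizable {} {} 0 (excess {} id id id)"
    unfolding realizable_def flag_graph_def flag_system_def rotation_def edge_set_def
    by (intro exI[of _ "{}"] exI[of _ id] exI[of _ undefined]) (simp add: free_involution_on_def)
  then show ?case by auto
next
  case (insert e E)
  obtain p q where e: "e = {p, q}" using insert.prems[of e] by (auto simp: card_2_iff)
  obtain \<phi> where "realizable (\<Union> E) E (card E) \<phi>" using insert by auto
  from realizable_add_edge[OF this, of p q] show ?case
    using insert.hyps by (auto simp: e Un_commute intro!: exI[of _ "\<phi> - 1"])
qed

lemma simple_graph_finite_edges: "simple_graph H \<Longrightarrow> finite (edges H)"
  unfolding simple_graph_def by (meson PowI finite_Pow_iff finite_subset subsetI)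

lemma euler_genus_attained:
  assumes "simple_graph H" "connected_graph H" "v \<in> verts H" "u \<in> verts H" "u \<noteq> v"
  obtains M where "closed_surface M" "surface_euler_genus M = int (euler_genus H)" "embeds_in H M"
proof -
  have "\<exists>\<phi>. realizable (\<Union> (edges H)) (edges H) (card (edges H)) \<phi>"
    using assms(1) simple_graph_finite_edges by (intro realizable_exists) (auto simp: simple_graph_def)
  then have "\<exists>k M. closed_surface M \<and> surface_euler_genus M = int k \<and> embeds_in H M"
    using realizable_surface[OF _ assms(2)] verts_union[OF assms] by blast
  then have "\<exists>M. closed_surface M \<and> surface_euler_genus M = int (euler_genus H) \<and> embeds_in H M"
    unfolding euler_genus_def by (rule LeastI_ex)
  then show thesis using that by blast
qed

text \<open>The converse of \<open>euler_genus_upper\<close>. From an optimal surface one 1-cell per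
  edge of \<open>H\<close> is kept and everything else is detached; the detached part has genus 0
  and the total has not grown, so the kept part obeys the bound.\<close>

lemma euler_genus_realized:
  assumes H: "simple_graph H" "connected_graph H" "v \<in> verts H" "u \<in> verts H" "u \<noteq> v"
  obtains D t0 t1 t2 l where "flag_graph D t0 t1 t2 l" "l ` D = verts H" "edge_set D t0 l = edges H"
    "card D = 4 * card (edges H)"
    "2 + int (card (edges H)) - 2 * int (card (verts H)) - excess D t0 t1 t2 \<le> int (euler_genus H)"
proof -
  obtain M where M: "closed_surface M" "surface_euler_genus M = int (euler_genus H)" "embeds_in H M"
    by (rule euler_genus_attained[OF H])
  define D t0 t1 t2 where "D = flags M" "t0 = flip0 M" "t1 = flip1 M" "t2 = flip2 M"
  note defs = D_t0_t1_t2_def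
  have F: "flag_system D t0 t2" and f1: "fi D t1" and ne: "D \<noteq> {}"
    and all: "\<And>d d'. d \<in> D \<Longrightarrow> d' \<in> D \<Longrightarrow> (d, d') \<in> (fr D t0 \<union> fr D t1 \<union> fr D t2)\<^sup>*"
    using M(1) by (auto simp: closed_surface_def flag_system_def defs)
  note g = flag_systemD[OF F]
  let ?R = "reach D t1 t2"
  have symR: "sym (fr D t1 \<union> fr D t2)" using f1 g by (simp add: sym_Un fr_sym)
  define C where "C d = ?R `` {d}" for d
  have C2: "C (t2 d) = C d" if "d \<in> D" for d
    unfolding C_def class_eq_iff[OF symR] using that g(3) by (auto intro!: r_into_rtrancl simp: fiD)
  have cells: "cells0 M = C ` D" by (simp add: cells0_def orbits_def quotient_image defs C_def)
  obtain \<phi> where \<phi>: "inj_on \<phi> (verts H)" "\<phi> ` verts H \<subseteq> C ` D"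
    "\<And>u v. {u, v} \<in> edges H \<Longrightarrow> \<exists>d\<in>D. d \<in> \<phi> u \<and> t0 d \<in> \<phi> v"
    using M(3) cells by (auto simp: embeds_in_def defs)
  have cell: "C d = \<phi> u" if d: "d \<in> \<phi> u" and u: "u \<in> verts H" for d u
  proof -
    obtain d' where d': "\<phi> u = C d'" using \<phi>(2) u by blast
    then have "(d', d) \<in> ?R" using d by (simp add: C_def)
    with d' show ?thesis using class_eq_iff[OF symR] by (metis C_def)
  qed
  define l where "l d = inv_into (verts H) \<phi> (C d)" for d
  have l: "l d = u" if "d \<in> \<phi> u" "u \<in> verts H" for d u
    using cell[OF that] inv_into_f_f[OF \<phi>(1) that(2)] by (simp add: l_def)
  have edge_verts: "e \<subseteq> verts H \<and> card e = 2" if "e \<in> edges H" for e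
    using that H(1) by (simp add: simple_graph_def)
  have ex: "\<exists>d. d \<in> D \<and> C d \<in> \<phi> ` verts H \<and> C (t0 d) \<in> \<phi> ` verts H \<and> {l d, l (t0 d)} = e" if e: "e \<in> edges H" for e
  proof -
    obtain u v where uv: "e = {u, v}" using edge_verts[OF e] by (auto simp: card_2_iff)
    then obtain d where d: "d \<in> D" "d \<in> \<phi> u" "t0 d \<in> \<phi> v" using \<phi>(3) e by blast
    have "u \<in> verts H" "v \<in> verts H" using edge_verts[OF e] uv by auto
    then show ?thesis using d l cell uv by blast
  qed
  \<comment> \<open>The label \<open>l\<close> is arbitrary on cells that are not images of vertices
    of \<open>H\<close>. The conditions on \<open>C\<close> rule these out, since otherwise two
    different cells might receive the same label.\<close>
  define sel where "sel e = (SOME d. d \<in> D \<and> C d \<in> \<phi> ` verts H \<and> C (t0 d) \<in> \<phi> ` verts H \<and> {l d, l (t0 d)} = e)" for e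
  have sel: "sel e \<in> D" "C (sel e) \<in> \<phi> ` verts H" "C (t0 (sel e)) \<in> \<phi> ` verts H" "{l (sel e), l (t0 (sel e))} = e"
    if "e \<in> edges H" for e
    using someI_ex[OF ex[OF that]] unfolding sel_def by blast+
  let ?E = "reach D t0 t2"
  define S where "S = (\<Union>e\<in>edges H. ?E `` {sel e})"
  have SD: "S \<subseteq> D" unfolding S_def using class_subset[of "fr D t0 \<union> fr D t2" D] g sel(1) by (auto simp: fr_sub)
  have inS: "\<exists>e\<in>edges H. d \<in> {sel e, t0 (sel e), t2 (sel e), t0 (t2 (sel e))}" if "d \<in> S" for d
    using that class_edge[OF F sel(1)] unfolding S_def by blast
  have S0: "t0 d \<in> S" "t2 d \<in> S" if dS: "d \<in> S" for d
  proof -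
    obtain e where e: "e \<in> edges H" "(sel e, d) \<in> ?E" using dS by (auto simp: S_def)
    have "(d, t0 d) \<in> fr D t0 \<union> fr D t2" "(d, t2 d) \<in> fr D t0 \<union> fr D t2" using that SD by auto
    then have "(sel e, t0 d) \<in> ?E" "(sel e, t2 d) \<in> ?E" using e(2) by (meson rtrancl.rtrancl_into_rtrancl)+
    then show "t0 d \<in> S" "t2 d \<in> S" using e(1) by (auto simp: S_def)
  qed
  have ends: "{l d, l (t0 d)} = e \<and> C d \<in> \<phi> ` verts H"
    if "e \<in> edges H" "d \<in> {sel e, t0 (sel e), t2 (sel e), t0 (t2 (sel e))}" for e d
  proof -
    let ?s = "sel e"
    have s: "?s \<in> D" "t0 ?s \<in> D" "t2 ?s \<in> D" using sel(1)[OF that(1)] fiD(1)[OF g(2)] fiD(1)[OF g(3)] by simp_all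
    have "t0 (t0 ?s) = ?s" "t0 (t0 (t2 ?s)) = t2 ?s" using s fiD(2)[OF g(2)] by simp_all
    moreover have "t0 (t2 ?s) = t2 (t0 ?s)" using g(4) s by simp
    moreover have "C (t2 ?s) = C ?s" "C (t2 (t0 ?s)) = C (t0 ?s)" using C2 s by simp_all
    moreover from this have "l (t2 ?s) = l ?s" "l (t2 (t0 ?s)) = l (t0 ?s)" by (simp_all add: l_def)
    ultimately show ?thesis using that(2) sel(2-4)[OF that(1)] by (auto simp: insert_commute)
  qed
  have ES: "edge_set S t0 l = edges H"
  proof (intro equalityI subsetI)
    fix e assume "e \<in> edge_set S t0 l"
    then show "e \<in> edges H" using inS ends unfolding edge_set_def by (metis (no_types, lifting) imageE)
  next
    fix e assume e: "e \<in> edges H"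
    then have "sel e \<in> S" by (auto simp: S_def)
    then show "e \<in> edge_set S t0 l" unfolding edge_set_def using sel(4)[OF e] by blast
  qed
  have CS: "C d \<in> \<phi> ` verts H" if "d \<in> S" for d using inS[OF that] ends by blast
  have lC: "\<phi> (l d) = C d" "l d \<in> verts H" if "d \<in> S" for d
    using f_inv_into_f[OF CS[OF that]] inv_into_into[OF CS[OF that]] by (simp_all add: l_def)
  have LS: "l ` S = verts H"
  proof -
    have "\<Union> (edge_set S t0 l) = l ` S" unfolding edge_set_def using S0(1) by auto
    then show ?thesis using ES verts_union[OF H] by simp
  qed
  have FS: "flag_system S t0 t2" by (rule flag_system_subset[OF F SD S0])
  have cardS: "card S = 4 * card (edges H)"
  proof -
    have "card (\<Union> ((\<lambda>e. ?E `` {sel e}) ` edges H)) = (\<Sum>c\<in>(\<lambda>e. ?E `` {sel e}) ` edges H. card c)"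
    proof (rule card_Union_disjoint)
      have disj: "e = e'" if "e \<in> edges H" "e' \<in> edges H" "z \<in> ?E `` {sel e}" "z \<in> ?E `` {sel e'}" for e e' z
      proof -
        have "z \<in> {sel e, t0 (sel e), t2 (sel e), t0 (t2 (sel e))}"
          using that(3) unfolding class_edge[OF F sel(1)[OF that(1)]] .
        moreover have "z \<in> {sel e', t0 (sel e'), t2 (sel e'), t0 (t2 (sel e'))}"
          using that(4) unfolding class_edge[OF F sel(1)[OF that(2)]] .
        ultimately have "{l z, l (t0 z)} = e" "{l z, l (t0 z)} = e'"
          using ends[OF that(1)] ends[OF that(2)] by blast+
        then show ?thesis by simp
      qed
      show "pairwise disjnt ((\<lambda>e. ?E `` {sel e}) ` edges H)"
        unfolding pairwise_def disjnt_def using disj by blast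
      show "finite c" if "c \<in> (\<lambda>e. ?E `` {sel e}) ` edges H" for c
      proof -
        obtain e where e: "e \<in> edges H" "c = ?E `` {sel e}" using \<open>c \<in> _\<close> by blast
        show ?thesis unfolding e(2) class_edge[OF F sel(1)[OF e(1)]] by simp
      qed
    qed
    also have "\<dots> = (\<Sum>c\<in>(\<lambda>e. ?E `` {sel e}) ` edges H. 4)"
    proof (rule sum.cong)
      fix c assume "c \<in> (\<lambda>e. ?E `` {sel e}) ` edges H"
      then obtain e where e: "e \<in> edges H" "c = ?E `` {sel e}" by blast
      show "card c = 4" unfolding e(2) class_edge[OF F sel(1)[OF e(1)]]
        by (rule card_edge_class[OF F sel(1)[OF e(1)]])
    qed simp
    also have "\<dots> = 4 * card ((\<lambda>e. ?E `` {sel e}) ` edges H)" by simp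
    also have "inj_on (\<lambda>e. ?E `` {sel e}) (edges H)"
    proof (rule inj_onI)
      fix e e' assume e: "e \<in> edges H" "e' \<in> edges H" "?E `` {sel e} = ?E `` {sel e'}"
      then have "sel e' \<in> ?E `` {sel e}" by blast
      then have "sel e' \<in> {sel e, t0 (sel e), t2 (sel e), t0 (t2 (sel e))}"
        unfolding class_edge[OF F sel(1)[OF e(1)]] .
      then show "e = e'" using ends[OF e(1)] sel(4)[OF e(2)] by metis
    qed
    then have "card ((\<lambda>e. ?E `` {sel e}) ` edges H) = card (edges H)" by (rule card_image)
    finally show ?thesis by (simp add: S_def)
  qed
  have J0: "t0 d \<in> D - S" "t2 d \<in> D - S" if "d \<in> D - S" for d
    using that S0(1)[of "t0 d"] S0(2)[of "t2 d"] fiD[OF g(2), of d] fiD[OF g(3), of d] by auto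
  \<comment> \<open>Inside \<open>S\<close> the vertex classes are the same for \<open>s\<close> as
    for \<open>t1\<close>; therefore \<open>l\<close> remains constant along the new
    rotation.\<close>
  then obtain s where s: "fi D s" "\<forall>d\<in>D - S. s d = t2 d" "flag_genus D t0 s t2 \<le> flag_genus D t0 t1 t2"
    and same: "\<And>d d'. d \<in> S \<Longrightarrow> d' \<in> S \<Longrightarrow> (d, d') \<in> reach D s t2 \<longleftrightarrow> (d, d') \<in> ?R"
    using detach_all[OF F, of "D - S" t1] f1 by blast
  have sS: "s d \<in> S" if "d \<in> S" for d
  proof (rule ccontr)
    assume "s d \<notin> S"
    then have n: "s d \<in> D - S" using fiD(1)[OF s(1)] that SD by blast
    then have "s (s d) = t2 (s d)" using s(2) by blast
    then have "d = t2 (s d)" using fiD(2)[OF s(1)] that SD by auto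
    then have "t2 d = s d" using fiD(2)[OF g(3), of "s d"] n by auto
    then show False using S0(2)[OF that] n by simp
  qed
  have fS: "fi S s" by (rule fi_subset[OF s(1) SD sS])
  have lCeq: "l d = l d' \<longleftrightarrow> (d, d') \<in> ?R" if "d \<in> S" "d' \<in> S" for d d'
  proof -
    have "l d = l d' \<longleftrightarrow> C d = C d'" using lC that by (metis l_def)
    then show ?thesis using class_eq_iff[OF symR] by (simp add: C_def)
  qed
  have G: "flag_graph S t0 s t2 l"
    unfolding flag_graph_def rotation_def
  proof (intro conjI ballI FS fS)
    fix d assume d: "d \<in> S"
    have "(s d, d) \<in> fr D s \<union> fr D t2" using d sS SD fiD(2)[OF fS d] by auto
    then show "l (s d) = l d" using lCeq[OF sS[OF d] d] same[OF sS[OF d] d] by blast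
    show "l (t2 d) = l d" using C2 d SD by (auto simp: l_def)
  qed
  have connS: "(d, d') \<in> reach S s t2" if d: "d \<in> S" "d' \<in> S" "l d' = l d" for d d'
  proof -
    have "(d, d') \<in> reach D s t2" using lCeq same d by metis
    then have "d' \<in> reach S s t2 `` {d}"
    proof (rule rtrancl_closed)
      fix u v assume uv: "(u, v) \<in> fr D s \<union> fr D t2" "u \<in> reach S s t2 `` {d}"
      have "u \<in> S" using uv(2) class_subset[of "fr S s \<union> fr S t2" S d] d(1) fr_sub[OF fS] fr_sub[OF flag_systemD(3)[OF FS]] by blast
      then have "(u, v) \<in> fr S s \<union> fr S t2" using uv(1) by auto
      then show "v \<in> reach S s t2 `` {d}" using uv(2) by (auto intro: rtrancl.rtrancl_into_rtrancl)
    qed simp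
    then show ?thesis by simp
  qed
  have nv: "ncyc S s t2 = card (verts H)"
    unfolding LS[symmetric] by (rule vertex_classes(2)[OF G]) (rule connS)
  have DS: "S \<union> (D - S) = D" using SD by blast
  have FJ: "flag_system (D - S) t0 t2"
    by (rule flag_system_subset[OF F Diff_subset J0])
  have fJ: "fi (D - S) s" using flag_systemD(3)[OF FJ] s(2) fi_cong[of "D - S" s t2] by blast
  have "flag_genus (S \<union> (D - S)) t0 s t2 = flag_genus S t0 s t2 + flag_genus (D - S) t0 s t2"
    by (rule flag_genus_Un) (simp_all add: flag_systemD[OF FS] flag_systemD[OF FJ] fS fJ)
  moreover have "flag_genus (D - S) t0 s t2 = 0" using flag_genus_detached[OF FJ] s(2) by blast
  ultimately have egS: "flag_genus S t0 s t2 \<le> flag_genus D t0 t1 t2" using s(3) unfolding DS by simp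
  have "nclass D (fr D t1 \<union> (fr D t0 \<union> fr D t2)) = 1"
  proof (rule nclass_connected[OF ne])
    have "fr D t1 \<union> (fr D t0 \<union> fr D t2) = fr D t0 \<union> fr D t1 \<union> fr D t2" by blast
    then show "(d, d') \<in> (fr D t1 \<union> (fr D t0 \<union> fr D t2))\<^sup>*" if "d \<in> D" "d' \<in> D" for d d'
      using all[OF that] by simp
    show "fr D t1 \<union> (fr D t0 \<union> fr D t2) \<subseteq> D \<times> D" using g f1 by (simp add: fr_sub)
  qed
  moreover have "card (cells0 M) = ncyc D t1 t2" "card (cells1 M) = ncyc D t0 t2"
    by (simp_all only: nclass_def cells0_def cells1_def orbits_def defs)
  moreover have "cells2 M = D // reach D t1 t0"
    by (subst Un_commute) (simp only: cells2_def orbits_def defs)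
  then have "card (cells2 M) = ncyc D t1 t0" by (simp only: nclass_def)
  ultimately have egD: "flag_genus D t0 t1 t2 = int (euler_genus H)"
    using M(2) unfolding flag_genus_def surface_euler_genus_def euler_char_def by simp
  \<comment> \<open>The number of components enters with factor 2, so the bound 1 from below yields
    the constant 2 of the claim.\<close>
  have "S \<noteq> {}" using LS H(3) by auto
  then have "nclass S (fr S s \<union> (fr S t0 \<union> fr S t2)) \<ge> 1"
    using finite_quotient_image[OF flag_systemD(1)[OF FS]]
    by (simp add: nclass_def Suc_le_eq card_gt_0_iff quotient_image)
  moreover have "ncyc S t0 t2 = card (edges H)" using ncyc_edges[OF FS] cardS by simp
  ultimately have "2 + int (card (edges H)) - 2 * int (card (verts H)) - excess S t0 s t2 \<le> int (euler_genus H)"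
    using egS egD nv unfolding flag_genus_def excess_def by linarith
  then show thesis using that[OF G LS ES cardS] by blast
qed

subsection \<open>Separating the two sides of a flag graph\<close>

lemma class_mem_iff:
  assumes "sym r" shows "z \<in> r\<^sup>* `` {a} \<longleftrightarrow> r\<^sup>* `` {a} = r\<^sup>* `` {z}"
  using class_eq_iff[OF assms, of a z] by simp

text \<open>The cycles that remain closed when the flags of \<open>K\<close> have lost their
  partners under \<open>f\<close>. Every other class is a path with two ends in \<open>K\<close>: a
  face segment if \<open>g\<close> is \<open>t0\<close>, a vertex run if \<open>g\<close> is
  \<open>t2\<close>.\<close>

definition pure_classes :: "nat set \<Rightarrow> nat set \<Rightarrow> (nat \<Rightarrow> nat) \<Rightarrow> (nat \<Rightarrow> nat) \<Rightarrow> nat set set" where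
  "pure_classes S K f g = {c \<in> S // (fr S g \<union> fr (S - K) f)\<^sup>*. c \<inter> K = {}}"

lemma finite_pure: "finite S \<Longrightarrow> finite (pure_classes S K f g)"
  unfolding pure_classes_def
  by (rule finite_subset[of _ "S // (fr S g \<union> fr (S - K) f)\<^sup>*"]) (auto intro: finite_quotient_image)

text \<open>One side of the sum after the rotation pairs between the sides have been cut; the flags
  of \<open>K\<close> are left without a partner. By \<open>cross\<close> and \<open>lxy\<close>
  every face segment leads from one terminal to the other.\<close>

locale dangling =
  fixes S :: "nat set" and t0 t2 :: "nat \<Rightarrow> nat" and l :: "nat \<Rightarrow> 'a" and x y :: 'a
    and K :: "nat set" and f :: "nat \<Rightarrow> nat"
  assumes FS: "flag_system S t0 t2" and KS: "K \<subseteq> S" and fK: "fi (S - K) f"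
    and lf: "\<And>d. d \<in> S - K \<Longrightarrow> l (f d) = l d" and l2: "\<And>d. d \<in> S \<Longrightarrow> l (t2 d) = l d"
    and lxy: "\<And>a. a \<in> K \<Longrightarrow> l a = x \<or> l a = y"
    and cross: "\<And>a b. a \<in> K \<Longrightarrow> b \<in> K \<Longrightarrow> a \<noteq> b \<Longrightarrow>
      (a, b) \<in> (fr S t0 \<union> fr (S - K) f)\<^sup>* \<Longrightarrow> l a \<noteq> l b"
begin

abbreviation "RF \<equiv> fr S t0 \<union> fr (S - K) f"
abbreviation "RV \<equiv> fr S t2 \<union> fr (S - K) f"

lemma fS: "finite S" and f0: "fi S t0" and f2: "fi S t2"
  using flag_systemD[OF FS] by auto

lemma RF_sym: "sym RF"
  using fr_sym[OF f0] fr_sym[OF fK] by (simp add: sym_Un)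

lemma mate:
  assumes "a \<in> K"
  obtains b where "b \<in> K" "b \<noteq> a" "RF\<^sup>* `` {a} \<inter> K = {a, b}" "RF\<^sup>* `` {b} \<inter> K = {a, b}" "l a \<noteq> l b"
    "(a, b) \<in> RF\<^sup>*"
proof -
  obtain b where b: "b \<in> K" "b \<noteq> a" "RF\<^sup>* `` {a} \<inter> K = {a, b}"
    by (rule path_end[OF fS f0 KS fK assms])
  then have ab: "(a, b) \<in> RF\<^sup>*" by blast
  moreover have "RF\<^sup>* `` {a} = RF\<^sup>* `` {b}" using class_eq_iff[OF RF_sym] ab by blast
  moreover have "l a \<noteq> l b" using cross[OF assms b(1)] b(2) ab by blast
  ultimately show thesis using that b by metis
qed

text \<open>A vertex run keeps its label, so unlike a face segment it returns to the terminal at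
  which it started.\<close>

lemma vertex_mate:
  assumes "a \<in> K"
  obtains b where "b \<in> K" "b \<noteq> a" "(a, b) \<in> RV\<^sup>*" "l b = l a"
proof -
  obtain b where b: "b \<in> K" "b \<noteq> a" "RV\<^sup>* `` {a} \<inter> K = {a, b}"
    by (rule path_end[OF fS f2 KS fK assms])
  then have ab: "(a, b) \<in> RV\<^sup>*" by blast
  then have "b \<in> {d. l d = l a}"
    by (rule rtrancl_closed) (use lf l2 in auto)
  then show thesis using that b ab by blast
qed

text \<open>All flags at \<open>x\<close> are paired by \<open>t2\<close>, and those that do not
  dangle are paired by \<open>f\<close>; the remainder is even.\<close>

lemma even_Kx: "even (card {a \<in> K. l a = x})"
proof -
  let ?A = "{d \<in> S. l d = x}" and ?B = "{d \<in> S - K. l d = x}"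
  have A: "fi ?A t2" by (rule fi_subset[OF f2]) (use l2 fiD(1)[OF f2] in auto)
  have B: "fi ?B f"
  proof (rule fi_subset[OF fK])
    fix d assume d: "d \<in> ?B"
    then have "d \<in> S - K" by blast
    then show "f d \<in> ?B" using lf[of d] fiD(1)[OF fK, of d] d by auto
  qed blast
  have "even (card ?A)" "even (card ?B)" using even_card_fi[OF _ A] even_card_fi[OF _ B] fS by simp_all
  moreover have "card ?A = card ?B + card {a \<in> K. l a = x}"
  proof -
    have "finite ?B" "finite {a \<in> K. l a = x}" "?B \<inter> {a \<in> K. l a = x} = {}"
      using fS KS finite_subset[of K S] by auto
    moreover have "?A = ?B \<union> {a \<in> K. l a = x}" using KS by blast
    ultimately show ?thesis by (simp only: card_Un_disjoint)
  qed
  ultimately show ?thesis by simp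
qed

end

text \<open>Two face segments, from \<open>i\<close> to \<open>i'\<close> and from \<open>j\<close>
  to \<open>j'\<close>, are to be closed up together by matching their ends at \<open>x\<close> with
  each other and likewise their ends at \<open>y\<close>.\<close>

locale dangling_pair = dangling +
  fixes i j i' j'
  assumes i: "i \<in> K" "l i = x" and j: "j \<in> K" "l j = x" and ij: "i \<noteq> j"
    and i': "i' \<in> K" "i' \<noteq> i" "RF\<^sup>* `` {i} \<inter> K = {i, i'}" "(i, i') \<in> RF\<^sup>*" "l i' = y"
    and j': "j' \<in> K" "j' \<noteq> j" "RF\<^sup>* `` {j} \<inter> K = {j, j'}" "(j, j') \<in> RF\<^sup>*" "l j' = y"
    and xy: "x \<noteq> y"
begin

definition "T = {i, j, i', j'}"
definition "K1 = K - T"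
definition "f1 = f(i := j, j := i, i' := j', j' := i')"
abbreviation "X \<equiv> fr T f1"
abbreviation "RF1 \<equiv> fr S t0 \<union> fr (S - K1) f1"
abbreviation "RV1 \<equiv> fr S t2 \<union> fr (S - K1) f1"

text \<open>A common segment would have both \<open>i\<close> and \<open>j\<close> as its ends,
  although its ends carry different terminals.\<close>

lemma class_ij: "RF\<^sup>* `` {i} \<inter> RF\<^sup>* `` {j} = {}"
proof (rule ccontr)
  assume "\<not> ?thesis"
  then obtain z where "z \<in> RF\<^sup>* `` {i}" "z \<in> RF\<^sup>* `` {j}" by blast
  then have "RF\<^sup>* `` {i} = RF\<^sup>* `` {j}" using class_mem_iff[OF RF_sym] by metis
  then have "{i, i'} = {j, j'}" using i' j' by simp
  then have "i = j'" using ij by (auto simp: doubleton_eq_iff)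
  then show False using i j' xy by simp
qed

lemma distinct: "i \<noteq> j" "i' \<noteq> j'" "i \<noteq> i'" "i \<noteq> j'" "j \<noteq> i'" "j \<noteq> j'"
proof -
  have "i' \<in> RF\<^sup>* `` {i}" "j' \<in> RF\<^sup>* `` {j}" using i' j' by auto
  then show "i' \<noteq> j'" using class_ij by blast
qed (use ij i i' j j' xy in auto)

lemma f1_T: "f1 i = j" "f1 j = i" "f1 i' = j'" "f1 j' = i'"
  using distinct by (simp_all add: f1_def)

lemma f1_other: "d \<notin> T \<Longrightarrow> f1 d = f d"
  by (simp add: f1_def T_def)

lemma TK: "T \<subseteq> K"
  using i j i' j' by (simp add: T_def)

lemma SK1: "S - K1 = (S - K) \<union> T" "(S - K) \<inter> T = {}"
  using TK KS by (auto simp: K1_def)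

lemma fi_T: "fi T f1"
  unfolding free_involution_on_def T_def using f1_T distinct by simp

lemma fi_f1: "fi (S - K1) f1"
  unfolding SK1
proof (rule fi_Un[OF _ fi_T])
  show "fi (S - K) f1" using fK fi_cong[of "S - K" f1 f] f1_other SK1(2) by blast
qed

lemma fr1: "fr (S - K1) f1 = fr (S - K) f \<union> X"
  unfolding SK1 fr_Un using fr_cong[of "S - K" f1 f] f1_other SK1(2) by blast

lemma RF1: "RF1 = RF \<union> X" and RV1: "RV1 = RV \<union> X"
  unfolding fr1 by blast+

lemma XT: "X \<subseteq> T \<times> T"
  by (rule fr_sub[OF fi_T])

lemma l_f1: "d \<in> S - K1 \<Longrightarrow> l (f1 d) = l d"
  unfolding SK1
proof (elim UnE)
  assume "d \<in> S - K"
  then show ?thesis using lf f1_other SK1(2) by (metis IntI emptyE)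
next
  assume "d \<in> T"
  then show ?thesis using f1_T i j i' j' unfolding T_def by auto
qed

lemma class_i: "RF1\<^sup>* `` {i} \<inter> K1 = {}"
proof -
  have "z \<in> RF\<^sup>* `` {i} \<union> RF\<^sup>* `` {j}" if z: "(i, z) \<in> RF1\<^sup>*" for z
    using z
  proof (rule rtrancl_closed)
    fix u v assume uv: "(u, v) \<in> RF1" "u \<in> RF\<^sup>* `` {i} \<union> RF\<^sup>* `` {j}"
    show "v \<in> RF\<^sup>* `` {i} \<union> RF\<^sup>* `` {j}"
    proof (cases "(u, v) \<in> RF")
      case True
      have "(k, v) \<in> RF\<^sup>*" if "(k, u) \<in> RF\<^sup>*" for k using that True by (rule rtrancl.rtrancl_into_rtrancl)
      then show ?thesis using uv(2) by blast
    next
      case False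
      then have "v \<in> T" using uv(1) XT unfolding RF1 by blast
      then show ?thesis using i'(4) j'(4) unfolding T_def by auto
    qed
  qed simp
  moreover have "RF\<^sup>* `` {i} \<inter> K1 = {}" "RF\<^sup>* `` {j} \<inter> K1 = {}"
    using i'(3) j'(3) unfolding K1_def T_def by blast+
  ultimately show ?thesis by blast
qed

text \<open>The two segments and the two new pairs form one closed face. The faces that were closed
  before avoid \<open>T\<close> and persist.\<close>

lemma pure_faces: "card (pure_classes S K f t0) + 1 \<le> card (pure_classes S K1 f1 t0)"
proof -
  have "pure_classes S K f t0 \<subseteq> pure_classes S K1 f1 t0"
  proof
    fix c assume c: "c \<in> pure_classes S K f t0"
    then have "c \<in> {c \<in> S // RF\<^sup>*. c \<inter> T = {}}" using TK unfolding pure_classes_def by blast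
    then have "c \<in> S // RF1\<^sup>*" unfolding RF1 using avoiding_classes[OF XT, of S RF] by blast
    then show "c \<in> pure_classes S K1 f1 t0" using c unfolding pure_classes_def K1_def by blast
  qed
  moreover have "RF1\<^sup>* `` {i} \<in> pure_classes S K1 f1 t0"
    using class_i i KS unfolding pure_classes_def quotient_image by blast
  moreover have "RF1\<^sup>* `` {i} \<notin> pure_classes S K f t0"
    using i unfolding pure_classes_def by blast
  ultimately have "card (insert (RF1\<^sup>* `` {i}) (pure_classes S K f t0)) \<le> card (pure_classes S K1 f1 t0)"
    by (intro card_mono finite_pure fS) blast
  then show ?thesis using \<open>RF1\<^sup>* `` {i} \<notin> _\<close> finite_pure[OF fS, of K f t0] by simp
qed

lemma RV1_sym: "sym RV1"
  using fr_sym[OF f2] fr_sym[OF fi_f1] by (simp add: sym_Un)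

lemma vertex_classes_T:
  assumes "c \<in> pure_classes S K1 f1 t2" "c \<inter> T \<noteq> {}"
  shows "c = RV1\<^sup>* `` {i} \<or> c = RV1\<^sup>* `` {i'}"
proof -
  obtain t where t: "t \<in> T" "t \<in> c" using assms(2) by blast
  obtain d where "c = RV1\<^sup>* `` {d}" using assms(1) unfolding pure_classes_def quotient_image by blast
  then have c: "c = RV1\<^sup>* `` {t}" using t(2) class_mem_iff[OF RV1_sym] by metis
  have "(i, j) \<in> RV1\<^sup>*" "(i', j') \<in> RV1\<^sup>*"
    unfolding RV1 using f1_T by (auto intro!: r_into_rtrancl simp: T_def)
  then have "RV1\<^sup>* `` {i} = RV1\<^sup>* `` {j}" "RV1\<^sup>* `` {i'} = RV1\<^sup>* `` {j'}"
    using class_eq_iff[OF RV1_sym] by blast+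
  then show ?thesis using c t(1) unfolding T_def by blast
qed

lemma vertex_classes_avoid:
  "c \<in> pure_classes S K1 f1 t2 \<Longrightarrow> c \<inter> T = {} \<Longrightarrow> c \<in> pure_classes S K f t2"
proof -
  assume c: "c \<in> pure_classes S K1 f1 t2" "c \<inter> T = {}"
  then have "c \<in> {c \<in> S // (RV \<union> X)\<^sup>*. c \<inter> T = {}}" unfolding pure_classes_def RV1 by blast
  then have "c \<in> S // RV\<^sup>*" unfolding avoiding_classes[OF XT] by blast
  moreover have "c \<inter> K = {}" using c unfolding pure_classes_def K1_def by blast
  ultimately show ?thesis by (simp add: pure_classes_def)
qed

text \<open>Only the runs through the new pairs can have become closed, one at \<open>x\<close> and
  one at \<open>y\<close>.\<close>

lemma pure_vertices: "card (pure_classes S K1 f1 t2) \<le> card (pure_classes S K f t2) + 2"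
proof -
  have "pure_classes S K1 f1 t2 \<subseteq> pure_classes S K f t2 \<union> {RV1\<^sup>* `` {i}, RV1\<^sup>* `` {i'}}"
    using vertex_classes_T vertex_classes_avoid by blast
  then have "card (pure_classes S K1 f1 t2) \<le> card (pure_classes S K f t2 \<union> {RV1\<^sup>* `` {i}, RV1\<^sup>* `` {i'}})"
    by (intro card_mono) (simp_all add: finite_pure fS)
  also have "\<dots> \<le> card (pure_classes S K f t2) + card {RV1\<^sup>* `` {i}, RV1\<^sup>* `` {i'}}" by (rule card_Un_le)
  also have "\<dots> \<le> card (pure_classes S K f t2) + 2" by (simp add: card_insert_if)
  finally show ?thesis .
qed

text \<open>If the runs from \<open>i\<close> and from \<open>i'\<close> lead to flags that still
  dangle, the classes of the new pairs are not closed yet. Arranging this in every round but the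
  last keeps the final number of new rotation cycles at 2.\<close>

lemma pure_vertices_linked:
  assumes "\<exists>a\<in>K1. (i, a) \<in> RV\<^sup>*" "\<exists>a\<in>K1. (i', a) \<in> RV\<^sup>*"
  shows "card (pure_classes S K1 f1 t2) \<le> card (pure_classes S K f t2)"
proof -
  have m: "RV\<^sup>* \<subseteq> RV1\<^sup>*" unfolding RV1 by (rule rtrancl_mono) blast
  have "RV1\<^sup>* `` {i} \<inter> K1 \<noteq> {}" "RV1\<^sup>* `` {i'} \<inter> K1 \<noteq> {}" using assms m by blast+
  then have "c \<inter> T = {}" if "c \<in> pure_classes S K1 f1 t2" for c
    using vertex_classes_T[OF that] that by (auto simp: pure_classes_def)
  then have "pure_classes S K1 f1 t2 \<subseteq> pure_classes S K f t2" using vertex_classes_avoid by blast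
  then show ?thesis by (intro card_mono finite_pure fS)
qed

lemma card_Kx: "card {a \<in> K. l a = x} = card {a \<in> K1. l a = x} + 2"
proof -
  have "finite K" using fS KS finite_subset by blast
  moreover have "{a \<in> K. l a = x} = {a \<in> K1. l a = x} \<union> {i, j}"
    using i j i' j' xy unfolding K1_def T_def by auto
  moreover have "{a \<in> K1. l a = x} \<inter> {i, j} = {}" unfolding K1_def T_def by blast
  moreover have "finite {a \<in> K1. l a = x}" using \<open>finite K\<close> unfolding K1_def by simp
  ultimately show ?thesis using card_Un_disjoint[of "{a \<in> K1. l a = x}" "{i, j}"] ij by simp
qed

lemma dangling1: "dangling S t0 t2 l x y K1 f1"
proof unfold_locales
  show "K1 \<subseteq> S" using KS unfolding K1_def by blast
  fix a b assume ab: "a \<in> K1" "b \<in> K1" "a \<noteq> b" "(a, b) \<in> RF1\<^sup>*"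
  have aK: "a \<in> K" "b \<in> K" "a \<notin> T" using ab unfolding K1_def by blast+
  obtain c where c: "c \<in> K" "RF\<^sup>* `` {a} \<inter> K = {a, c}" by (rule mate[OF aK(1)])
  \<comment> \<open>If the segment of \<open>a\<close> met \<open>T\<close>, it would be one of the
    two segments just closed, and \<open>a\<close> would be one of their ends.\<close>
  have no: "z \<notin> T" if z: "z \<in> RF\<^sup>* `` {a}" for z
  proof
    assume zT: "z \<in> T"
    have e: "RF\<^sup>* `` {a} = RF\<^sup>* `` {z}" using z class_mem_iff[OF RF_sym] by metis
    have "RF\<^sup>* `` {i'} = RF\<^sup>* `` {i}" "RF\<^sup>* `` {j'} = RF\<^sup>* `` {j}"
      using i'(4) j'(4) class_eq_iff[OF RF_sym] by blast+
    then have "RF\<^sup>* `` {z} \<inter> K \<subseteq> T" using zT i'(3) j'(3) unfolding T_def by auto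
    moreover have "a \<in> RF\<^sup>* `` {z}" unfolding e[symmetric] by blast
    ultimately show False using aK by blast
  qed
  have "b \<in> RF\<^sup>* `` {a}"
    using ab(4)
  proof (rule rtrancl_closed)
    fix u v assume uv: "(u, v) \<in> RF1" "u \<in> RF\<^sup>* `` {a}"
    have "(u, v) \<in> RF" using uv no[OF uv(2)] XT unfolding RF1 by blast
    then show "v \<in> RF\<^sup>* `` {a}" using uv(2) by (meson Image_singleton_iff rtrancl.rtrancl_into_rtrancl)
  qed simp
  then show "l a \<noteq> l b" using cross[OF aK(1,2) ab(3)] by blast
next
  show "l a = x \<or> l a = y" if "a \<in> K1" for a using lxy that unfolding K1_def by blast
qed (use FS fi_f1 l_f1 l2 in auto)

end

text \<open>
  The matching of the dangling flags forms a single cycle with the vertex runs at \<open>x\<close> and another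
  one at \<open>y\<close>, while two face segments are closed up together into one face; topologically, opposite
  corners of a face are identified across a crosscap.
\<close>

lemma pair_dangling:
  assumes "dangling S t0 t2 l x y K f" "K \<noteq> {}" "x \<noteq> y"
  shows "\<exists>h. flag_graph S t0 h t2 l \<and> ncyc S h t2 \<le> card (pure_classes S K f t2) + 2 \<and>
    2 * card (pure_classes S K f t0) + card {a \<in> K. l a = x} \<le> 2 * ncyc S h t0 \<and>
    (\<exists>p\<in>S. \<exists>q\<in>S. l p = x \<and> l q = y \<and> (p, q) \<in> reach S h t0)"
  using assms(1,2)
proof (induction "card K" arbitrary: K f rule: less_induct)
  case less
  interpret dangling S t0 t2 l x y K f by (rule less.prems(1))
  have finK: "finite K" using fS KS finite_subset by blast
  have mate_x: "\<exists>b. b \<in> K \<and> b \<noteq> a \<and> RF\<^sup>* `` {a} \<inter> K = {a, b} \<and> (a, b) \<in> RF\<^sup>* \<and> l b = y"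
    if a: "a \<in> K" "l a = x" for a
  proof -
    obtain b where b: "b \<in> K" "b \<noteq> a" "RF\<^sup>* `` {a} \<inter> K = {a, b}" "l a \<noteq> l b" "(a, b) \<in> RF\<^sup>*"
      by (rule mate[OF a(1)])
    moreover have "l b = y" using lxy[OF b(1)] b(4) a(2) by auto
    ultimately show ?thesis by blast
  qed
  have mate_y: "\<exists>b. b \<in> K \<and> RF\<^sup>* `` {b} \<inter> K = {a, b} \<and> l b = x"
    if a: "a \<in> K" "l a = y" for a
  proof -
    obtain b where b: "b \<in> K" "RF\<^sup>* `` {b} \<inter> K = {a, b}" "l a \<noteq> l b"
      by (rule mate[OF a(1)])
    moreover have "l b = x" using lxy[OF b(1)] b(3) a(2) by auto
    ultimately show ?thesis by blast
  qed
  obtain k where "k \<in> K" using less.prems(2) by blast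
  then obtain i where i: "i \<in> K" "l i = x" using mate_y lxy by metis
  obtain i' where i': "i' \<in> K" "i' \<noteq> i" "RF\<^sup>* `` {i} \<inter> K = {i, i'}" "(i, i') \<in> RF\<^sup>*" "l i' = y"
    using mate_x[OF i] by blast
  obtain a where a: "a \<in> K" "a \<noteq> i" "(i, a) \<in> RV\<^sup>*" "l a = l i" by (rule vertex_mate[OF i(1)])
  obtain b where b: "b \<in> K" "b \<noteq> i'" "(i', b) \<in> RV\<^sup>*" "l b = l i'" by (rule vertex_mate[OF i'(1)])
  obtain a' where a': "a' \<in> K" "RF\<^sup>* `` {a'} \<inter> K = {b, a'}" "l a' = x" using mate_y[OF b(1)] b(4) i'(5) by auto
  let ?Kx = "{a \<in> K. l a = x}"
  show ?case
  proof (cases "?Kx \<subseteq> {i, a}")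
    \<comment> \<open>Last round: only two flags dangle at \<open>x\<close>, so the two segments
      exhaust \<open>K\<close>. The final run at \<open>x\<close> and the final run at
      \<open>y\<close> may close here; this is the 2 in the bound for the rotation cycles.\<close>
    case True
    obtain j' where j': "j' \<in> K" "j' \<noteq> a" "RF\<^sup>* `` {a} \<inter> K = {a, j'}" "(a, j') \<in> RF\<^sup>*" "l j' = y"
      using mate_x[OF a(1)] a(4) i(2) by auto
    have "l a = x" "i \<noteq> a" using a(2,4) i(2) by auto
    interpret P: dangling_pair S t0 t2 l x y K f i a i' j'
      by (unfold_locales; fact)
    have "K \<subseteq> P.T"
    proof
      fix c assume c: "c \<in> K"
      show "c \<in> P.T"
      proof (cases "l c = x")
        case True
        then show ?thesis using \<open>?Kx \<subseteq> _\<close> c unfolding P.T_def by blast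
      next
        case False
        then have "l c = y" using lxy[OF c] by blast
        then obtain d where d: "d \<in> K" "RF\<^sup>* `` {d} \<inter> K = {c, d}" "l d = x" using mate_y[OF c] by blast
        then have "d = i \<or> d = a" using \<open>?Kx \<subseteq> _\<close> by blast
        then show ?thesis using d(2) i'(3) j'(3) unfolding P.T_def by auto
      qed
    qed
    then have K1: "P.K1 = {}" unfolding P.K1_def by blast
    have fS1: "fi S P.f1" using P.fi_f1 unfolding K1 by simp
    have G: "flag_graph S t0 P.f1 t2 l"
      unfolding flag_graph_def rotation_def using FS fS1 P.l_f1 l2 unfolding K1 by simp
    have eq: "card (pure_classes S P.K1 P.f1 g) = ncyc S P.f1 g" for g
      unfolding pure_classes_def nclass_def K1 by (simp add: Un_commute)
    have "ncyc S P.f1 t2 \<le> card (pure_classes S K f t2) + 2" using P.pure_vertices unfolding eq .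
    moreover have "2 * card (pure_classes S K f t0) + card ?Kx \<le> 2 * ncyc S P.f1 t0"
      using P.pure_faces[unfolded eq] P.card_Kx by (simp add: K1)
    moreover have "RF \<subseteq> fr S P.f1 \<union> fr S t0" using P.RF1 unfolding K1 by auto
    then have "(i, i') \<in> reach S P.f1 t0" using i'(4) rtrancl_mono by blast
    ultimately show ?thesis using G i i' KS by blast
  next
    case False
    \<comment> \<open>At least three flags dangle at \<open>x\<close>, hence by parity at least
      four, and one of them is none of \<open>i\<close>, \<open>a\<close>, \<open>a'\<close>.
      Avoiding \<open>a\<close> keeps the run at \<open>x\<close> open. Avoiding \<open>a'\<close>,
      the segment partner of \<open>b\<close>, makes \<open>j'\<close> different from
      \<open>b\<close> and keeps the run at \<open>y\<close> open.\<close>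
    then have "card {i, a} < card ?Kx" using i a finK by (intro psubset_card_mono) auto
    then have "card ?Kx > 2" using a(2) by simp
    moreover have "even (card ?Kx)" by (rule even_Kx)
    ultimately have "card ?Kx > 3" by presburger
    moreover have "card {i, a, a'} \<le> 3" by (simp add: card_insert_if)
    ultimately have "\<not> ?Kx \<subseteq> {i, a, a'}" using card_mono[of "{i, a, a'}" ?Kx] by auto
    then obtain j where j: "j \<in> K" "l j = x" "j \<noteq> i" "j \<noteq> a" "j \<noteq> a'" by blast
    obtain j' where j': "j' \<in> K" "j' \<noteq> j" "RF\<^sup>* `` {j} \<inter> K = {j, j'}" "(j, j') \<in> RF\<^sup>*" "l j' = y"
      using mate_x[OF j(1,2)] by blast
    have "i \<noteq> j" using j(3) by simp
    interpret P: dangling_pair S t0 t2 l x y K f i j i' j'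
      by (unfold_locales; fact)
    have "b \<noteq> j'"
    proof
      assume "b = j'"
      then have "RF\<^sup>* `` {j} = RF\<^sup>* `` {b}" using j'(4) class_eq_iff[OF RF_sym] by blast
      moreover have "b \<in> RF\<^sup>* `` {a'}" using a'(2) by blast
      then have "RF\<^sup>* `` {a'} = RF\<^sup>* `` {b}" using class_mem_iff[OF RF_sym] by metis
      ultimately have "{j, j'} = {b, a'}" using j'(3) a'(2) by simp
      then show False using \<open>b = j'\<close> j(5) j'(2) by (auto simp: doubleton_eq_iff)
    qed
    moreover have "l b = y" "l a = x" using b(4) i'(5) a(4) i(2) by simp_all
    then have "b \<noteq> i" "b \<noteq> j" "a \<noteq> i'" "a \<noteq> j'" using i(2) j(2) i'(5) j'(5) assms(3) by metis+
    ultimately have bK1: "b \<in> P.K1" and aK1: "a \<in> P.K1"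
      unfolding P.K1_def P.T_def using a(1,2) b(1,2) j(4) by simp_all
    have "P.K1 \<subset> K" using i unfolding P.K1_def P.T_def by blast
    then have "card P.K1 < card K" using finK by (rule psubset_card_mono[rotated])
    then obtain h where h: "flag_graph S t0 h t2 l" "ncyc S h t2 \<le> card (pure_classes S P.K1 P.f1 t2) + 2"
      "2 * card (pure_classes S P.K1 P.f1 t0) + card {a \<in> P.K1. l a = x} \<le> 2 * ncyc S h t0"
      "\<exists>p\<in>S. \<exists>q\<in>S. l p = x \<and> l q = y \<and> (p, q) \<in> reach S h t0"
      using less.hyps[OF _ P.dangling1] aK1 by blast
    have "card (pure_classes S P.K1 P.f1 t2) \<le> card (pure_classes S K f t2)"
      by (rule P.pure_vertices_linked) (use aK1 bK1 a b in blast)+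
    then have "ncyc S h t2 \<le> card (pure_classes S K f t2) + 2" using h(2) by simp
    moreover have "2 * card (pure_classes S K f t0) + card ?Kx \<le> 2 * ncyc S h t0"
      using h(3) P.pure_faces P.card_Kx by simp
    ultimately show ?thesis using h(1,4) by blast
  qed
qed

section \<open>Rotation pairs between the two sides\<close>

lemma rtrancl_fr_mem:
  assumes "(a, d) \<in> (fr D g \<union> fr E f)\<^sup>*" "d \<in> D" shows "(a, g d) \<in> (fr D g \<union> fr E f)\<^sup>*"
  using assms(1) by (rule rtrancl.rtrancl_into_rtrancl) (simp add: assms(2))

lemma rtrancl_fr_mem2:
  assumes "(a, d) \<in> (fr D g \<union> fr E f)\<^sup>*" "d \<in> E" shows "(a, f d) \<in> (fr D g \<union> fr E f)\<^sup>*"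
  using assms(1) by (rule rtrancl.rtrancl_into_rtrancl) (simp add: assms(2))

definition mixed :: "nat set \<Rightarrow> nat set \<Rightarrow> (nat \<Rightarrow> nat) \<Rightarrow> nat set" where
  "mixed D S t = {d \<in> D. t d \<in> S \<longleftrightarrow> d \<notin> S}"

text \<open>A side consists of whole edges, so only the rotation leads from one side to the
  other.\<close>

locale sided =
  fixes D S t0 t1 t2 and l :: "nat \<Rightarrow> 'a"
  assumes G: "flag_graph D t0 t1 t2 l" and SD: "S \<subseteq> D"
    and S0: "\<And>d. d \<in> S \<Longrightarrow> t0 d \<in> S" and S2: "\<And>d. d \<in> S \<Longrightarrow> t2 d \<in> S"
begin

lemmas g = flag_graphD[OF G]

abbreviation "M \<equiv> mixed D S t1"
abbreviation "RD \<equiv> fr D t0 \<union> fr (D - M) t1"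

lemma MD: "M \<subseteq> D"
  by (auto simp: mixed_def)

lemma M1: "d \<in> M \<Longrightarrow> t1 d \<in> M"
  unfolding mixed_def using fiD(1,2)[OF g(5), of d] by auto

lemma M1_iff: "d \<in> D \<Longrightarrow> t1 d \<in> M \<longleftrightarrow> d \<in> M"
  using M1[of d] M1[of "t1 d"] fiD(2)[OF g(5), of d] by auto

lemma side0: "d \<in> D \<Longrightarrow> t0 d \<in> S \<longleftrightarrow> d \<in> S"
  using S0[of d] S0[of "t0 d"] fiD(2)[OF g(4), of d] by auto

lemma side2: "d \<in> D \<Longrightarrow> t2 d \<in> S \<longleftrightarrow> d \<in> S"
  using S2[of d] S2[of "t2 d"] fiD(2)[OF g(6), of d] by auto

lemma side1: "d \<in> D \<Longrightarrow> d \<notin> M \<Longrightarrow> t1 d \<in> S \<longleftrightarrow> d \<in> S"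
  by (auto simp: mixed_def)

lemma side1_mixed: "d \<in> M \<Longrightarrow> t1 d \<in> S \<longleftrightarrow> d \<notin> S"
  by (auto simp: mixed_def)

lemma fi_pure: "fi (D - M) t1"
  by (rule fi_subset[OF g(5)]) (use M1_iff fiD(1)[OF g(5)] in auto)

lemma complement: "sided D (D - S) t0 t1 t2 l"
proof
  fix d assume "d \<in> D - S"
  then show "t0 d \<in> D - S" "t2 d \<in> D - S"
    using side0[of d] side2[of d] fiD(1)[OF g(4), of d] fiD(1)[OF g(6), of d] by auto
qed (use G in auto)

lemma mixed_complement: "mixed D (D - S) t1 = M"
  unfolding mixed_def using fiD(1)[OF g(5)] by blast

text \<open>A face segment stays on one side. If its two ends belong to the same vertex, it can be
  made a face of its own: one face is gained, at most one rotation cycle is added, and the former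
  partners, both on the other side, are matched with each other.\<close>

lemma close_path:
  assumes ab: "a \<in> M" "b \<in> M" "a \<noteq> b" "(a, b) \<in> RD\<^sup>*" "l a = l b"
  shows "flag_graph D t0 (join t1 a b) t2 l" "excess D t0 t1 t2 \<le> excess D t0 (join t1 a b) t2"
    "mixed D S (join t1 a b) \<subseteq> M - {a}"
proof -
  obtain c where c: "c \<in> M" "c \<noteq> a" "RD\<^sup>* `` {a} \<inter> M = {a, c}"
    by (rule path_end[OF g(3,4) MD fi_pure ab(1)])
  then have CM: "RD\<^sup>* `` {a} \<inter> M = {a, b}" using ab by auto
  let ?C = "RD\<^sup>* `` {a}"
  have side: "d \<in> D \<and> (d \<in> S \<longleftrightarrow> a \<in> S)" if d: "d \<in> ?C" for d
  proof -
    have "(a, d) \<in> RD\<^sup>*" using d by simp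
    then have "d \<in> {d \<in> D. d \<in> S \<longleftrightarrow> a \<in> S}"
    proof (rule rtrancl_closed)
      fix u v assume uv: "(u, v) \<in> RD" "u \<in> {d \<in> D. d \<in> S \<longleftrightarrow> a \<in> S}"
      then consider "v = t0 u" | "v = t1 u" "u \<notin> M" by auto
      then show "v \<in> {d \<in> D. d \<in> S \<longleftrightarrow> a \<in> S}"
        by cases (use uv(2) side0 side1 fiD(1)[OF g(4)] fiD(1)[OF g(5)] in auto)
    qed (use ab MD in auto)
    then show ?thesis by simp
  qed
  have CD: "?C \<subseteq> D" using side by blast
  have bC: "b \<in> ?C" using ab(4) by simp
  have C0: "t0 d \<in> ?C" if d: "d \<in> ?C" for d
    using rtrancl_fr_mem[of a d D t0 "D - M" t1] d CD by auto
  have C1: "t1 d \<in> ?C" if d: "d \<in> ?C" "d \<noteq> a" "d \<noteq> b" for d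
  proof -
    have "d \<notin> M" using CM d by blast
    then show ?thesis using rtrancl_fr_mem2[of a d D t0 "D - M" t1] d CD by auto
  qed
  have out: "t1 a \<notin> ?C" "t1 b \<notin> ?C"
    using side[of "t1 a"] side[of "t1 b"] side[OF bC] side1_mixed ab(1,2) by blast+
  have j: "joinable D t1 a b" and f: "ncyc D (join t1 a b) t0 = ncyc D t1 t0 + 1"
    using join_close[OF g(3,5,4) CD _ bC ab(3)] C0 C1 out by blast+
  interpret J: joinable D t1 a b by (rule j)
  interpret V: joinable_rel2 D t1 a b "fr D t2" t2 by (rule joinable_relI[OF j g(6)])
  show "flag_graph D t0 (join t1 a b) t2 l"
    using G rotation_join[OF g(2) j ab(5)] by (simp add: flag_graph_def)
  show "excess D t0 t1 t2 \<le> excess D t0 (join t1 a b) t2"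
    using f V.nclass_join_le unfolding excess_def by linarith
  have s: "b \<in> S \<longleftrightarrow> a \<in> S" using side[OF bC] by blast
  show "mixed D S (join t1 a b) \<subseteq> M - {a}"
  proof
    fix d assume d: "d \<in> mixed D S (join t1 a b)"
    have ns: "join t1 a b d \<in> S \<longleftrightarrow> d \<notin> S" and dD: "d \<in> D" using d by (auto simp: mixed_def)
    have "d \<noteq> a" using ns J.join_apply(1) s by metis
    moreover have "d \<noteq> b" using ns J.join_apply(2) s by metis
    moreover have "d \<noteq> t1 a" using ns J.join_apply(3) s side1_mixed ab(1,2) by metis
    moreover have "d \<noteq> t1 b" using ns J.join_apply(4) s side1_mixed ab(1,2) by metis
    ultimately show "d \<in> M - {a}" using ns dD J.join_other[of d] by (simp add: mixed_def)
  qed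
qed

end

text \<open>A side is selected by a symmetric property of the end labels of edges. Here
  \<open>k\<close> may be finer than \<open>l\<close>, as when the ends of a contracted edge are
  told apart.\<close>

lemma sidedI:
  assumes G: "flag_graph D t0 t1 t2 l" and k: "\<And>d. d \<in> D \<Longrightarrow> k (t2 d) = k d"
    and P: "\<And>u v. P u v \<Longrightarrow> P v u" and S: "S = {d \<in> D. P (k d) (k (t0 d))}"
  shows "sided D S t0 t1 t2 l"
proof
  note g = flag_graphD[OF G]
  fix d assume "d \<in> S"
  then have d: "d \<in> D" "P (k d) (k (t0 d))" by (simp_all add: S)
  have d': "t0 d \<in> D" "t0 (t0 d) = d" "t2 d \<in> D" using fiD[OF g(4) d(1)] fiD(1)[OF g(6) d(1)] by auto
  have "k (t0 (t2 d)) = k (t0 d)" using flag_systemD(4)[OF g(1) d(1)] k[OF d'(1)] by simp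
  then show "t0 d \<in> S" "t2 d \<in> S" using d d' k[OF d(1)] P by (simp_all add: S)
qed (use G S in auto)

text \<open>Repeating \<open>close_path\<close> leaves only face segments with different labels at
  their ends; this establishes the assumption \<open>cross\<close> of the later locales.\<close>

lemma close_paths:
  assumes "sided D S t0 t1 t2 l"
  shows "\<exists>s. sided D S t0 s t2 l \<and> excess D t0 t1 t2 \<le> excess D t0 s t2 \<and> mixed D S s \<subseteq> mixed D S t1 \<and>
    (\<forall>a\<in>mixed D S s. \<forall>b\<in>mixed D S s. a \<noteq> b \<longrightarrow>
       (a, b) \<in> (fr D t0 \<union> fr (D - mixed D S s) s)\<^sup>* \<longrightarrow> l a \<noteq> l b)"
  using assms
proof (induction "card (mixed D S t1)" arbitrary: t1 rule: less_induct)
  case less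
  interpret sided D S t0 t1 t2 l by (rule less.prems)
  show ?case
  proof (cases "\<forall>a\<in>M. \<forall>b\<in>M. a \<noteq> b \<longrightarrow> (a, b) \<in> RD\<^sup>* \<longrightarrow> l a \<noteq> l b")
    case False
    then obtain a b where ab: "a \<in> M" "b \<in> M" "a \<noteq> b" "(a, b) \<in> RD\<^sup>*" "l a = l b" by blast
    note c = close_path[OF ab]
    have "finite M" using MD g(3) finite_subset by blast
    then have "card (mixed D S (join t1 a b)) < card M"
      using c(3) ab(1) by (intro psubset_card_mono) auto
    moreover have "sided D S t0 (join t1 a b) t2 l"
      using c(1) SD S0 S2 by (simp add: sided_def)
    ultimately obtain s where "sided D S t0 s t2 l" "excess D t0 (join t1 a b) t2 \<le> excess D t0 s t2"
      "mixed D S s \<subseteq> mixed D S (join t1 a b)"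
      "\<forall>a\<in>mixed D S s. \<forall>b\<in>mixed D S s. a \<noteq> b \<longrightarrow>
       (a, b) \<in> (fr D t0 \<union> fr (D - mixed D S s) s)\<^sup>* \<longrightarrow> l a \<noteq> l b"
      using less.hyps by blast
    moreover from this c(2,3) have "excess D t0 t1 t2 \<le> excess D t0 s t2" "mixed D S s \<subseteq> M" by auto
    ultimately show ?thesis by blast
  qed (use less.prems in blast)
qed

locale crossing = sided +
  fixes x y
  assumes xy: "x \<noteq> y" and Mne: "mixed D S t1 \<noteq> {}"
    and Mxy: "\<And>a. a \<in> mixed D S t1 \<Longrightarrow> l a = x \<or> l a = y"
    and cross: "\<And>a b. a \<in> mixed D S t1 \<Longrightarrow> b \<in> mixed D S t1 \<Longrightarrow> a \<noteq> b \<Longrightarrow>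
      (a, b) \<in> (fr D t0 \<union> fr (D - mixed D S t1) t1)\<^sup>* \<Longrightarrow> l a \<noteq> l b"
begin

abbreviation "KS \<equiv> M \<inter> S"
abbreviation "KC \<equiv> M \<inter> (D - S)"

lemma swapped: "crossing D (D - S) t0 t1 t2 l x y"
  using complement xy Mne Mxy cross
  by (simp add: crossing_def crossing_axioms_def mixed_complement)

lemma S_minus: "S - KS \<subseteq> D - M"
  using SD by blast

lemma fi_S: "fi S t0" "fi S t2" "fi (S - KS) t1"
proof -
  show "fi S t0" "fi S t2" using g(4,6) SD S0 S2 by (auto intro: fi_subset)
  show "fi (S - KS) t1"
    by (rule fi_subset[OF fi_pure S_minus]) (use side1 M1_iff SD in blast)
qed

lemma dangling_S: "dangling S t0 t2 l x y KS t1"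
proof
  show "flag_system S t0 t2" by (rule flag_system_subset[OF g(1) SD S0 S2])
  fix a b assume ab: "a \<in> KS" "b \<in> KS" "a \<noteq> b" "(a, b) \<in> (fr S t0 \<union> fr (S - KS) t1)\<^sup>*"
  have "fr S t0 \<union> fr (S - KS) t1 \<subseteq> RD" using SD by auto
  then have "(a, b) \<in> RD\<^sup>*" using ab(4) rtrancl_mono by blast
  then show "l a \<noteq> l b" using cross ab by blast
qed (use fi_S g(7,8) SD Mxy in auto)

lemma KS_ne: "KS \<noteq> {}"
proof -
  obtain a where a: "a \<in> M" using Mne by blast
  show ?thesis using a M1[OF a] side1_mixed[OF a] by blast
qed

lemma S0_image: "t0 ` S \<subseteq> S" and S2_image: "t2 ` S \<subseteq> S"
  using S0 S2 by blast+

text \<open>A cycle that meets no cut pair never leaves its side, so it can be computed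
  there.\<close>

lemma class_local:
  assumes d: "d \<in> S" and u: "u ` S \<subseteq> S"
    and p: "(fr S u \<union> fr (S - KS) t1)\<^sup>* `` {d} \<inter> KS = {}"
  shows "reach D t1 u `` {d} = (fr S u \<union> fr (S - KS) t1)\<^sup>* `` {d}"
proof (intro equalityI subsetI)
  let ?C = "(fr S u \<union> fr (S - KS) t1)\<^sup>* `` {d}"
  fix z assume "z \<in> reach D t1 u `` {d}"
  then have "(d, z) \<in> reach D t1 u" by simp
  then have "z \<in> ?C \<inter> S"
  proof (rule rtrancl_closed)
    fix a b assume ab: "(a, b) \<in> fr D t1 \<union> fr D u" "a \<in> ?C \<inter> S"
    have aK: "a \<in> S - KS" using ab(2) p by blast
    have "(d, a) \<in> (fr S u \<union> fr (S - KS) t1)\<^sup>*" using ab(2) by simp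
    from rtrancl_fr_mem[OF this] rtrancl_fr_mem2[OF this] have "u a \<in> ?C" "t1 a \<in> ?C" using aK by auto
    moreover have "u a \<in> S" "t1 a \<in> S" using aK u fiD(1)[OF fi_S(3) aK] by blast+
    ultimately show "b \<in> ?C \<inter> S" using ab(1) by auto
  qed (use d in auto)
  then show "z \<in> ?C" by blast
next
  fix z assume "z \<in> (fr S u \<union> fr (S - KS) t1)\<^sup>* `` {d}"
  moreover have "fr S u \<union> fr (S - KS) t1 \<subseteq> fr D t1 \<union> fr D u" using SD by auto
  ultimately show "z \<in> reach D t1 u `` {d}" using rtrancl_mono by blast
qed

lemma pure_classes_S:
  assumes u: "u ` S \<subseteq> S" and fu: "fi S u"
    and c: "c \<in> pure_classes S KS t1 u"
  shows "c \<in> D // reach D t1 u" "c \<subseteq> S" "c \<inter> M = {}" "c \<noteq> {}"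
proof -
  obtain d where d: "d \<in> S" "c = (fr S u \<union> fr (S - KS) t1)\<^sup>* `` {d}" "c \<inter> KS = {}"
    using c unfolding pure_classes_def quotient_image by blast
  have "c = reach D t1 u `` {d}"
    unfolding d(2) by (rule class_local[OF d(1) u, symmetric]) (use d(2,3) in simp)
  then show "c \<in> D // reach D t1 u" using d(1) SD unfolding quotient_image by blast
  have "fr S u \<union> fr (S - KS) t1 \<subseteq> S \<times> S" using fr_sub[OF fu] fr_sub[OF fi_S(3)] by blast
  then show "c \<subseteq> S" unfolding d(2) by (rule class_subset) (rule d(1))
  then show "c \<inter> M = {}" using d(3) by blast
  show "c \<noteq> {}" using d(2) by blast
qed

lemma pure_class_of:
  assumes d: "d \<in> S" and u: "u ` S \<subseteq> S"
    and c: "reach D t1 u `` {d} \<inter> M = {}"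
  shows "reach D t1 u `` {d} \<in> pure_classes S KS t1 u"
proof -
  have "fr S u \<union> fr (S - KS) t1 \<subseteq> fr D t1 \<union> fr D u" using SD by auto
  then have "(fr S u \<union> fr (S - KS) t1)\<^sup>* `` {d} \<subseteq> reach D t1 u `` {d}"
    using rtrancl_mono by blast
  then have p: "(fr S u \<union> fr (S - KS) t1)\<^sup>* `` {d} \<inter> KS = {}" using c by blast
  then show ?thesis using class_local[OF d u p] d unfolding pure_classes_def quotient_image by simp
qed

text \<open>A mixed face contains a whole segment inside \<open>S\<close>, and one of the two ends
  of that segment is at \<open>x\<close>.\<close>

lemma face_hits:
  assumes a: "a \<in> M"
  shows "\<exists>k\<in>KS. l k = x \<and> (a, k) \<in> reach D t1 t0"
proof -
  have sub: "RD\<^sup>* \<subseteq> reach D t1 t0" by (rule rtrancl_mono) auto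
  obtain b where b: "b \<in> KS" "(a, b) \<in> reach D t1 t0"
  proof (cases "a \<in> S")
    case True
    then show ?thesis using that a by blast
  next
    case False
    have "(a, t1 a) \<in> reach D t1 t0" by (rule r_into_rtrancl) (use a MD in auto)
    then show ?thesis using that M1[OF a] side1_mixed[OF a] False by blast
  qed
  interpret K: dangling S t0 t2 l x y KS t1 by (rule dangling_S)
  obtain c where c: "c \<in> KS" "l b \<noteq> l c" "(b, c) \<in> (fr S t0 \<union> fr (S - KS) t1)\<^sup>*" by (rule K.mate[OF b(1)])
  have "fr S t0 \<union> fr (S - KS) t1 \<subseteq> fr D t1 \<union> fr D t0" using SD by auto
  then have "(b, c) \<in> reach D t1 t0" using c(3) rtrancl_mono by blast
  then have "(a, c) \<in> reach D t1 t0" using b(2) by (meson rtrancl_trans)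
  moreover have "l b = x \<or> l c = x" using c(2) K.lxy[OF b(1)] K.lxy[OF c(1)] by metis
  ultimately show ?thesis using b c by blast
qed

lemma card_KS_KC: "card {a \<in> KS. l a = x} = card {a \<in> KC. l a = x}"
proof (rule bij_betw_same_card)
  show "bij_betw t1 {a \<in> KS. l a = x} {a \<in> KC. l a = x}"
  proof (rule bij_betw_byWitness[where f' = t1])
    show "\<forall>a\<in>{a \<in> KS. l a = x}. t1 (t1 a) = a" "\<forall>a\<in>{a \<in> KC. l a = x}. t1 (t1 a) = a"
      using fiD(2)[OF g(5)] MD by auto
    show "t1 ` {a \<in> KS. l a = x} \<subseteq> {a \<in> KC. l a = x}" "t1 ` {a \<in> KC. l a = x} \<subseteq> {a \<in> KS. l a = x}"
      using M1 side1_mixed MD g(8) fiD(1)[OF g(5)] by auto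
  qed
qed

text \<open>Each mixed face is charged to a flag of \<open>KS\<close> at \<open>x\<close> that it
  contains, by \<open>face_hits\<close>.\<close>

lemma faces_le:
  "ncyc D t1 t0 \<le> card (pure_classes S KS t1 t0) + card (pure_classes (D - S) KC t1 t0)
     + card {a \<in> KS. l a = x}"
proof -
  interpret C: crossing D "D - S" t0 t1 t2 l x y by (rule swapped)
  let ?R = "reach D t1 t0"
  let ?A = "pure_classes S KS t1 t0" and ?B = "pure_classes (D - S) KC t1 t0"
  let ?Z = "(\<lambda>k. ?R `` {k}) ` {a \<in> KS. l a = x}"
  have sym: "sym (fr D t1 \<union> fr D t0)" using g by (simp add: sym_Un fr_sym)
  have "D // ?R \<subseteq> ?A \<union> ?B \<union> ?Z"
  proof
    fix c assume "c \<in> D // ?R"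
    then obtain d where d: "d \<in> D" "c = ?R `` {d}" unfolding quotient_image by blast
    show "c \<in> ?A \<union> ?B \<union> ?Z"
    proof (cases "c \<inter> M = {}")
      case True
      show ?thesis
      proof (cases "d \<in> S")
        case True
        then show ?thesis using pure_class_of[OF True S0_image] \<open>c \<inter> M = {}\<close> d(2) by blast
      next
        case False
        then have "d \<in> D - S" using d(1) by blast
        then have "?R `` {d} \<in> ?B"
          using C.pure_class_of[OF _ C.S0_image, of d] \<open>c \<inter> M = {}\<close> d(2) unfolding mixed_complement by blast
        then show ?thesis using d(2) by blast
      qed
    next
      case False
      then obtain a where a: "a \<in> M" "(d, a) \<in> ?R" using d(2) by blast
      obtain k where k: "k \<in> KS" "l k = x" "(a, k) \<in> ?R" using face_hits[OF a(1)] by blast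
      have "(d, k) \<in> ?R" using a(2) k(3) by (meson rtrancl_trans)
      then have "c = ?R `` {k}" using class_eq_iff[OF sym] d(2) by blast
      then show ?thesis using k(1,2) by blast
    qed
  qed
  moreover have fin: "finite S" "finite (D - S)" "finite KS" using g(3) SD finite_subset by blast+
  ultimately have "card (D // ?R) \<le> card (?A \<union> ?B \<union> ?Z)"
    by (intro card_mono) (simp_all add: finite_pure)
  also have "\<dots> \<le> card (?A \<union> ?B) + card ?Z" by (rule card_Un_le)
  also have "\<dots> \<le> card ?A + card ?B + card {a \<in> KS. l a = x}"
    by (intro add_mono card_Un_le card_image_le) (simp add: fin)
  finally show ?thesis by (simp only: nclass_def)
qed

text \<open>The two ends of a face segment lie in mixed rotation cycles, one at \<open>x\<close> and
  one at \<open>y\<close>; these account for the 2.\<close>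

lemma vertices_ge:
  "card (pure_classes S KS t1 t2) + card (pure_classes (D - S) KC t1 t2) + 2 \<le> ncyc D t1 t2"
proof -
  interpret C: crossing D "D - S" t0 t1 t2 l x y by (rule swapped)
  let ?R = "reach D t1 t2"
  let ?A = "pure_classes S KS t1 t2" and ?B = "pure_classes (D - S) KC t1 t2"
  have fin: "finite S" "finite (D - S)" using g(3) SD finite_subset by blast+
  interpret K: dangling S t0 t2 l x y KS t1 by (rule dangling_S)
  obtain a where a: "a \<in> KS" using KS_ne by blast
  obtain b where b: "b \<in> KS" "l a \<noteq> l b" by (rule K.mate[OF a])
  have const: "l z = l d" if z: "(d, z) \<in> ?R" for d z
  proof -
    have "z \<in> {z. l z = l d}" using z by (rule rtrancl_closed) (use g(7,8) in auto)
    then show ?thesis by simp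
  qed
  have "sym (fr D t1 \<union> fr D t2)" using g by (simp add: sym_Un fr_sym)
  moreover have "(a, b) \<notin> ?R" using const[of a b] b(2) by metis
  ultimately have ne: "?R `` {a} \<noteq> ?R `` {b}" by (simp only: class_eq_iff not_False_eq_True)
  note A = pure_classes_S[OF S2_image fi_S(2)]
  have B: "c \<in> D // ?R \<and> c \<subseteq> D - S \<and> c \<inter> M = {} \<and> c \<noteq> {}" if c: "c \<in> ?B" for c
    using C.pure_classes_S[OF C.S2_image C.fi_S(2), of c] c unfolding mixed_complement by blast
  have "?A \<inter> ?B = {}" using A(2,4) B by blast
  then have 1: "card (?A \<union> ?B) = card ?A + card ?B" by (simp add: card_Un_disjoint finite_pure fin)
  have "c \<inter> M = {}" if "c \<in> ?A \<union> ?B" for c using that A(3) B by blast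
  then have "(?A \<union> ?B) \<inter> {?R `` {a}, ?R `` {b}} = {}" using a b(1) by blast
  then have "card (?A \<union> ?B \<union> {?R `` {a}, ?R `` {b}}) = card (?A \<union> ?B) + 2"
    using ne card_Un_disjoint[of "?A \<union> ?B" "{?R `` {a}, ?R `` {b}}"] by (simp add: finite_pure fin)
  moreover have "?A \<union> ?B \<union> {?R `` {a}, ?R `` {b}} \<subseteq> D // ?R"
    using A(1) B a b(1) MD unfolding quotient_image by blast
  then have "card (?A \<union> ?B \<union> {?R `` {a}, ?R `` {b}}) \<le> card (D // ?R)"
    by (intro card_mono finite_quotient_image g(3))
  ultimately show ?thesis using 1 by (simp add: nclass_def)
qed

text \<open>Let \<open>n\<close> flags of \<open>KS\<close> be at \<open>x\<close>. Before, there
  are at most \<open>n\<close> mixed faces and at least 2 mixed rotation cycles. Afterwards each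
  side has at least \<open>n/2\<close> new faces and at most 2 new cycles. So the excess drops by at
  most 2.\<close>

lemma uncross:
  "\<exists>h. flag_graph D t0 h t2 l \<and> (\<forall>d\<in>S. h d \<in> S) \<and> excess D t0 t1 t2 - 2 \<le> excess D t0 h t2 \<and>
    (\<exists>p\<in>S. \<exists>q\<in>S. l p = x \<and> l q = y \<and> (p, q) \<in> reach D h t0) \<and>
    (\<exists>p\<in>D - S. \<exists>q\<in>D - S. l p = x \<and> l q = y \<and> (p, q) \<in> reach D h t0)"
proof -
  interpret C: crossing D "D - S" t0 t1 t2 l x y by (rule swapped)
  have dC: "dangling (D - S) t0 t2 l x y KC t1"
    using C.dangling_S unfolding mixed_complement .
  have KC: "KC \<noteq> {}" using C.KS_ne unfolding mixed_complement .
  obtain h1 where h1: "flag_graph S t0 h1 t2 l" "ncyc S h1 t2 \<le> card (pure_classes S KS t1 t2) + 2"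
    "2 * card (pure_classes S KS t1 t0) + card {a \<in> KS. l a = x} \<le> 2 * ncyc S h1 t0"
    "\<exists>p\<in>S. \<exists>q\<in>S. l p = x \<and> l q = y \<and> (p, q) \<in> reach S h1 t0"
    using pair_dangling[OF dangling_S KS_ne xy] by blast
  obtain h2 where h2: "flag_graph (D - S) t0 h2 t2 l" "ncyc (D - S) h2 t2 \<le> card (pure_classes (D - S) KC t1 t2) + 2"
    "2 * card (pure_classes (D - S) KC t1 t0) + card {a \<in> KC. l a = x} \<le> 2 * ncyc (D - S) h2 t0"
    "\<exists>p\<in>D - S. \<exists>q\<in>D - S. l p = x \<and> l q = y \<and> (p, q) \<in> reach (D - S) h2 t0"
    using pair_dangling[OF dC KC xy] by blast
  define h where "h = piecewise S h1 h2"
  have hS: "h d = h1 d" if "d \<in> S" for d using that by (simp add: h_def piecewise_def)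
  have hC: "h d = h2 d" if "d \<in> D - S" for d using that by (simp add: h_def piecewise_def)
  have D: "S \<union> (D - S) = D" using SD by blast
  have G1: "flag_graph S t0 h t2 l" by (rule flag_graph_cong[OF _ _ _ _ h1(1)]) (simp_all add: hS)
  have G2: "flag_graph (D - S) t0 h t2 l" by (rule flag_graph_cong[OF _ _ _ _ h2(1)]) (simp_all add: hC)
  have GD: "flag_graph D t0 h t2 l" using flag_graph_Un[OF G1 G2] unfolding D .
  have "excess (S \<union> (D - S)) t0 h t2 = excess S t0 h t2 + excess (D - S) t0 h t2"
    using flag_graphD[OF G1] flag_graphD[OF G2] by (intro excess_Un) auto
  moreover have "excess S t0 h t2 = excess S t0 h1 t2" by (rule excess_cong) (simp_all add: hS)
  moreover have "excess (D - S) t0 h t2 = excess (D - S) t0 h2 t2" by (rule excess_cong) (simp_all add: hC)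
  ultimately have P: "excess D t0 h t2 = excess S t0 h1 t2 + excess (D - S) t0 h2 t2" unfolding D by simp
  have excess: "excess D t0 t1 t2 - 2 \<le> excess D t0 h t2"
    unfolding P using h1(2,3) h2(2,3) card_KS_KC faces_le vertices_ge unfolding excess_def by linarith
  have "fr S h1 \<subseteq> fr D h" "fr (D - S) h2 \<subseteq> fr D h" using hS hC SD by auto
  then have m: "reach S h1 t0 \<subseteq> reach D h t0"
    "reach (D - S) h2 t0 \<subseteq> reach D h t0"
    using SD by (intro rtrancl_mono; auto)+
  have "\<forall>d\<in>S. h d \<in> S" using fiD(1)[OF flag_graphD(5)[OF G1]] by blast
  then show ?thesis using GD excess h1(4) h2(4) m by blast
qed

end

lemma separate:
  assumes "sided D S t0 t1 t2 l" "\<And>a. a \<in> mixed D S t1 \<Longrightarrow> l a = x \<or> l a = y" "x \<noteq> y"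
  shows "\<exists>h. flag_graph D t0 h t2 l \<and> (\<forall>d\<in>S. h d \<in> S) \<and> (excess D t0 t1 t2 \<le> excess D t0 h t2 \<or>
    excess D t0 t1 t2 - 2 \<le> excess D t0 h t2 \<and>
    (\<exists>p\<in>S. \<exists>q\<in>S. l p = x \<and> l q = y \<and> (p, q) \<in> reach D h t0) \<and>
    (\<exists>p\<in>D - S. \<exists>q\<in>D - S. l p = x \<and> l q = y \<and> (p, q) \<in> reach D h t0))"
proof -
  obtain s where s: "sided D S t0 s t2 l" "excess D t0 t1 t2 \<le> excess D t0 s t2" "mixed D S s \<subseteq> mixed D S t1"
    "\<forall>a\<in>mixed D S s. \<forall>b\<in>mixed D S s. a \<noteq> b \<longrightarrow>
       (a, b) \<in> (fr D t0 \<union> fr (D - mixed D S s) s)\<^sup>* \<longrightarrow> l a \<noteq> l b"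
    using close_paths[OF assms(1)] by blast
  interpret sided D S t0 s t2 l by (rule s(1))
  show ?thesis
  proof (cases "mixed D S s = {}")
    case True
    then have "\<forall>d\<in>S. s d \<in> S" using side1 SD by blast
    then show ?thesis using G s(2) by blast
  next
    case False
    interpret crossing D S t0 s t2 l x y
      by unfold_locales (use False s(3,4) assms(2,3) in blast)+
    obtain h where h: "flag_graph D t0 h t2 l" "\<forall>d\<in>S. h d \<in> S" "excess D t0 s t2 - 2 \<le> excess D t0 h t2"
      "\<exists>p\<in>S. \<exists>q\<in>S. l p = x \<and> l q = y \<and> (p, q) \<in> reach D h t0"
      "\<exists>p\<in>D - S. \<exists>q\<in>D - S. l p = x \<and> l q = y \<and> (p, q) \<in> reach D h t0"
      using uncross by blast
    have "excess D t0 t1 t2 - 2 \<le> excess D t0 h t2" using h(3) s(2) by linarith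
    then show ?thesis using h by blast
  qed
qed

subsection \<open>The Euler genus of an xy-sum\<close>

lemma nclass_image:
  assumes "inj_on h D" "r \<subseteq> D \<times> D" "finite D"
  shows "nclass (h ` D) (map_prod h h ` r) = nclass D r"
proof -
  have cl: "(map_prod h h ` r)\<^sup>* `` {h d} = h ` (r\<^sup>* `` {d})" if d: "d \<in> D" for d
  proof (intro equalityI subsetI)
    fix z assume "z \<in> (map_prod h h ` r)\<^sup>* `` {h d}"
    then have "(h d, z) \<in> (map_prod h h ` r)\<^sup>*" by simp
    then show "z \<in> h ` (r\<^sup>* `` {d})"
    proof (rule rtrancl_closed)
      fix u v assume uv: "(u, v) \<in> map_prod h h ` r" "u \<in> h ` (r\<^sup>* `` {d})"
      obtain p q where pq: "(p, q) \<in> r" "u = h p" "v = h q" using uv(1) by auto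
      obtain w where w: "(d, w) \<in> r\<^sup>*" "u = h w" using uv(2) by blast
      have "w \<in> D" using class_subset[OF assms(2) d] w(1) by blast
      then have "w = p" using inj_onD[OF assms(1)] w(2) pq assms(2) by blast
      then have "(d, q) \<in> r\<^sup>*" using w(1) pq(1) by (simp add: rtrancl.rtrancl_into_rtrancl)
      then show "v \<in> h ` (r\<^sup>* `` {d})" using pq(3) by blast
    qed simp
  next
    fix z assume "z \<in> h ` (r\<^sup>* `` {d})"
    then obtain w where w: "(d, w) \<in> r\<^sup>*" "z = h w" by blast
    have "(h d, h w) \<in> (map_prod h h ` r)\<^sup>*"
      by (rule map_rtrancl[OF w(1)]) (auto intro!: r_into_rtrancl simp: image_iff map_prod_def)
    then show "z \<in> (map_prod h h ` r)\<^sup>* `` {h d}" using w(2) by simp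
  qed
  have "(h ` D) // (map_prod h h ` r)\<^sup>* = (`) h ` (D // r\<^sup>*)"
    unfolding quotient_image image_image using cl by (intro image_cong) simp_all
  moreover have "inj_on ((`) h) (D // r\<^sup>*)"
  proof (rule inj_onI)
    fix c c' assume c: "c \<in> D // r\<^sup>*" "c' \<in> D // r\<^sup>*" "h ` c = h ` c'"
    then have "c \<subseteq> D" "c' \<subseteq> D" using class_subset[OF assms(2)] unfolding quotient_image by auto
    then show "c = c'" using c(3) inj_on_image_eq_iff[OF assms(1)] by blast
  qed
  ultimately show ?thesis unfolding nclass_def by (simp add: card_image)
qed

text \<open>Flags are natural numbers, so disjoint copies are made by translation; the truncated
  difference is exact on translated flags.\<close>

lemma flag_graph_shift:
  fixes n :: nat and sh :: "(nat \<Rightarrow> nat) \<Rightarrow> nat \<Rightarrow> nat"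
  assumes "flag_graph D t0 t1 t2 l" and sh_def: "\<And>t d. sh t d = t (d - n) + n"
  shows "flag_graph ((+) n ` D) (sh t0) (sh t1) (sh t2) (\<lambda>d. l (d - n))"
    "excess ((+) n ` D) (sh t0) (sh t1) (sh t2) = excess D t0 t1 t2"
    "edge_set ((+) n ` D) (sh t0) (\<lambda>d. l (d - n)) = edge_set D t0 l"
proof -
  note g = flag_graphD[OF assms(1)]
  have fi: "fi ((+) n ` D) (sh t)" if "fi D t" for t
    using fiD[OF that] by (auto simp: free_involution_on_def sh_def)
  show "flag_graph ((+) n ` D) (sh t0) (sh t1) (sh t2) (\<lambda>d. l (d - n))"
    unfolding flag_graph_def flag_system_def rotation_def
    using g(3) fi[OF g(4)] fi[OF g(5)] fi[OF g(6)] g(7,8) flag_systemD(4,5)[OF g(1)]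
    by (auto simp: sh_def)
  have fr: "fr ((+) n ` D) (sh t) = map_prod ((+) n) ((+) n) ` fr D t" for t
  proof -
    have 1: "fr A s = (\<lambda>d. (d, s d)) ` A" for A s by auto
    show ?thesis unfolding 1 image_image by (simp add: sh_def add.commute)
  qed
  have "ncyc ((+) n ` D) (sh f) (sh g) = ncyc D f g" if "fi D f" "fi D g" for f g
    unfolding fr image_Un[symmetric]
    by (rule nclass_image) (use \<open>finite D\<close> fr_sub[OF that(1)] fr_sub[OF that(2)] in auto)
  then show "excess ((+) n ` D) (sh t0) (sh t1) (sh t2) = excess D t0 t1 t2"
    unfolding excess_def using g(4,5,6) by simp
  show "edge_set ((+) n ` D) (sh t0) (\<lambda>d. l (d - n)) = edge_set D t0 l"
    unfolding edge_set_def image_image by (simp add: sh_def)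
qed

lemma edge_flag:
  assumes "flag_graph D t0 t1 t2 l" "{u, v} \<in> edge_set D t0 l"
  obtains d where "d \<in> D" "l d = u" "l (t0 d) = v"
proof -
  obtain d where d: "d \<in> D" "{u, v} = {l d, l (t0 d)}" using assms(2) unfolding edge_set_def by blast
  then consider "l d = u \<and> l (t0 d) = v" | "l d = v \<and> l (t0 d) = u" by (auto simp: doubleton_eq_iff)
  then show thesis
  proof cases
    case 2
    then have "l (t0 d) = u" "l (t0 (t0 d)) = v" using fiD(2)[OF flag_graphD(4)[OF assms(1)] d(1)] by simp_all
    then show thesis using that fiD(1)[OF flag_graphD(4)[OF assms(1)] d(1)] by blast
  qed (use that d in blast)
qed

lemma flag_graph_disjoint:
  assumes "flag_graph D t0 t1 t2 l" "finite A"
  obtains D' s0 s1 s2 k where "flag_graph D' s0 s1 s2 k" "D' \<inter> A = {}" "card D' = card D"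
    "k ` D' = l ` D" "edge_set D' s0 k = edge_set D t0 l" "excess D' s0 s1 s2 = excess D t0 t1 t2"
proof -
  define n where "n = Suc (Max (insert 0 A))"
  note s = flag_graph_shift[OF assms(1) refl, of n]
  have "a < n" if "a \<in> A" for a using that assms(2) by (simp add: n_def less_Suc_eq_le)
  then have "(+) n ` D \<inter> A = {}" by fastforce
  moreover have "card ((+) n ` D) = card D" by (simp add: card_image)
  moreover have "(\<lambda>d. l (d - n)) ` (+) n ` D = l ` D" by (simp add: image_image)
  ultimately show thesis using that[OF s(1)] s(2,3) by blast
qed

lemma flag_graph_restrict:
  assumes G: "flag_graph D t0 t1 t2 l" and S: "S \<subseteq> D" "t0 ` S \<subseteq> S" "t1 ` S \<subseteq> S" "t2 ` S \<subseteq> S"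
  shows "flag_graph S t0 t1 t2 l"
proof -
  note g = flag_graphD[OF G]
  have "flag_system S t0 t2" by (rule flag_system_subset[OF g(1) S(1)]) (use S in auto)
  moreover have "fi S t1" by (rule fi_subset[OF g(5) S(1)]) (use S in auto)
  ultimately show ?thesis using g(7,8) S(1) unfolding flag_graph_def rotation_def by blast
qed

lemma flag_graph_card: "flag_graph D t0 t1 t2 l \<Longrightarrow> \<exists>m. card D = 4 * m"
  using ncyc_edges[OF flag_graphD(1)] by metis

lemma split_sides:
  assumes G: "flag_graph D t0 t1 t2 l" and S: "S \<subseteq> D" "t0 ` S \<subseteq> S" "t1 ` S \<subseteq> S" "t2 ` S \<subseteq> S"
  shows "flag_graph S t0 t1 t2 l" "flag_graph (D - S) t0 t1 t2 l"
    "excess D t0 t1 t2 = excess S t0 t1 t2 + excess (D - S) t0 t1 t2" "card D = card S + card (D - S)"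
    "\<And>p q. p \<in> S \<Longrightarrow> (p, q) \<in> reach D t1 t0 \<Longrightarrow> (p, q) \<in> reach S t1 t0"
    "\<And>p q. p \<in> D - S \<Longrightarrow> (p, q) \<in> reach D t1 t0 \<Longrightarrow> (p, q) \<in> reach (D - S) t1 t0"
proof -
  note g = flag_graphD[OF G]
  have cl: "t ` (D - S) \<subseteq> D - S" if "fi D t" "t ` S \<subseteq> S" for t
  proof
    fix z assume "z \<in> t ` (D - S)"
    then obtain d where d: "d \<in> D" "d \<notin> S" "z = t d" by blast
    have "t z = d" "z \<in> D" using fiD[OF that(1) d(1)] d(3) by auto
    then show "z \<in> D - S" using d(2) that(2) by blast
  qed
  note C = cl[OF g(4) S(2)] cl[OF g(5) S(3)] cl[OF g(6) S(4)]
  show 1: "flag_graph S t0 t1 t2 l" by (rule flag_graph_restrict[OF G S])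
  show 2: "flag_graph (D - S) t0 t1 t2 l" by (rule flag_graph_restrict[OF G Diff_subset C])
  have D: "S \<union> (D - S) = D" using S(1) by blast
  have "excess (S \<union> (D - S)) t0 t1 t2 = excess S t0 t1 t2 + excess (D - S) t0 t1 t2"
    using flag_graphD[OF 1] flag_graphD[OF 2] by (intro excess_Un) auto
  then show "excess D t0 t1 t2 = excess S t0 t1 t2 + excess (D - S) t0 t1 t2" unfolding D .
  have "card (S \<union> (D - S)) = card S + card (D - S)"
    using flag_graphD(3)[OF 1] flag_graphD(3)[OF 2] by (intro card_Un_disjoint) auto
  then show "card D = card S + card (D - S)" unfolding D .
  have R: "(p, q) \<in> reach A t1 t0"
    if "A \<subseteq> D" "t0 ` A \<subseteq> A" "t1 ` A \<subseteq> A" "p \<in> A" "(p, q) \<in> reach D t1 t0" for A p q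
  proof -
    have "q \<in> {q \<in> A. (p, q) \<in> reach A t1 t0}"
      using that(5)
    proof (rule rtrancl_closed)
      fix u v assume uv: "(u, v) \<in> fr D t1 \<union> fr D t0" "u \<in> {q \<in> A. (p, q) \<in> reach A t1 t0}"
      then have u: "u \<in> A" "(p, u) \<in> reach A t1 t0" and "(u, v) \<in> fr A t1 \<union> fr A t0" by auto
      then have "(p, v) \<in> reach A t1 t0" by (simp add: rtrancl.rtrancl_into_rtrancl)
      moreover have "v \<in> A" using uv(1) u(1) that(2,3) by auto
      ultimately show "v \<in> {q \<in> A. (p, q) \<in> reach A t1 t0}" by simp
    qed (use that(4) in simp)
    then show ?thesis by simp
  qed
  show "\<And>p q. p \<in> S \<Longrightarrow> (p, q) \<in> reach D t1 t0 \<Longrightarrow> (p, q) \<in> reach S t1 t0"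
    by (rule R[OF S(1,2,3)])
  show "\<And>p q. p \<in> D - S \<Longrightarrow> (p, q) \<in> reach D t1 t0 \<Longrightarrow> (p, q) \<in> reach (D - S) t1 t0"
    by (rule R[OF Diff_subset C(1,2)])
qed

lemma euler_genus_mono:
  assumes "simple_graph H" "connected_graph H" "u \<in> verts H" "v \<in> verts H" "u \<noteq> v"
    and "verts H' = verts H" "edges H' \<subseteq> edges H"
  shows "euler_genus H' \<le> euler_genus H"
proof -
  obtain M where M: "closed_surface M" "surface_euler_genus M = int (euler_genus H)" "embeds_in H M"
    by (rule euler_genus_attained[OF assms(1-4) assms(5)[symmetric]])
  have "embeds_in H' M" using M(3) assms(6,7) unfolding embeds_in_def by (metis subsetD)
  then show ?thesis unfolding euler_genus_def[of H'] using M(1,2) by (intro Least_le) blast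
qed

lemma simple_graph_add_xy: "simple_graph H \<Longrightarrow> x \<in> verts H \<Longrightarrow> y \<in> verts H \<Longrightarrow> x \<noteq> y \<Longrightarrow> simple_graph (add_xy x y H)"
  by (auto simp: simple_graph_def add_xy_def)

lemma connected_graph_mono:
  assumes "connected_graph H" "verts H' = verts H" "edges H \<subseteq> edges H'"
  shows "connected_graph H'"
proof -
  have "{(a, b). {a, b} \<in> edges H}\<^sup>* \<subseteq> {(a, b). {a, b} \<in> edges H'}\<^sup>*"
    by (rule rtrancl_mono) (use assms(3) in auto)
  then show ?thesis using assms(1,2) unfolding connected_graph_def by blast
qed

lemma connected_graph_add_xy: "connected_graph H \<Longrightarrow> connected_graph (add_xy x y H)"
  by (rule connected_graph_mono) (auto simp: add_xy_def)

lemma add_xy_sel [simp]: "verts (add_xy x y H) = verts H" "edges (add_xy x y H) = insert {x, y} (edges H)"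
  by (simp_all add: add_xy_def)

lemma euler_genus_realizable:
  assumes "simple_graph H" "connected_graph H" "x \<in> verts H" "y \<in> verts H" "x \<noteq> y"
  obtains \<phi> where "realizable (verts H) (edges H) (card (edges H)) \<phi>"
    "2 + int (card (edges H)) - 2 * int (card (verts H)) - \<phi> \<le> int (euler_genus H)"
proof -
  obtain D t0 t1 t2 l where "flag_graph D t0 t1 t2 l" "l ` D = verts H" "edge_set D t0 l = edges H"
    "card D = 4 * card (edges H)"
    "2 + int (card (edges H)) - 2 * int (card (verts H)) - excess D t0 t1 t2 \<le> int (euler_genus H)"
    by (rule euler_genus_realized[OF assms(1-4) assms(5)[symmetric]])
  moreover from this have "realizable (verts H) (edges H) (card (edges H)) (excess D t0 t1 t2)"
    unfolding realizable_def by blast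
  ultimately show thesis using that by blast
qed

text \<open>For the upper bound, a separate copy of \<open>xy\<close> raises \<open>m\<close> by 1
  and lowers the excess by 1, hence adds 2 to the genus formula.\<close>

lemma theta_bounds:
  assumes "simple_graph H" "connected_graph H" "x \<in> verts H" "y \<in> verts H" "x \<noteq> y"
  shows "euler_genus H \<le> euler_genus_plus x y H" "euler_genus_plus x y H \<le> euler_genus H + 2"
proof -
  show "euler_genus H \<le> euler_genus_plus x y H"
    unfolding euler_genus_plus_def
    by (rule euler_genus_mono[OF simple_graph_add_xy connected_graph_add_xy]) (use assms in auto)
  obtain \<phi> where \<phi>: "realizable (verts H) (edges H) (card (edges H)) \<phi>"
    "2 + int (card (edges H)) - 2 * int (card (verts H)) - \<phi> \<le> int (euler_genus H)"
    by (rule euler_genus_realizable[OF assms])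
  from realizable_add_edge[OF \<phi>(1), of x y]
  have "realizable (verts H) (insert {x, y} (edges H)) (card (edges H) + 1) (\<phi> - 1)"
    using assms(3,4) by (simp add: insert_absorb)
  from euler_genus_upper[OF this connected_graph_add_xy[OF assms(2)], of x y]
  show "euler_genus_plus x y H \<le> euler_genus H + 2"
    using \<phi>(2) unfolding euler_genus_plus_def by simp
qed

lemma realizable_pair:
  assumes "realizable V E m p" "realizable V' E' m' p'"
  obtains A B t0 t1 t2 l where "flag_graph A t0 t1 t2 l" "flag_graph B t0 t1 t2 l" "A \<inter> B = {}"
    "flag_graph (A \<union> B) t0 t1 t2 l" "l ` (A \<union> B) = V \<union> V'" "edge_set A t0 l = E" "edge_set B t0 l = E'"
    "card (A \<union> B) = 4 * (m + m')" "excess (A \<union> B) t0 t1 t2 = p + p'"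
proof -
  obtain A t0 t1 t2 l where A: "flag_graph A t0 t1 t2 l" "l ` A = V" "edge_set A t0 l = E"
    "card A = 4 * m" "excess A t0 t1 t2 = p" using assms(1) unfolding realizable_def by blast
  obtain C r0 r1 r2 j where C: "flag_graph C r0 r1 r2 j" "j ` C = V'" "edge_set C r0 j = E'"
    "card C = 4 * m'" "excess C r0 r1 r2 = p'" using assms(2) unfolding realizable_def by blast
  obtain B s0 s1 s2 k where B: "flag_graph B s0 s1 s2 k" "B \<inter> A = {}" "card B = card C"
    "k ` B = j ` C" "edge_set B s0 k = edge_set C r0 j" "excess B s0 s1 s2 = excess C r0 r1 r2"
    by (rule flag_graph_disjoint[OF C(1) flag_graphD(3)[OF A(1)]])
  have AB: "A \<inter> B = {}" using B(2) by blast
  note U = disjoint_union[OF A(1) B(1) AB]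
  let ?u0 = "piecewise A t0 s0" and ?u1 = "piecewise A t1 s1" and ?u2 = "piecewise A t2 s2" and ?h = "piecewise A l k"
  have "edge_set A ?u0 ?h = E" unfolding A(3)[symmetric]
    by (rule edge_set_cong) (use flag_graphD(4)[OF U(1)] in \<open>auto simp: piecewise_def\<close>)
  moreover have "edge_set B ?u0 ?h = E'" unfolding C(3)[symmetric] B(5)[symmetric]
    by (rule edge_set_cong) (use flag_graphD(4)[OF U(2)] AB in \<open>auto simp: piecewise_def\<close>)
  moreover have "card (A \<union> B) = 4 * (m + m')"
    using card_Un_disjoint[OF _ _ AB] flag_graphD(3)[OF A(1)] flag_graphD(3)[OF B(1)] A(4) B(3) C(4) by simp
  moreover have "excess (A \<union> B) ?u0 ?u1 ?u2 = p + p'" using U(4) A(5) B(6) C(5) by simp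
  moreover have "?h ` (A \<union> B) = V \<union> V'" using U(6) A(2) B(4) C(2) by simp
  ultimately show thesis using that[OF U(1,2) AB U(3)] by blast
qed

lemma realizable_Un:
  assumes "realizable V E m p" "realizable V' E' m' p'"
  shows "realizable (V \<union> V') (E \<union> E') (m + m') (p + p')"
  by (rule realizable_pair[OF assms]) (metis realizable_def edge_set_Un)

text \<open>The gain of 2 comes from laying the two \<open>xy\<close>-edges side by side so that they bound a digon.\<close>

lemma realizable_edge_sum:
  assumes R: "realizable V E m c" "realizable V' E' m' c'" and e: "{x, y} \<in> E" "{x, y} \<in> E'" "x \<noteq> y"
  shows "realizable (V \<union> V') (E \<union> E') (m + m') (c + c' + 2)"
proof -
  obtain A B u0 u1 u2 h where U: "flag_graph A u0 u1 u2 h" "flag_graph B u0 u1 u2 h" and AB: "A \<inter> B = {}"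
    and UD: "flag_graph (A \<union> B) u0 u1 u2 h" "h ` (A \<union> B) = V \<union> V'"
    and E: "edge_set A u0 h = E" "edge_set B u0 h = E'"
    and C: "card (A \<union> B) = 4 * (m + m')" "excess (A \<union> B) u0 u1 u2 = c + c'"
    by (rule realizable_pair[OF R])
  define D where "D = A \<union> B"
  note UA = flag_graphD[OF U(1)] and UB = flag_graphD[OF U(2)] and G = UD(1)[folded D_def]
  have AD: "A \<subseteq> D" and BD: "B = D - A" using AB by (auto simp: D_def)
  have cl: "u0 ` A \<subseteq> A" "u1 ` A \<subseteq> A" "u2 ` A \<subseteq> A"
    using fiD(1)[OF UA(4)] fiD(1)[OF UA(5)] fiD(1)[OF UA(6)] by auto
  obtain p where p: "p \<in> A" "h p = x" "h (u0 p) = y" using edge_flag[OF U(1)] e(1) E(1) by metis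
  obtain q where q: "q \<in> D - A" "h q = x" "h (u0 q) = y" using edge_flag[OF U(2)] e(2) E(2) BD by metis
  have hpq: "h p = h q" using p(2) q(2) by simp
  let ?f = "join u1 p q"
  note J = join_across[OF G AD cl p(1) q(1) hpq]
  interpret P: joinable D u1 p q by (rule J(3))
  have pq: "u0 p \<in> A" "u0 q \<in> D - A" "u0 p \<in> D" "u0 q \<in> D"
    using fiD(1)[OF UA(4) p(1)] fiD(1)[OF UB(4)] q(1) AD unfolding BD by auto
  \<comment> \<open>Joining \<open>p\<close> and \<open>q\<close> at \<open>x\<close> merges the
    faces along the two copies of \<open>xy\<close>, while the rotation at \<open>y\<close> is
    untouched. So the far ends share a face but not a rotation cycle, as
    \<open>join_cofacial\<close> requires.\<close>
  have other: "?f d = u1 d" if "d \<in> D" "h d = y" for d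
  proof (rule P.join_other)
    have "h (u1 p) = x" "h (u1 q) = x" using flag_graphD(8)[OF G] P.a P.b p(2) q(2) by auto
    then show "d \<notin> {p, u1 p, q, u1 q}" using that p(2) q(2) e(3) by auto
  qed
  have vsep: "(u0 p, u0 q) \<notin> reach D ?f u2"
  proof
    assume "(u0 p, u0 q) \<in> reach D ?f u2"
    then have "u0 q \<in> {d \<in> A. h d = y}"
    proof (rule rtrancl_closed)
      fix u v assume uv: "(u, v) \<in> fr D ?f \<union> fr D u2" "u \<in> {d \<in> A. h d = y}"
      then have "v = u1 u \<or> v = u2 u" using other by auto
      then show "v \<in> {d \<in> A. h d = y}" using uv(2) UA(7,8) cl by auto
    qed (use pq p in simp)
    then show False using pq(2) by blast
  qed
  have "(p, u0 p) \<in> reach D u1 u0" "(q, u0 q) \<in> reach D u1 u0"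
    by (rule r_into_rtrancl, simp add: P.a P.b)+
  then have face: "(u0 p, u0 q) \<in> reach D ?f u0" by (rule J(4))
  have "h (u0 p) = h (u0 q)" using p(3) q(3) by simp
  then obtain s where s: "flag_graph D u0 s u2 h" "excess D u0 s u2 = excess D u0 ?f u2 + 2"
    using join_cofacial[OF J(1) pq(3,4) _ face vsep] by blast
  have "excess D u0 s u2 = c + c' + 2" using s(2) J(2) C(2)[folded D_def] by simp
  moreover have "edge_set D u0 h = E \<union> E'" using E edge_set_Un unfolding D_def by metis
  ultimately show ?thesis unfolding realizable_def using s(1) UD(2) C(1) unfolding D_def by blast
qed

text \<open>Disjoint edge sets are assumed rather than non-adjacency of the terminals: contracting
  an edge of \<open>G1\<close> can make \<open>x\<close> and \<open>y\<close> adjacent, and the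
  formula is also applied to that result.\<close>

locale xy_sum =
  fixes x y :: 'a and G G1 G2 :: "'a graph"
  assumes s1: "simple_graph G1" and s2: "simple_graph G2" and c1: "connected_graph G1" and c2: "connected_graph G2"
    and xy: "x \<noteq> y" and V: "verts G1 \<inter> verts G2 = {x, y}" and E: "edges G1 \<inter> edges G2 = {}"
    and G: "G = Graph (verts G1 \<union> verts G2) (edges G1 \<union> edges G2)"
begin

lemma x1: "x \<in> verts G1" and x2: "x \<in> verts G2" and y1: "y \<in> verts G1" and y2: "y \<in> verts G2"
  using V by auto

lemma G_sel [simp]: "verts G = verts G1 \<union> verts G2" "edges G = edges G1 \<union> edges G2"
  by (simp_all add: G)

lemma sG: "simple_graph G"
  using s1 s2 by (auto simp: simple_graph_def)

lemma cG: "connected_graph G"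
proof -
  let ?r = "\<lambda>H. {(a, b). {a, b} \<in> edges H}\<^sup>*"
  have m: "?r G1 \<subseteq> ?r G" "?r G2 \<subseteq> ?r G" by (rule rtrancl_mono; force)+
  have "(u, x) \<in> ?r G \<and> (x, u) \<in> ?r G" if "u \<in> verts G" for u
  proof -
    have "(u, x) \<in> ?r G1 \<and> (x, u) \<in> ?r G1" if "u \<in> verts G1" for u
      using c1 x1 that by (simp add: connected_graph_def)
    moreover have "(u, x) \<in> ?r G2 \<and> (x, u) \<in> ?r G2" if "u \<in> verts G2" for u
      using c2 x2 that by (simp add: connected_graph_def)
    ultimately show ?thesis using that m unfolding G_sel by blast
  qed
  then have "(u, v) \<in> ?r G" if "u \<in> verts G" "v \<in> verts G" for u v
    using that by (meson rtrancl_trans)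
  moreover have "verts G \<noteq> {}" using x1 by auto
  ultimately show ?thesis unfolding connected_graph_def by blast
qed

lemma card_verts: "card (verts G) + 2 = card (verts G1) + card (verts G2)"
  using card_Un_Int[of "verts G1" "verts G2"] s1 s2 V xy by (simp add: simple_graph_def)

text \<open>Optimal realizations are put side by side. When the formulas
  \<open>2 + m - 2 n - excess\<close> are added, one constant 2 is surplus, but each of the two
  shared vertices is counted twice; the balance is +2.\<close>

lemma genus_le: "euler_genus G \<le> euler_genus G1 + euler_genus G2 + 2"
proof -
  obtain c where c: "realizable (verts G1) (edges G1) (card (edges G1)) c"
    "2 + int (card (edges G1)) - 2 * int (card (verts G1)) - c \<le> int (euler_genus G1)"
    by (rule euler_genus_realizable[OF s1 c1 x1 y1 xy])
  obtain d where d: "realizable (verts G2) (edges G2) (card (edges G2)) d"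
    "2 + int (card (edges G2)) - 2 * int (card (verts G2)) - d \<le> int (euler_genus G2)"
    by (rule euler_genus_realizable[OF s2 c2 x2 y2 xy])
  have "int (euler_genus G) \<le> 2 + int (card (edges G1) + card (edges G2)) - 2 * int (card (verts G)) - (c + d)"
    using euler_genus_upper[OF realizable_Un[OF c(1) d(1)] cG] by simp
  then show ?thesis using c(2) d(2) card_verts by linarith
qed

text \<open>The realization carries two copies of \<open>xy\<close>, which \<open>G\<close> need not
  contain. The gain of 2 from the digon cancels the +2 that arises in
  \<open>genus_le\<close>.\<close>

lemma genus_le_plus: "euler_genus G \<le> euler_genus_plus x y G1 + euler_genus_plus x y G2"
proof -
  let ?G1 = "add_xy x y G1" and ?G2 = "add_xy x y G2"
  have S: "simple_graph ?G1" "simple_graph ?G2" "connected_graph ?G1" "connected_graph ?G2"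
    using simple_graph_add_xy connected_graph_add_xy s1 s2 c1 c2 x1 x2 y1 y2 xy by metis+
  obtain c where c: "realizable (verts ?G1) (edges ?G1) (card (edges ?G1)) c"
    "2 + int (card (edges ?G1)) - 2 * int (card (verts ?G1)) - c \<le> int (euler_genus ?G1)"
    by (rule euler_genus_realizable[OF S(1,3), of x y]) (use x1 y1 xy in auto)
  obtain d where d: "realizable (verts ?G2) (edges ?G2) (card (edges ?G2)) d"
    "2 + int (card (edges ?G2)) - 2 * int (card (verts ?G2)) - d \<le> int (euler_genus ?G2)"
    by (rule euler_genus_realizable[OF S(2,4), of x y]) (use x2 y2 xy in auto)
  have "{x, y} \<in> edges ?G1" "{x, y} \<in> edges ?G2" by simp_all
  note R = realizable_edge_sum[OF c(1) d(1) this xy]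
  have "int (euler_genus G) \<le> 2 + int (card (edges ?G1) + card (edges ?G2)) - 2 * int (card (verts G)) - (c + d + 2)"
    using euler_genus_upper[OF R cG] by auto
  then show ?thesis using c(2) d(2) card_verts unfolding euler_genus_plus_def add_xy_sel(1) by linarith
qed

text \<open>The two outcomes of \<open>separate\<close> give the two terms of the minimum. In the
  second, the terminals share a face on each side, so \<open>xy\<close> can be added there as a
  chord, and the gain of 1 on each side makes up for the lost 2.\<close>

lemma genus_ge: "min (euler_genus G1 + euler_genus G2 + 2) (euler_genus_plus x y G1 + euler_genus_plus x y G2)
    \<le> euler_genus G"
proof -
  obtain D t0 t1 t2 l where D: "flag_graph D t0 t1 t2 l" "l ` D = verts G" "edge_set D t0 l = edges G"
    "card D = 4 * card (edges G)"
    "2 + int (card (edges G)) - 2 * int (card (verts G)) - excess D t0 t1 t2 \<le> int (euler_genus G)"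
    by (rule euler_genus_realized[OF sG cG, of x y]) (use x1 y1 xy in auto)
  note g = flag_graphD[OF D(1)]
  define S where "S = {d \<in> D. {l d, l (t0 d)} \<in> edges G1}"
  have SD: "S \<subseteq> D" by (auto simp: S_def)
  have edge: "{l d, l (t0 d)} \<in> edges G1 \<union> edges G2" if "d \<in> D" for d
    using that D(3) unfolding edge_set_def G_sel by blast
  have edge2: "{l d, l (t0 d)} \<in> edges G2" if "d \<in> D - S" for d
    using edge[of d] that by (auto simp: S_def)
  have ends1: "l d \<in> verts G1" if "d \<in> S" for d
    using that s1 unfolding S_def simple_graph_def by blast
  have ends2: "l d \<in> verts G2" if "d \<in> D - S" for d
    using edge2[OF that] s2 unfolding simple_graph_def by blast
  have sided: "sided D S t0 t1 t2 l"
    by (rule sidedI[OF D(1), where P = "\<lambda>u v. {u, v} \<in> edges G1"]) (auto simp: g(7) S_def insert_commute)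
  note S0 = sided.S0[OF sided] sided.S2[OF sided]
  have "l a = x \<or> l a = y" if a: "a \<in> mixed D S t1" for a
  proof -
    have aD: "a \<in> D" "t1 a \<in> D" "l (t1 a) = l a" using a fiD(1)[OF g(5)] g(8) by (auto simp: mixed_def)
    have "l a \<in> verts G1 \<and> l a \<in> verts G2"
      using ends1[of a] ends1[of "t1 a"] ends2[of a] ends2[of "t1 a"] a aD by (auto simp: mixed_def)
    then show ?thesis using V by blast
  qed
  then obtain h where h: "flag_graph D t0 h t2 l" "\<forall>d\<in>S. h d \<in> S"
    and alt: "excess D t0 t1 t2 \<le> excess D t0 h t2 \<or> excess D t0 t1 t2 - 2 \<le> excess D t0 h t2 \<and>
      (\<exists>p\<in>S. \<exists>q\<in>S. l p = x \<and> l q = y \<and> (p, q) \<in> reach D h t0) \<and>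
      (\<exists>p\<in>D - S. \<exists>q\<in>D - S. l p = x \<and> l q = y \<and> (p, q) \<in> reach D h t0)"
    using separate[OF sided _ xy] by blast
  have cl: "t0 ` S \<subseteq> S" "h ` S \<subseteq> S" "t2 ` S \<subseteq> S" using S0 h(2) by auto
  note sp = split_sides[OF h(1) SD cl]
  have e1: "edge_set S t0 l = edges G1"
  proof (intro equalityI subsetI)
    fix e assume e: "e \<in> edges G1"
    then obtain d where "d \<in> D" "e = {l d, l (t0 d)}" using D(3) unfolding edge_set_def G_sel by blast
    then show "e \<in> edge_set S t0 l" using e unfolding edge_set_def S_def by blast
  qed (auto simp: edge_set_def S_def)
  have e2: "edge_set (D - S) t0 l = edges G2"
  proof (intro equalityI subsetI)
    fix e assume e: "e \<in> edges G2"
    then obtain d where "d \<in> D" "e = {l d, l (t0 d)}" using D(3) unfolding edge_set_def G_sel by blast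
    then show "e \<in> edge_set (D - S) t0 l" using e E unfolding edge_set_def S_def by blast
  qed (use edge2 in \<open>auto simp: edge_set_def\<close>)
  have lab: "l ` C = \<Union> (edge_set C t0 l)" if "flag_graph C t0 h t2 l" for C
    using fiD(1)[OF flag_graphD(4)[OF that]] unfolding edge_set_def by auto
  have v1: "l ` S = verts G1" using lab[OF sp(1)] e1 verts_union[OF s1 c1 x1 y1] xy by simp
  have v2: "l ` (D - S) = verts G2" using lab[OF sp(2)] e2 verts_union[OF s2 c2 x2 y2] xy by simp
  obtain m1 m2 where m: "card S = 4 * m1" "card (D - S) = 4 * m2"
    using flag_graph_card[OF sp(1)] flag_graph_card[OF sp(2)] by blast
  have m12: "m1 + m2 = card (edges G)" using sp(4) D(4) m by simp
  show ?thesis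
  proof (cases "excess D t0 t1 t2 \<le> excess D t0 h t2")
    case True
    have r1: "realizable (verts G1) (edges G1) m1 (excess S t0 h t2)"
      unfolding realizable_def using sp(1) e1 v1 m(1) by blast
    have r2: "realizable (verts G2) (edges G2) m2 (excess (D - S) t0 h t2)"
      unfolding realizable_def using sp(2) e2 v2 m(2) by blast
    have "int (euler_genus G1) + int (euler_genus G2) + 2 \<le> int (euler_genus G)"
      using euler_genus_upper[OF r1 c1 refl subset_refl] euler_genus_upper[OF r2 c2 refl subset_refl]
        sp(3) True D(5) m12 card_verts by linarith
    then show ?thesis by linarith
  next
    case False
    then obtain p q p' q' where P: "excess D t0 t1 t2 - 2 \<le> excess D t0 h t2"
      and p: "p \<in> S" "q \<in> S" "l p = x" "l q = y" "(p, q) \<in> reach D h t0"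
      and p': "p' \<in> D - S" "q' \<in> D - S" "l p' = x" "l q' = y" "(p', q') \<in> reach D h t0"
      using alt by blast
    have r1: "realizable (verts G1) (insert {x, y} (edges G1)) (m1 + 1) (excess S t0 h t2 + 1)"
      using realizable_add_chord[OF sp(1) m(1) p(1,2) sp(5)[OF p(1,5)]] p(3,4) e1 v1 by simp
    have r2: "realizable (verts G2) (insert {x, y} (edges G2)) (m2 + 1) (excess (D - S) t0 h t2 + 1)"
      using realizable_add_chord[OF sp(2) m(2) p'(1,2) sp(6)[OF p'(1,5)]] p'(3,4) e2 v2 by simp
    have "int (euler_genus_plus x y G1) + int (euler_genus_plus x y G2) \<le> int (euler_genus G)"
      using euler_genus_upper[OF r1 connected_graph_add_xy[OF c1], of x y]
        euler_genus_upper[OF r2 connected_graph_add_xy[OF c2], of x y]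
        sp(3) P D(5) m12 card_verts unfolding euler_genus_plus_def add_xy_sel by simp
    then show ?thesis by linarith
  qed
qed

lemma genus_eq: "euler_genus G =
    min (euler_genus G1 + euler_genus G2 + 2) (euler_genus_plus x y G1 + euler_genus_plus x y G2)"
  using genus_le genus_le_plus genus_ge by linarith

end

subsection \<open>Contracting a bridge\<close>

definition merge_to :: "'a \<Rightarrow> 'a set \<Rightarrow> 'a \<Rightarrow> 'a" where
  "merge_to m e v = (if v \<in> e then m else v)"

text \<open>The name of the new vertex is a parameter, so that statements about an edge remain
  symmetric in its two ends.\<close>

definition contract :: "'a \<Rightarrow> 'a set \<Rightarrow> 'a graph \<Rightarrow> 'a graph" where
  "contract m e H = Graph (merge_to m e ` verts H) ((`) (merge_to m e) ` (edges H - {e}))"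

lemma contract_sel [simp]:
  "verts (contract m e H) = merge_to m e ` verts H"
  "edges (contract m e H) = (`) (merge_to m e) ` (edges H - {e})"
  by (simp_all add: contract_def)

lemma simple_graph_contract:
  assumes H: "simple_graph H" and e: "e \<in> edges H" "m \<in> e"
  shows "simple_graph (contract m e H)"
  unfolding simple_graph_def
proof (intro conjI ballI)
  show "finite (verts (contract m e H))" using H by (simp add: simple_graph_def)
  fix d assume "d \<in> edges (contract m e H)"
  then obtain d0 where d0: "d0 \<in> edges H" "d0 \<noteq> e" "d = merge_to m e ` d0" by auto
  then have "d0 \<subseteq> verts H" "card d0 = 2" "card e = 2" using H e by (auto simp: simple_graph_def)
  then show "d \<subseteq> verts (contract m e H)" using d0(3) by auto
  obtain u v where uv: "d0 = {u, v}" "u \<noteq> v" using \<open>card d0 = 2\<close> by (auto simp: card_2_iff)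
  have "merge_to m e u \<noteq> merge_to m e v"
  proof
    assume eq: "merge_to m e u = merge_to m e v"
    then have "u \<in> e \<and> v \<in> e" using e(2) uv(2) unfolding merge_to_def by metis
    then have "d0 \<subseteq> e" using uv by simp
    moreover have "finite e" using \<open>card e = 2\<close> card.infinite by fastforce
    ultimately have "d0 = e" using card_subset_eq[of e d0] \<open>card d0 = 2\<close> \<open>card e = 2\<close> by simp
    then show False using d0(2) by simp
  qed
  then show "card d = 2" using d0(3) uv(1) by simp
qed

lemma connected_graph_contract:
  assumes H: "connected_graph H" and e: "m \<in> e" "e \<subseteq> verts H"
  shows "connected_graph (contract m e H)"
  unfolding connected_graph_def
proof (intro conjI ballI)
  show "verts (contract m e H) \<noteq> {}" using H by (simp add: connected_graph_def)
  fix u v assume "u \<in> verts (contract m e H)" "v \<in> verts (contract m e H)"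
  then obtain p q where pq: "p \<in> verts H" "q \<in> verts H" "u = merge_to m e p" "v = merge_to m e q" by auto
  have "(p, q) \<in> {(a, b). {a, b} \<in> edges H}\<^sup>*" using H pq by (simp add: connected_graph_def)
  then have "(merge_to m e p, merge_to m e q) \<in> {(a, b). {a, b} \<in> edges (contract m e H)}\<^sup>*"
  proof (rule map_rtrancl)
    fix y z assume "(y, z) \<in> {(a, b). {a, b} \<in> edges H}"
    then have yz: "{y, z} \<in> edges H" by simp
    show "(merge_to m e y, merge_to m e z) \<in> {(a, b). {a, b} \<in> edges (contract m e H)}\<^sup>*"
    proof (cases "{y, z} = e")
      case True
      then have "merge_to m e y = merge_to m e z" by (auto simp: merge_to_def)
      then show ?thesis by simp
    next
      case False
      then have "merge_to m e ` {y, z} \<in> edges (contract m e H)" using yz by (simp del: image_insert)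
      then show ?thesis by (intro r_into_rtrancl) simp
    qed
  qed
  then show "(u, v) \<in> {(a, b). {a, b} \<in> edges (contract m e H)}\<^sup>*" using pq by simp
qed

text \<open>Joining the sides at a common vertex merges the faces of \<open>p\<close> and
  \<open>p'\<close>, and the new edge is drawn across the merged face.\<close>

lemma join_chord:
  assumes G: "flag_graph D t0 t1 t2 l" and S: "S \<subseteq> D" "t0 ` S \<subseteq> S" "t1 ` S \<subseteq> S" "t2 ` S \<subseteq> S"
    and q: "q \<in> S" "q' \<in> D - S" "l q = l q'" and m: "card D = 4 * m"
    and p: "p \<in> D" "p' \<in> D" "(q, p) \<in> reach D t1 t0" "(q', p') \<in> reach D t1 t0"
  shows "realizable (l ` D) (insert {l p, l p'} (edge_set D t0 l)) (m + 1) (excess D t0 t1 t2 + 1)"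
  using realizable_add_chord[OF join_across(1)[OF G S q] m p(1,2) join_across(4)[OF G S q p(3,4)]]
    join_across(2)[OF G S q] by simp

section \<open>Edge cuts of size at most two\<close>

lemma labels_Union:
  assumes "fi D t0" shows "l ` D = \<Union> (edge_set D t0 l)"
  using fiD(1)[OF assms] unfolding edge_set_def by auto

text \<open>No edge other than \<open>{a, b}\<close> and possibly \<open>{s, t}\<close> runs between
  \<open>A\<close> and \<open>B\<close>. If \<open>{s, t}\<close> is counted with the side of
  \<open>B\<close>, the two sides of \<open>H'\<close> meet only in the merged vertex and in
  \<open>s\<close>, the situation of \<open>separate\<close>.\<close>

locale two_cut =
  fixes H :: "'a graph" and A B :: "'a set" and a b s t m :: 'a
  assumes H: "simple_graph H" "connected_graph H" and V: "verts H = A \<union> B" "A \<inter> B = {}"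
    and a: "a \<in> A" and b: "b \<in> B" and e: "{a, b} \<in> edges H" and s: "s \<in> A" "s \<noteq> a" and t: "t \<in> B"
    and m: "m = a \<or> m = b"
    and within: "\<And>d. d \<in> edges H \<Longrightarrow> d \<noteq> {a, b} \<Longrightarrow> d \<noteq> {s, t} \<Longrightarrow> d \<subseteq> A \<or> d \<subseteq> B"
begin

abbreviation "mg \<equiv> merge_to m {a, b}"
abbreviation "H' \<equiv> contract m {a, b} H"

lemma ab: "a \<noteq> b" "a \<notin> B" "b \<notin> A" "s \<notin> B" "t \<notin> A" "s \<noteq> b"
  using a b s t V by auto

lemma sH': "simple_graph H'" and cH': "connected_graph H'"
  using simple_graph_contract[OF H(1) e] connected_graph_contract[OF H(2), of m "{a, b}"] m H(1) e
  by (auto simp: simple_graph_def)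

lemma H'_verts: "m \<in> verts H'" "s \<in> verts H'" "s \<noteq> m" "v \<in> verts H' \<Longrightarrow> v \<in> {a, b} \<Longrightarrow> v = m"
  using V a s ab m by (auto simp: merge_to_def image_iff)

lemma card_H': "card (verts H') + 1 = card (verts H)"
proof -
  have "finite (verts H)" using H(1) by (simp add: simple_graph_def)
  have "verts H' = verts H - {if m = a then b else a}"
    using V a b m ab by (auto simp: merge_to_def image_iff)
  moreover have "(if m = a then b else a) \<in> verts H" using V a b by auto
  ultimately show ?thesis using card_Suc_Diff1[OF \<open>finite (verts H)\<close>] by simp
qed

lemma edge_card: "{u, v} \<in> edges H \<Longrightarrow> u \<noteq> v \<and> u \<in> verts H \<and> v \<in> verts H"
  using H(1) by (auto simp: simple_graph_def)

text \<open>The excluded case is the one in which contraction makes \<open>{s, t}\<close> parallel to another edge.\<close>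

lemma genus_le_contract_no_parallel:
  assumes np: "\<not> ({s, t} \<in> edges H \<and> t = b \<and> {a, s} \<in> edges H)"
  shows "euler_genus H \<le> euler_genus H'"
proof -
  obtain D t0 t1 t2 l where D: "flag_graph D t0 t1 t2 l" "l ` D = verts H'" "edge_set D t0 l = edges H'"
    "card D = 4 * card (edges H')"
    "2 + int (card (edges H')) - 2 * int (card (verts H')) - excess D t0 t1 t2 \<le> int (euler_genus H')"
    by (rule euler_genus_realized[OF sH' cH' H'_verts(1,2,3)])
  note g = flag_graphD[OF D(1)]
  \<comment> \<open>The labelling \<open>k\<close> undoes the contraction: it decides from which end
    of the contracted edge a flag at \<open>m\<close> comes. The test is unambiguous as long as
    \<open>a\<close> and \<open>b\<close> have no common neighbour.\<close>
  define k where "k d = (if l d = m then (if {b, l (t0 d)} \<in> edges H then b else a) else l d)" for d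
  have lV: "l d \<in> verts H'" if "d \<in> D" for d using that D(2) by blast
  have lab: "l d \<notin> {a, b}" if "d \<in> D" "l d \<noteq> m" for d using H'_verts(4)[OF lV[OF that(1)]] that(2) by blast
  have pre: "\<exists>u v. {u, v} \<in> edges H \<and> {u, v} \<noteq> {a, b} \<and> l d = mg u \<and> l (t0 d) = mg v \<and> mg u \<noteq> mg v"
    if d: "d \<in> D" for d
  proof -
    have "{l d, l (t0 d)} \<in> edges H'" using d D(3) unfolding edge_set_def by blast
    then obtain d0 where d0: "d0 \<in> edges H" "d0 \<noteq> {a, b}" "{l d, l (t0 d)} = mg ` d0" by auto
    obtain u v where uv: "d0 = {u, v}" using d0(1) H(1) by (auto simp: simple_graph_def card_2_iff)
    have "card (mg ` d0) = 2" using sH' d0 unfolding simple_graph_def contract_sel by blast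
    then have "mg u \<noteq> mg v" using uv by auto
    moreover have "(l d = mg u \<and> l (t0 d) = mg v) \<or> (l d = mg v \<and> l (t0 d) = mg u)"
      using d0(3) uv by (auto simp: doubleton_eq_iff)
    moreover have "{v, u} = {u, v}" by blast
    ultimately show ?thesis using d0(1,2) uv by metis
  qed
  have mg_id: "mg u = u" "mg u \<notin> {a, b}" if "mg u \<noteq> m" for u using that by (auto simp: merge_to_def)
  have mg_m: "u \<in> {a, b}" if "mg u = m" for u
    using that m unfolding merge_to_def by (auto split: if_splits)
  have half: "{k d, l (t0 d)} \<in> edges H \<and> {k d, l (t0 d)} \<noteq> {a, b} \<and> k (t0 d) = l (t0 d)"
    if d: "d \<in> D" "l d = m" for d
  proof -
    obtain u v where uv: "{u, v} \<in> edges H" "{u, v} \<noteq> {a, b}" "l d = mg u" "l (t0 d) = mg v" "mg u \<noteq> mg v"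
      using pre[OF d(1)] by blast
    have v: "mg v = v" "v \<notin> {a, b}" "l (t0 d) = v" "l (t0 d) \<noteq> m" using mg_id[of v] uv d(2) by auto
    have u: "u = a \<or> u = b" using mg_m[of u] uv(3) d(2) by auto
    have "{k d, v} \<in> edges H" using u uv(1) v(3) d(2) by (auto simp: k_def)
    moreover have "{k d, v} \<noteq> {a, b}" using v(2) by (auto simp: doubleton_eq_iff)
    ultimately show ?thesis using v(3,4) by (simp add: k_def)
  qed
  have ed: "{k d, k (t0 d)} \<in> edges H \<and> {k d, k (t0 d)} \<noteq> {a, b}" if d: "d \<in> D" for d
  proof -
    have d': "t0 d \<in> D" "t0 (t0 d) = d" using fiD[OF g(4) d] by auto
    consider "l d = m" | "l (t0 d) = m" | "l d \<noteq> m" "l (t0 d) \<noteq> m" by blast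
    then show ?thesis
    proof cases
      case 1
      then show ?thesis using half[OF d] by simp
    next
      case 2
      then show ?thesis using half[OF d'(1)] d'(2) by (simp add: insert_commute)
    next
      case 3
      then show ?thesis using pre[OF d] mg_id by (metis k_def)
    qed
  qed
  have cover: "{u, v} \<in> edge_set D t0 k" if uv: "{u, v} \<in> edges H" "{u, v} \<noteq> {a, b}" "v \<notin> {a, b}" for u v
  proof -
    have "mg ` {u, v} \<in> edges H'" using uv(1,2) by (simp del: image_insert)
    moreover have "mg v = v" using uv(3) by (simp add: merge_to_def)
    ultimately have "{mg u, v} \<in> edge_set D t0 l" using D(3) by simp
    then obtain d where d: "d \<in> D" "l d = mg u" "l (t0 d) = v" by (rule edge_flag[OF D(1)])
    have "v \<noteq> m" using uv(3) m by auto
    then have kv: "k (t0 d) = v" using d(3) by (simp add: k_def)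
    have "k d = u"
    proof (cases "u \<in> {a, b}")
      case False
      then have "l d = u" "l d \<noteq> m" using d(2) m by (auto simp: merge_to_def)
      then show ?thesis by (simp add: k_def)
    next
      case True
      then have ldm: "l d = m" using d(2) by (simp add: merge_to_def)
      \<comment> \<open>For a common neighbour \<open>v\<close>, one of the edges to
        \<open>a\<close> and \<open>b\<close> would run between the sides and so be
        \<open>{s, t}\<close>; this leaves only the case excluded by \<open>np\<close>.\<close>
      have "{b, v} \<notin> edges H" if ua: "u = a"
      proof
        assume bv: "{b, v} \<in> edges H"
        have av: "{a, v} \<in> edges H" using uv(1) ua by simp
        have ne: "{b, v} \<noteq> {a, b}" "{a, v} \<noteq> {a, b}" using uv(3) by (auto simp: doubleton_eq_iff)
        have "v \<in> A \<or> v \<in> B" using edge_card[OF bv] V by blast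
        then show False
        proof
          assume "v \<in> A"
          then have "v \<notin> B" using V(2) by blast
          then have "{b, v} = {s, t}" using within[OF bv ne(1)] ab(3) b by auto
          then have "b = t" "v = s" using \<open>v \<in> A\<close> ab t by (auto simp: doubleton_eq_iff)
          then show False using np bv av by (simp add: insert_commute)
        next
          assume "v \<in> B"
          then have "v \<notin> A" using V(2) by blast
          then have "{a, v} = {s, t}" using within[OF av ne(2)] ab(2) by auto
          then show False using s ab \<open>v \<in> B\<close> by (auto simp: doubleton_eq_iff)
        qed
      qed
      then show ?thesis using True ldm d(3) uv(1) by (auto simp: k_def)
    qed
    then show ?thesis using d(1) kv unfolding edge_set_def by blast
  qed
  have Ek: "edge_set D t0 k = edges H - {{a, b}}"
  proof (intro equalityI subsetI)
    fix f assume f: "f \<in> edges H - {{a, b}}"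
    then have "card f = 2" using H(1) by (simp add: simple_graph_def)
    then obtain u v where uv: "f = {u, v}" by (auto simp: card_2_iff)
    have "\<not> {u, v} \<subseteq> {a, b}" using f uv edge_card[of u v] by auto
    then show "f \<in> edge_set D t0 k" using cover[of u v] cover[of v u] f uv by (auto simp: insert_commute)
  qed (use ed in \<open>auto simp: edge_set_def\<close>)
  have t20: "l (t0 (t2 d)) = l (t0 d)" if d: "d \<in> D" for d
    using flag_systemD(4)[OF g(1) d] g(7)[OF fiD(1)[OF g(4) d]] by simp
  have k2: "k (t2 d) = k d" if d: "d \<in> D" for d
    using g(7)[OF d] t20[OF d] by (simp add: k_def)
  define S where "S = {d \<in> D. k d \<in> A \<and> k (t0 d) \<in> A}"
  have SD: "S \<subseteq> D" by (auto simp: S_def)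
  have sided: "sided D S t0 t1 t2 l"
    by (rule sidedI[OF D(1), where P = "\<lambda>u v. u \<in> A \<and> v \<in> A"]) (auto simp: k2 S_def)
  note S0 = sided.S0[OF sided] sided.S2[OF sided]
  have CS: "k d \<in> B \<or> k d = s" if d: "d \<in> D" "d \<notin> S" for d
  proof -
    have "\<not> {k d, k (t0 d)} \<subseteq> A" using d by (auto simp: S_def)
    then have "{k d, k (t0 d)} \<subseteq> B \<or> {k d, k (t0 d)} = {s, t}" using within ed[OF d(1)] by metis
    then show ?thesis using t by (auto simp: doubleton_eq_iff)
  qed
  have km: "k d = a \<or> k d = b" if "l d = m" for d using that by (simp add: k_def)
  have kS: "k d = a" if "d \<in> S" "l d = m" for d using km[OF that(2)] that(1) ab by (auto simp: S_def)
  have kC: "k d = b" if "d \<in> D" "d \<notin> S" "l d = m" for d using km[OF that(3)] CS[OF that(1,2)] ab s by auto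
  have cr: "l p = m \<or> l p = s" if p: "p \<in> S" "q \<in> D" "q \<notin> S" "l q = l p" for p q
  proof (cases "l p = m")
    case False
    then have "k p = l p" "k q = l p" using p(4) by (simp_all add: k_def)
    moreover have "k p \<in> A" using p(1) by (simp add: S_def)
    ultimately show ?thesis using CS[OF p(2,3)] V(2) by auto
  qed simp
  have "l d = m \<or> l d = s" if d: "d \<in> mixed D S t1" for d
  proof -
    have dD: "d \<in> D" "t1 d \<in> D" "l (t1 d) = l d" "t1 d \<in> S \<longleftrightarrow> d \<notin> S"
      using d fiD(1)[OF g(5)] g(8) by (auto simp: mixed_def)
    then show ?thesis using cr[of d "t1 d"] cr[of "t1 d" d] by auto
  qed
  moreover note sided
  moreover have "m \<noteq> s" using H'_verts(3) by simp
  ultimately obtain h where h: "flag_graph D t0 h t2 l" "\<forall>d\<in>S. h d \<in> S"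
    and alt: "excess D t0 t1 t2 \<le> excess D t0 h t2 \<or> excess D t0 t1 t2 - 2 \<le> excess D t0 h t2 \<and>
      (\<exists>p\<in>S. \<exists>q\<in>S. l p = m \<and> l q = s \<and> (p, q) \<in> reach D h t0) \<and>
      (\<exists>p\<in>D - S. \<exists>q\<in>D - S. l p = m \<and> l q = s \<and> (p, q) \<in> reach D h t0)"
    using separate[of D S t0 t1 t2 l m s] by blast
  note gh = flag_graphD[OF h(1)]
  have hC: "h d \<notin> S" if "d \<in> D" "d \<notin> S" for d
    using h(2) fiD(2)[OF gh(5) that(1)] that(2) by metis
  \<comment> \<open>The labels \<open>k\<close> divide the flags at \<open>m\<close> exactly by
    sides. As \<open>h\<close> respects the sides, it is a rotation for the finer labelling
    too.\<close>
  have kh: "k (h d) = k d" if d: "d \<in> D" for d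
  proof (cases "l d = m")
    case True
    then have "l (h d) = m" using gh(8)[OF d] by simp
    then show ?thesis
      using True kS[of d] kS[of "h d"] kC[OF d] kC[OF fiD(1)[OF gh(5) d]] h(2) hC[OF d] by metis
  next
    case False
    then show ?thesis using gh(8)[OF d] by (simp add: k_def)
  qed
  have Gk: "flag_graph D t0 h t2 k"
    using gh(1,5) kh k2 by (simp add: flag_graph_def rotation_def)
  have kV: "k ` D \<union> {a, b} = verts H"
  proof -
    have "k ` D \<union> {a, b} = \<Union> (edges H)" unfolding labels_Union[OF g(4)] Ek using e by blast
    then show ?thesis using verts_union[OF H, of a b] V a b ab by auto
  qed
  have Eab: "insert {a, b} (edges H - {{a, b}}) = edges H" using e by blast
  \<comment> \<open>Undoing the contraction adds an edge and a vertex, so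
    \<open>2 + m - 2 n - excess\<close> does not grow even if the excess drops by 1.\<close>
  have "\<exists>\<phi>. realizable (verts H) (edges H) (card (edges H') + 1) \<phi> \<and> excess D t0 t1 t2 - 1 \<le> \<phi>"
  proof (cases "excess D t0 t1 t2 \<le> excess D t0 h t2")
    case True
    have "realizable (k ` D) (edges H - {{a, b}}) (card (edges H')) (excess D t0 h t2)"
      unfolding realizable_def using Gk Ek D(4) by blast
    from realizable_add_edge[OF this, of a b] show ?thesis using True unfolding Eab kV
      by (intro exI[of _ "excess D t0 h t2 - 1"]) simp
  next
    case False
    then obtain p q p' q' where P: "excess D t0 t1 t2 - 2 \<le> excess D t0 h t2"
      and p: "p \<in> S" "q \<in> S" "l p = m" "l q = s" "(p, q) \<in> reach D h t0"
      and p': "p' \<in> D - S" "q' \<in> D - S" "l p' = m" "l q' = s" "(p', q') \<in> reach D h t0"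
      using alt by blast
    have sym: "sym (reach D h t0)" using gh by (simp add: sym_Un fr_sym sym_rtrancl)
    have kk: "k p = a" "k p' = b" "k q = k q'"
      using kS p p' kC \<open>m \<noteq> s\<close> by (auto simp: k_def)
    have pD: "p \<in> D" "p' \<in> D" using p p' SD by auto
    have cl: "t0 ` S \<subseteq> S" "h ` S \<subseteq> S" "t2 ` S \<subseteq> S" using S0 h(2) by auto
    \<comment> \<open>After the sides are joined at \<open>s\<close>, the faces through
      \<open>a\<close> and through \<open>b\<close> are one, and the contracted edge is a chord of
      it. The loss of 2 and the gain of 1 leave -1.\<close>
    have "realizable (k ` D) (insert {k p, k p'} (edge_set D t0 k)) (card (edges H') + 1) (excess D t0 h t2 + 1)"
      by (rule join_chord[OF Gk SD cl p(2) p'(2) kk(3) D(4) pD symD[OF sym p(5)] symD[OF sym p'(5)]])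
    moreover have "k ` D = verts H" using kV kk(1,2) pD by blast
    ultimately have "realizable (verts H) (edges H) (card (edges H') + 1) (excess D t0 h t2 + 1)"
      unfolding kk(1,2) Ek Eab by simp
    then show ?thesis using P by (intro exI[of _ "excess D t0 h t2 + 1"]) simp
  qed
  then obtain \<phi> where R: "realizable (verts H) (edges H) (card (edges H') + 1) \<phi>" and \<phi>: "excess D t0 t1 t2 - 1 \<le> \<phi>"
    by blast
  have "int (euler_genus H) \<le> int (euler_genus H')"
    using euler_genus_upper[OF R H(2) refl subset_refl] \<phi> D(5) card_H' by linarith
  then show ?thesis by simp
qed

end

text \<open>Without \<open>{s, b}\<close> the edge \<open>{a, b}\<close> is a bridge, so the sides
  meet in \<open>a\<close> alone and separate at no cost. Then \<open>{s, b}\<close> can be drawn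
  close to the path through \<open>s\<close>, \<open>a\<close>, \<open>b\<close>.\<close>

lemma euler_genus_triangle:
  assumes H: "simple_graph H" "connected_graph H" and V: "verts H = A \<union> B" "A \<inter> B = {}"
    and a: "a \<in> A" and b: "b \<in> B" and s: "s \<in> A" "s \<noteq> a"
    and e: "{a, b} \<in> edges H" "{s, b} \<in> edges H" "{a, s} \<in> edges H"
    and within: "\<And>d. d \<in> edges H \<Longrightarrow> d \<noteq> {a, b} \<Longrightarrow> d \<noteq> {s, b} \<Longrightarrow> d \<subseteq> A \<or> d \<subseteq> B"
  defines "H0 \<equiv> Graph (verts H) (edges H - {{s, b}})"
  shows "simple_graph H0" "connected_graph H0" "euler_genus H \<le> euler_genus H0"
proof -
  have ne: "a \<noteq> b" "s \<noteq> b" "b \<notin> A" "a \<notin> B" "s \<notin> B" using a b s V by auto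
  have V0: "verts H0 = verts H" "edges H0 = edges H - {{s, b}}" by (simp_all add: H0_def)
  show s0: "simple_graph H0" using H(1) V0 by (simp add: simple_graph_def)
  have e0: "{a, b} \<in> edges H0" "{a, s} \<in> edges H0"
    using e s ne unfolding V0 by (auto simp: doubleton_eq_iff)
  let ?r = "{(p, q). {p, q} \<in> edges H0}"
  have path: "(s, b) \<in> ?r\<^sup>*" "(b, s) \<in> ?r\<^sup>*"
  proof -
    have "(s, a) \<in> ?r" "(a, b) \<in> ?r" "(b, a) \<in> ?r" "(a, s) \<in> ?r" using e0 by (auto simp: insert_commute)
    then show "(s, b) \<in> ?r\<^sup>*" "(b, s) \<in> ?r\<^sup>*" by (meson r_into_rtrancl rtrancl.rtrancl_into_rtrancl)+
  qed
  have "{(p, q). {p, q} \<in> edges H} \<subseteq> ?r\<^sup>*"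
  proof
    fix z assume "z \<in> {(p, q). {p, q} \<in> edges H}"
    then obtain p q where z: "z = (p, q)" "{p, q} \<in> edges H" by blast
    show "z \<in> ?r\<^sup>*"
    proof (cases "{p, q} = {s, b}")
      case True
      then show ?thesis using z(1) path by (auto simp: doubleton_eq_iff)
    next
      case False
      then show ?thesis using z V0 by (intro r_into_rtrancl) simp
    qed
  qed
  then have "{(p, q). {p, q} \<in> edges H}\<^sup>* \<subseteq> ?r\<^sup>*" by (rule rtrancl_sub_rtrancl)
  then show c0: "connected_graph H0" using H(2) V0(1) unfolding connected_graph_def by blast
  have v0: "a \<in> verts H0" "s \<in> verts H0" using V0 V a s by auto
  obtain D t0 t1 t2 l where D: "flag_graph D t0 t1 t2 l" "l ` D = verts H0" "edge_set D t0 l = edges H0"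
    "card D = 4 * card (edges H0)"
    "2 + int (card (edges H0)) - 2 * int (card (verts H0)) - excess D t0 t1 t2 \<le> int (euler_genus H0)"
    by (rule euler_genus_realized[OF s0 c0 v0 s(2)])
  note g = flag_graphD[OF D(1)]
  define S where "S = {d \<in> D. l d \<in> A \<and> l (t0 d) \<in> A}"
  have SD: "S \<subseteq> D" by (auto simp: S_def)
  have sided: "sided D S t0 t1 t2 l"
    by (rule sidedI[OF D(1), where P = "\<lambda>u v. u \<in> A \<and> v \<in> A"]) (auto simp: g(7) S_def)
  note S0 = sided.S0[OF sided] sided.S2[OF sided]
  have CS: "l d \<in> B \<or> l d = a" if d: "d \<in> D" "d \<notin> S" for d
  proof -
    have "{l d, l (t0 d)} \<in> edge_set D t0 l" using d(1) unfolding edge_set_def by blast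
    then have "{l d, l (t0 d)} \<in> edges H" "{l d, l (t0 d)} \<noteq> {s, b}" unfolding D(3) V0 by auto
    moreover have "\<not> {l d, l (t0 d)} \<subseteq> A" using d by (auto simp: S_def)
    ultimately have "{l d, l (t0 d)} \<subseteq> B \<or> {l d, l (t0 d)} = {a, b}" using within by metis
    then show ?thesis using b by (auto simp: doubleton_eq_iff)
  qed
  have "l d = a \<or> l d = b" if d: "d \<in> mixed D S t1" for d
  proof -
    have dD: "d \<in> D" "t1 d \<in> D" "l (t1 d) = l d" "t1 d \<in> S \<longleftrightarrow> d \<notin> S"
      using d fiD(1)[OF g(5)] g(8) by (auto simp: mixed_def)
    have "l p = a" if "p \<in> S" "q \<in> D" "q \<notin> S" "l q = l p" for p q
      using that CS[OF that(2,3)] V(2) unfolding S_def by auto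
    then show ?thesis using dD by metis
  qed
  moreover note sided
  ultimately obtain h where h: "flag_graph D t0 h t2 l" "\<forall>d\<in>S. h d \<in> S"
    and alt: "excess D t0 t1 t2 \<le> excess D t0 h t2 \<or> (\<exists>p\<in>S. \<exists>q\<in>S. l p = a \<and> l q = b)"
    using separate[of D S t0 t1 t2 l a b] ne(1) by blast
  \<comment> \<open>The second label offered to \<open>separate\<close> is \<open>b\<close>, which
    does not occur on the side of \<open>A\<close>; so the alternative with a loss is
    impossible.\<close>
  have P: "excess D t0 t1 t2 \<le> excess D t0 h t2" using alt ne(3) unfolding S_def by blast
  note gh = flag_graphD[OF h(1)]
  have "{a, s} \<in> edge_set D t0 l" "{a, b} \<in> edge_set D t0 l" using e0 D(3) by simp_all
  then obtain q q' where q: "q \<in> D" "l q = a" "l (t0 q) = s" and q': "q' \<in> D" "l q' = a" "l (t0 q') = b"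
    using edge_flag[OF D(1)] by metis
  have qS: "q \<in> S" "q' \<in> D - S" using q q' a s ne by (auto simp: S_def)
  have cl: "t0 ` S \<subseteq> S" "h ` S \<subseteq> S" "t2 ` S \<subseteq> S" using S0 h(2) by auto
  have lq: "l q = l q'" using q q' by simp
  have f: "(q, t0 q) \<in> reach D h t0" "(q', t0 q') \<in> reach D h t0"
    by (rule r_into_rtrancl, simp add: q q')+
  have "realizable (l ` D) (insert {l (t0 q), l (t0 q')} (edge_set D t0 l)) (card (edges H0) + 1) (excess D t0 h t2 + 1)"
    by (rule join_chord[OF h(1) SD cl qS lq D(4) fiD(1)[OF g(4) q(1)] fiD(1)[OF g(4) q'(1)] f])
  moreover have "insert {s, b} (edges H0) = edges H" using e(2) V0 by blast
  ultimately have R: "realizable (verts H) (edges H) (card (edges H0) + 1) (excess D t0 h t2 + 1)"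
    using q(3) q'(3) D(2,3) V0(1) by simp
  have "int (euler_genus H) \<le> int (euler_genus H0)"
    using euler_genus_upper[OF R H(2) refl subset_refl] P D(5) V0(1) by simp
  then show "euler_genus H \<le> euler_genus H0" by simp
qed

text \<open>In the parallel case the contraction identifies \<open>{s, b}\<close> with
  \<open>{a, s}\<close>. Deleting \<open>{s, b}\<close> beforehand therefore gives the same
  contracted graph, and by the triangle lemma it does not lower the genus.\<close>

lemma (in two_cut) genus_le_contraction: "euler_genus H \<le> euler_genus H'"
proof (cases "{s, t} \<in> edges H \<and> t = b \<and> {a, s} \<in> edges H")
  case True
  define H0 where "H0 = Graph (verts H) (edges H - {{s, b}})"
  have w: "d \<subseteq> A \<or> d \<subseteq> B" if "d \<in> edges H" "d \<noteq> {a, b}" "d \<noteq> {s, b}" for d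
    using within[OF that(1,2)] that(3) True by blast
  have sb: "{s, b} \<in> edges H" "{a, s} \<in> edges H" using True by auto
  note T = euler_genus_triangle[OF H V a b s e sb w, folded H0_def]
  interpret Z: two_cut H0 A B a b s t m
    using T(1,2) V a b e s t m within ab
    by unfold_locales (auto simp: H0_def doubleton_eq_iff)
  have "euler_genus H0 \<le> euler_genus (contract m {a, b} H0)"
    by (rule Z.genus_le_contract_no_parallel) (simp add: H0_def True)
  moreover have "contract m {a, b} H0 = contract m {a, b} H"
  proof -
    have "mg ` {s, b} = mg ` {a, s}" by (auto simp: merge_to_def)
    moreover have "{a, s} \<in> edges H - {{s, b}} - {{a, b}}"
      using True ab s by (auto simp: doubleton_eq_iff)
    moreover have "edges H - {{a, b}} = insert {s, b} (edges H - {{s, b}} - {{a, b}})"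
      using True ab s by (auto simp: doubleton_eq_iff)
    ultimately have "(`) mg ` (edges H - {{a, b}}) = (`) mg ` (edges H - {{s, b}} - {{a, b}})"
      by (metis image_insert insert_absorb image_eqI)
    then show ?thesis by (simp add: contract_def H0_def)
  qed
  ultimately show ?thesis using T(3) by simp
qed (rule genus_le_contract_no_parallel)

lemma genus_le_contract_cut:
  assumes H: "simple_graph H" "connected_graph H" and V: "verts H = A \<union> B" "A \<inter> B = {}"
    and ab: "a \<in> A" "b \<in> B" "{a, b} \<in> edges H" and pq: "p \<in> A" "q \<in> B" "{p, q} \<noteq> {a, b}"
    and m: "m \<in> {a, b}"
    and within: "\<And>d. d \<in> edges H \<Longrightarrow> d \<noteq> {a, b} \<Longrightarrow> d \<noteq> {p, q} \<Longrightarrow> d \<subseteq> A \<or> d \<subseteq> B"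
  shows "euler_genus H \<le> euler_genus (contract m {a, b} H)"
proof (cases "p = a")
  case False
  interpret two_cut H A B a b p q m
    by unfold_locales (use assms False in auto)
  show ?thesis by (rule genus_le_contraction)
next
  case True
  \<comment> \<open>The roles of the two sides are exchanged, because the second cut pair must have
    an end away from the contracted edge on the side called \<open>A\<close>.\<close>
  then have "q \<noteq> b" using pq(3) by metis
  have w: "d \<subseteq> B \<or> d \<subseteq> A" if "d \<in> edges H" "d \<noteq> {b, a}" "d \<noteq> {q, p}" for d
    using within[OF that(1)] that(2,3) by (auto simp: insert_commute)
  interpret two_cut H B A b a q p m
    using w by unfold_locales (use assms \<open>q \<noteq> b\<close> in \<open>auto simp: insert_commute\<close>)
  show ?thesis using genus_le_contraction by (simp add: insert_commute)
qed

text \<open>With \<open>A\<close> the component of \<open>a\<close> after removal of the bridge,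
  both graphs fall under \<open>genus_le_contract_cut\<close> with the same \<open>p\<close> and
  \<open>q\<close>: adding \<open>xy\<close> creates at most one further edge between the
  sides.\<close>

lemma bridge_contract:
  assumes H: "simple_graph H" "connected_graph H" and x: "x \<in> verts H" "y \<in> verts H" "x \<noteq> y"
    and nadj: "{x, y} \<notin> edges H" and e: "e \<in> edges H" "m \<in> e"
    and bridge: "\<not> connected_graph (Graph (verts H) (edges H - {e}))"
  shows "euler_genus H \<le> euler_genus (contract m e H)"
    "euler_genus (add_xy x y H) \<le> euler_genus (contract m e (add_xy x y H))"
proof -
  obtain a b where ab: "e = {a, b}" "a \<noteq> b" using H(1) e(1) by (auto simp: simple_graph_def card_2_iff)
  have abV: "a \<in> verts H" "b \<in> verts H" using H(1) e(1) ab by (auto simp: simple_graph_def)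
  let ?r = "{(u, v). {u, v} \<in> edges H - {e}}"
  have symr: "sym ?r" by (auto simp: sym_def insert_commute)
  define A where "A = {w \<in> verts H. (a, w) \<in> ?r\<^sup>*}"
  define B where "B = verts H - A"
  have V: "verts H = A \<union> B" "A \<inter> B = {}" by (auto simp: A_def B_def)
  have aA: "a \<in> A" using abV by (simp add: A_def)
  have "(a, b) \<notin> ?r\<^sup>*"
  proof
    assume p: "(a, b) \<in> ?r\<^sup>*"
    have p': "(b, a) \<in> ?r\<^sup>*" using p symr by (meson symD sym_rtrancl)
    have "{(u, v). {u, v} \<in> edges H} \<subseteq> ?r\<^sup>*"
    proof
      fix z assume "z \<in> {(u, v). {u, v} \<in> edges H}"
      then obtain u v where z: "z = (u, v)" "{u, v} \<in> edges H" by blast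
      show "z \<in> ?r\<^sup>*"
      proof (cases "{u, v} = e")
        case True
        then show ?thesis using z(1) p p' ab(1) by (auto simp: doubleton_eq_iff)
      next
        case False
        then show ?thesis using z by (intro r_into_rtrancl) simp
      qed
    qed
    then have "{(u, v). {u, v} \<in> edges H}\<^sup>* \<subseteq> ?r\<^sup>*" by (rule rtrancl_sub_rtrancl)
    then have "connected_graph (Graph (verts H) (edges H - {e}))"
      using H(2) unfolding connected_graph_def graph.sel by blast
    then show False using bridge by simp
  qed
  then have bB: "b \<in> B" using abV by (simp add: A_def B_def)
  have w: "d \<subseteq> A \<or> d \<subseteq> B" if d: "d \<in> edges H" "d \<noteq> e" for d
  proof -
    obtain u v where uv: "d = {u, v}" using H(1) d(1) by (auto simp: simple_graph_def card_2_iff)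
    have uvV: "u \<in> verts H" "v \<in> verts H" using H(1) d(1) uv by (auto simp: simple_graph_def)
    have "(u, v) \<in> ?r" "(v, u) \<in> ?r" using d uv by (auto simp: insert_commute)
    then have "(a, u) \<in> ?r\<^sup>* \<longleftrightarrow> (a, v) \<in> ?r\<^sup>*" by (meson rtrancl.rtrancl_into_rtrancl)
    then show ?thesis using uv uvV by (auto simp: A_def B_def)
  qed
  \<comment> \<open>If \<open>xy\<close> crosses the cut, the pair consists of the terminals.
    Otherwise both lie on one side and one of them differs from the end of the bridge there, which
    yields an auxiliary pair.\<close>
  have "\<exists>p\<in>A. \<exists>q\<in>B. {p, q} \<noteq> {a, b} \<and> ({x, y} \<subseteq> A \<or> {x, y} \<subseteq> B \<or> {x, y} = {p, q})"
  proof -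
    have ne: "{x, y} \<noteq> {a, b}" using nadj e(1) ab(1) by auto
    consider "x \<in> A" "y \<in> A" | "x \<in> B" "y \<in> B" | "x \<in> A" "y \<in> B" | "x \<in> B" "y \<in> A" using V(1) x by blast
    then show ?thesis
    proof cases
      case 1
      obtain p where p: "p \<in> {x, y}" "p \<noteq> a" using x(3) by auto
      have "{p, b} \<noteq> {a, b}" using p(2) by (auto simp: doubleton_eq_iff)
      moreover have "p \<in> A" using p(1) 1 by auto
      ultimately show ?thesis using bB 1 by blast
    next
      case 2
      obtain q where q: "q \<in> {x, y}" "q \<noteq> b" using x(3) by auto
      have "{a, q} \<noteq> {a, b}" using q(2) by (auto simp: doubleton_eq_iff)
      moreover have "q \<in> B" using q(1) 2 by auto
      ultimately show ?thesis using aA 2 by blast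
    next
      case 3
      then show ?thesis using ne by blast
    next
      case 4
      then show ?thesis using ne insert_commute by blast
    qed
  qed
  then obtain p q where pq: "p \<in> A" "q \<in> B" "{p, q} \<noteq> {a, b}"
    "{x, y} \<subseteq> A \<or> {x, y} \<subseteq> B \<or> {x, y} = {p, q}" by blast
  show "euler_genus H \<le> euler_genus (contract m e H)"
    unfolding ab(1) by (rule genus_le_contract_cut[OF H V aA bB _ pq(1,2,3)]) (use w e ab in auto)
  have "verts (add_xy x y H) = A \<union> B" using V by simp
  then show "euler_genus (add_xy x y H) \<le> euler_genus (contract m e (add_xy x y H))"
    unfolding ab(1)
    by (rule genus_le_contract_cut[OF simple_graph_add_xy[OF H(1) x] connected_graph_add_xy[OF H(2)] _ V(2) aA bB _ pq(1,2,3)])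
      (use w e ab pq(4) in auto)
qed

subsection \<open>Minor-operations on one side of an xy-sum\<close>

lemma merged_vertex_in: "e = {a, b} \<Longrightarrow> merged_vertex x y e \<in> e"
  using some_in_eq[of e] by (simp add: merged_vertex_def)

lemma apply_contract: "apply_op x y (Contract e) H = contract (merged_vertex x y e) e H"
proof -
  have "merge x y e = merge_to (merged_vertex x y e) e" by (simp add: fun_eq_iff merge_def merge_to_def)
  then show ?thesis by (simp add: contract_def)
qed

text \<open>An edge other than \<open>xy\<close> contains at most one terminal, and the merged
  vertex is named after it.\<close>

lemma merge_terminal: "e \<noteq> {x, y} \<Longrightarrow> card e = 2 \<Longrightarrow> v = x \<or> v = y \<Longrightarrow> merge x y e v = v"
  by (auto simp: merge_def merged_vertex_def card_2_iff)

context
  fixes x y :: 'a and G G1 G2 :: "'a graph"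
  assumes T1: "G1 \<in> terminal_graphs_nonadj x y" and T2: "G2 \<in> terminal_graphs_nonadj x y"
    and c1: "connected_graph G1" and c2: "connected_graph G2" and sum: "is_xy_sum x y G G1 G2"
begin

lemma terminals: "simple_graph G1" "simple_graph G2" "x \<in> verts G1" "y \<in> verts G1" "x \<in> verts G2" "y \<in> verts G2"
  "x \<noteq> y" "{x, y} \<notin> edges G1" "{x, y} \<notin> edges G2" "verts G1 \<inter> verts G2 = {x, y}"
  "G = Graph (verts G1 \<union> verts G2) (edges G1 \<union> edges G2)"
  using T1 T2 sum by (auto simp: terminal_graphs_nonadj_def terminal_graphs_def is_xy_sum_def)

text \<open>A common edge would have both ends among the terminals and thus be \<open>xy\<close>,
  which is not in \<open>G2\<close>. The first summand \<open>K\<close> may contain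
  \<open>xy\<close>.\<close>

lemma xy_sumI:
  assumes "simple_graph K" "connected_graph K" "verts K \<inter> verts G2 = {x, y}"
  shows "xy_sum x y (Graph (verts K \<union> verts G2) (edges K \<union> edges G2)) K G2"
proof unfold_locales
  show "edges K \<inter> edges G2 = {}"
  proof (rule ccontr)
    assume "edges K \<inter> edges G2 \<noteq> {}"
    then obtain e where e: "e \<in> edges K" "e \<in> edges G2" by blast
    then have "e \<subseteq> {x, y}" "card e = 2" using assms(1,3) terminals(2) unfolding simple_graph_def by blast+
    then have "e = {x, y}" using card_subset_eq[of "{x, y}" e] terminals(7) by simp
    then show False using e(2) terminals(9) by simp
  qed
qed (use assms terminals c2 in auto)

lemma edge_G1:
  assumes "e \<in> edges G1"
  shows "e \<subseteq> verts G1" "card e = 2" "e \<noteq> {x, y}" "e \<notin> edges G2"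
proof -
  show e: "e \<subseteq> verts G1" "card e = 2" "e \<noteq> {x, y}"
    using assms terminals(1,8) by (auto simp: simple_graph_def)
  interpret xy_sum x y "Graph (verts G1 \<union> verts G2) (edges G1 \<union> edges G2)" G1 G2
    by (rule xy_sumI[OF terminals(1) c1 terminals(10)])
  show "e \<notin> edges G2" using assms E by blast
qed

lemma ops_cases:
  assumes "\<mu> \<in> minor_ops x y G1"
  obtains e where "e \<in> edges G1" "\<mu> = Delete e" | e where "e \<in> edges G1" "\<mu> = Contract e"
  using assms that unfolding minor_ops_def by blast

lemma apply_op_sum:
  assumes "\<mu> \<in> minor_ops x y G1"
  shows "apply_op x y \<mu> G = Graph (verts (apply_op x y \<mu> G1) \<union> verts G2) (edges (apply_op x y \<mu> G1) \<union> edges G2)"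
    "verts (apply_op x y \<mu> G1) \<inter> verts G2 = {x, y}" "simple_graph (apply_op x y \<mu> G1)"
proof -
  have "(apply_op x y \<mu> G = Graph (verts (apply_op x y \<mu> G1) \<union> verts G2) (edges (apply_op x y \<mu> G1) \<union> edges G2)) \<and>
    verts (apply_op x y \<mu> G1) \<inter> verts G2 = {x, y} \<and> simple_graph (apply_op x y \<mu> G1)"
    using assms
  proof (cases rule: ops_cases)
    case (1 e)
    have "edges G1 \<union> edges G2 - {e} = (edges G1 - {e}) \<union> edges G2" using edge_G1(4)[OF 1(1)] by blast
    then show ?thesis using 1(2) terminals(1,10,11) by (simp add: simple_graph_def)
  next
    case (2 e)
    let ?f = "merge x y e"
    note e = edge_G1[OF 2(1)]
    have fix2: "?f v = v" if v: "v \<in> verts G2" for v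
    proof (cases "v \<in> e")
      case True
      then have "v = x \<or> v = y" using e(1) v terminals(10) by blast
      then show ?thesis by (rule merge_terminal[OF e(3,2)])
    qed (simp add: merge_def)
    have "?f ` verts G2 = verts G2" using fix2 by simp
    moreover have img2: "(`) ?f ` edges G2 = edges G2"
    proof -
      have "?f ` d = d" if "d \<in> edges G2" for d
      proof -
        have "d \<subseteq> verts G2" using terminals(2) that unfolding simple_graph_def by blast
        then have "?f ` d = (\<lambda>v. v) ` d" by (intro image_cong) (use fix2 in auto)
        then show ?thesis by simp
      qed
      then show ?thesis by simp
    qed
    moreover have "edges G1 \<union> edges G2 - {e} = (edges G1 - {e}) \<union> edges G2" using e(4) by blast
    ultimately have "apply_op x y \<mu> G = Graph (?f ` verts G1 \<union> verts G2) ((`) ?f ` (edges G1 - {e}) \<union> edges G2)"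
      using 2(2) terminals(11) by (simp add: image_Un)
    moreover obtain a b where ab: "e = {a, b}" using e(2) by (auto simp: card_2_iff)
    have m: "merged_vertex x y e \<in> e" by (rule merged_vertex_in[OF ab])
    have sub: "?f v \<in> verts G1" if "v \<in> verts G1" for v using that m e(1) by (auto simp: merge_def)
    have "?f x = x" "?f y = y" using merge_terminal[OF e(3,2)] by simp_all
    then have "x \<in> ?f ` verts G1" "y \<in> ?f ` verts G1" using terminals(3,4) by (metis imageI)+
    then have "?f ` verts G1 \<inter> verts G2 = {x, y}" using sub terminals(10) by blast
    moreover have "simple_graph (apply_op x y (Contract e) G1)"
      unfolding apply_contract by (rule simple_graph_contract[OF terminals(1) 2(1) m])
    ultimately show ?thesis using 2(2) by simp
  qed
  then show "apply_op x y \<mu> G = Graph (verts (apply_op x y \<mu> G1) \<union> verts G2) (edges (apply_op x y \<mu> G1) \<union> edges G2)"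
    "verts (apply_op x y \<mu> G1) \<inter> verts G2 = {x, y}" "simple_graph (apply_op x y \<mu> G1)" by blast+
qed

lemma connected_contract:
  assumes "e \<in> edges G1" shows "connected_graph (apply_op x y (Contract e) G1)"
proof -
  obtain a b where ab: "e = {a, b}" using edge_G1(2)[OF assms] by (auto simp: card_2_iff)
  show ?thesis unfolding apply_contract
    by (rule connected_graph_contract[OF c1 merged_vertex_in[OF ab] edge_G1(1)[OF assms]])
qed

lemma genus_apply_op:
  assumes "\<mu> \<in> minor_ops x y G1" "connected_graph (apply_op x y \<mu> G1)"
  defines "K \<equiv> apply_op x y \<mu> G1"
  shows "euler_genus (apply_op x y \<mu> G) =
      min (euler_genus K + euler_genus G2 + 2) (euler_genus_plus x y K + euler_genus_plus x y G2)"
    "euler_genus K \<le> euler_genus_plus x y K" "euler_genus_plus x y K \<le> euler_genus K + 2"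
proof -
  interpret xy_sum x y "apply_op x y \<mu> G" K G2
    unfolding apply_op_sum(1)[OF assms(1)] K_def
    by (rule xy_sumI[OF apply_op_sum(3)[OF assms(1)] assms(2) apply_op_sum(2)[OF assms(1)]])
  show "euler_genus (apply_op x y \<mu> G) =
      min (euler_genus K + euler_genus G2 + 2) (euler_genus_plus x y K + euler_genus_plus x y G2)"
    by (rule genus_eq)
  show "euler_genus K \<le> euler_genus_plus x y K" "euler_genus_plus x y K \<le> euler_genus K + 2"
    using theta_bounds[OF s1 c1 x1 y1 xy] by blast+
qed

lemma genus_sum: "euler_genus G =
    min (euler_genus G1 + euler_genus G2 + 2) (euler_genus_plus x y G1 + euler_genus_plus x y G2)"
proof -
  interpret xy_sum x y G G1 G2
    using xy_sumI[OF terminals(1) c1 terminals(10)] unfolding terminals(11)[symmetric] .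
  show ?thesis by (rule genus_eq)
qed

lemma contract_bridge:
  assumes e: "e \<in> edges G1" and "\<not> connected_graph (apply_op x y (Delete e) G1)"
  shows "euler_genus G1 \<le> euler_genus (apply_op x y (Contract e) G1)"
    "euler_genus_plus x y G1 \<le> euler_genus_plus x y (apply_op x y (Contract e) G1)"
proof -
  obtain a b where ab: "e = {a, b}" using edge_G1(2)[OF e] by (auto simp: card_2_iff)
  have br: "\<not> connected_graph (Graph (verts G1) (edges G1 - {e}))" using assms(2) by simp
  note B = bridge_contract[OF terminals(1) c1 terminals(3,4,7,8) e merged_vertex_in[OF ab, of x y] br]
  show "euler_genus G1 \<le> euler_genus (apply_op x y (Contract e) G1)"
    unfolding apply_contract by (rule B(1))
  \<comment> \<open>Contraction commutes with the addition of \<open>xy\<close>, since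
    \<open>e\<close> is another edge and the terminals keep their names.\<close>
  have "insert {x, y} (edges G1) - {e} = insert {x, y} (edges G1 - {e})" using edge_G1(3)[OF e] by blast
  moreover have "merge x y e ` {x, y} = {x, y}" using merge_terminal[OF edge_G1(3,2)[OF e]] by auto
  ultimately have "apply_op x y (Contract e) (add_xy x y G1) = add_xy x y (apply_op x y (Contract e) G1)"
    by (simp add: add_xy_def)
  then show "euler_genus_plus x y G1 \<le> euler_genus_plus x y (apply_op x y (Contract e) G1)"
    unfolding euler_genus_plus_def using B(2) unfolding apply_contract by simp
qed

definition criterion :: "'a minor_op \<Rightarrow> bool" where
  "criterion \<mu> \<longleftrightarrow> (let b = int (euler_genus (apply_op x y \<mu> G1)) - int (euler_genus G1);
      b' = int (euler_genus_plus x y (apply_op x y \<mu> G1)) - int (euler_genus_plus x y G1);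
      n = eta x y G1 G2 in
    (n = 0 \<longrightarrow> b' \<le> -1) \<and> (n = 1 \<longrightarrow> b' \<le> -1 \<or> b \<le> -2) \<and> (n = 2 \<longrightarrow> b' \<le> -1 \<or> b \<le> -1) \<and>
    (n = 3 \<longrightarrow> b \<le> -1 \<or> b' \<le> -2) \<and> (n = 4 \<longrightarrow> b \<le> -1))"

lemma eta_bounds:
  "eta x y G1 G2 = int (euler_genus_plus x y G1) - int (euler_genus G1)
     + int (euler_genus_plus x y G2) - int (euler_genus G2)"
  "euler_genus G1 \<le> euler_genus_plus x y G1" "euler_genus_plus x y G1 \<le> euler_genus G1 + 2"
  "euler_genus G2 \<le> euler_genus_plus x y G2" "euler_genus_plus x y G2 \<le> euler_genus G2 + 2"
  using theta_bounds[OF terminals(1) c1 terminals(3,4,7)] theta_bounds[OF terminals(2) c2 terminals(5,6,7)]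
  by (simp_all add: eta_def theta_def)

lemma eta_cases: "eta x y G1 G2 \<in> {0, 1, 2, 3, 4}"
proof -
  have "0 \<le> eta x y G1 G2" "eta x y G1 G2 \<le> 4" using eta_bounds by linarith+
  then show ?thesis by (simp only: insert_iff empty_iff) presburger
qed

text \<open>The two terms of the minimum differ by \<open>eta - 2\<close>: the smaller one must fall
  by 1, or the other one by 1 more than the distance. For \<open>eta\<close> equal to 0 or 4 the
  second way means a fall by 3, which entails the first because theta lies between 0 and 2 before
  and after the operation.\<close>

lemma genus_decreases_iff:
  assumes "\<mu> \<in> minor_ops x y G1" "connected_graph (apply_op x y \<mu> G1)"
  shows "euler_genus (apply_op x y \<mu> G) < euler_genus G \<longleftrightarrow> criterion \<mu>"
proof -
  note * = genus_apply_op[OF assms] genus_sum eta_bounds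
  consider "eta x y G1 G2 = 0" | "eta x y G1 G2 = 1" | "eta x y G1 G2 = 2" | "eta x y G1 G2 = 3" | "eta x y G1 G2 = 4"
    using eta_cases by auto
  then show ?thesis
    by cases (use * in \<open>simp add: criterion_def Let_def min_def, linarith\<close>)+
qed

lemma tight_iff: "tight_in x y euler_genus G1 G \<longleftrightarrow> (\<forall>\<mu>\<in>minor_ops x y G1. criterion \<mu>)"
proof -
  have sub: "subgraph G1 G" using terminals(11) by (simp add: subgraph_def)
  show ?thesis
  proof (cases "\<exists>e\<in>edges G1. \<not> connected_graph (apply_op x y (Delete e) G1)")
    case True
    then obtain e where e: "e \<in> edges G1" "\<not> connected_graph (apply_op x y (Delete e) G1)" by blast
    have op: "Contract e \<in> minor_ops x y G1" using e(1) edge_G1(3)[OF e(1)] by (simp add: minor_ops_def)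
    \<comment> \<open>The exhaustive list of values of \<open>eta\<close> matters here, as
      \<open>criterion\<close> holds vacuously for any other value.\<close>
    have "\<not> criterion (Contract e)"
      using contract_bridge[OF e] eta_cases by (auto simp: criterion_def Let_def simp del: apply_op.simps)
    then show ?thesis
      using op genus_decreases_iff[OF op connected_contract[OF e(1)]] unfolding tight_in_def by blast
  next
    case False
    have "connected_graph (apply_op x y \<mu> G1)" if "\<mu> \<in> minor_ops x y G1" for \<mu>
      using that by (cases rule: ops_cases) (use False connected_contract in blast)+
    then show ?thesis unfolding tight_in_def using sub genus_decreases_iff by blast
  qed
qed

end

theorem theorem4p8:
  fixes x y :: 'a and G G1 G2 :: "'a graph"
  assumes "G1 \<in> terminal_graphs_nonadj x y" and "G2 \<in> terminal_graphs_nonadj x y"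
    and "connected_graph G1" and "connected_graph G2"
    and "is_xy_sum x y G G1 G2"
  shows "tight_in x y euler_genus G1 G \<longleftrightarrow>
    (eta x y G1 G2 = 0 \<longrightarrow> G1 \<in> critical_nonadj x y (euler_genus_plus x y)) \<and>
    (eta x y G1 G2 = 1 \<longrightarrow>
       G1 \<in> critical_nonadj x y (euler_genus_plus x y) \<union> weak_genus_hoppers x y) \<and>
    (eta x y G1 G2 = 2 \<longrightarrow>
       G1 \<in> critical_nonadj x y (euler_genus_plus x y) \<union> critical_nonadj x y euler_genus
             \<union> cascades x y) \<and>
    (eta x y G1 G2 = 3 \<longrightarrow>
       G1 \<in> critical_nonadj x y euler_genus \<union> weak_genus_plus_hoppers x y) \<and>
    (eta x y G1 G2 = 4 \<longrightarrow> G1 \<in> critical_nonadj x y euler_genus)"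
proof -
  let ?O = "minor_ops x y G1" and ?P = "euler_genus_plus x y"
  define dec where "dec P k \<mu> \<longleftrightarrow> int (P (apply_op x y \<mu> G1)) - int (P G1) \<le> - int k"
    for P :: "'a graph \<Rightarrow> nat" and k \<mu>
  have D: "decreasing_ops x y k P G1 = {\<mu> \<in> ?O. dec P k \<mu>}" for k P
    unfolding decreasing_ops_def dec_def by auto
  have crit: "G1 \<in> critical_nonadj x y P \<longleftrightarrow> (\<forall>\<mu>\<in>?O. dec P 1 \<mu>)" for P
    unfolding critical_nonadj_def critical_def mem_Collect_eq D using assms(1) by blast
  \<comment> \<open>The class of hoppers excludes exactly the critical graphs that the union adds
    again, so only the condition on the operations is left; the same happens for cascades.\<close>
  have h: "G1 \<in> critical_nonadj x y ?P \<union> weak_genus_hoppers x y \<longleftrightarrow>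
      (\<forall>\<mu>\<in>?O. dec ?P 1 \<mu> \<or> dec euler_genus 2 \<mu>)"
    unfolding weak_genus_hoppers_def Un_iff mem_Collect_eq crit D using assms(1) by blast
  have c: "G1 \<in> critical_nonadj x y ?P \<union> critical_nonadj x y euler_genus \<union> cascades x y \<longleftrightarrow>
      (\<forall>\<mu>\<in>?O. dec ?P 1 \<mu> \<or> dec euler_genus 1 \<mu>)"
    unfolding cascades_def Un_iff mem_Collect_eq crit D using assms(1) by blast
  have h': "G1 \<in> critical_nonadj x y euler_genus \<union> weak_genus_plus_hoppers x y \<longleftrightarrow>
      (\<forall>\<mu>\<in>?O. dec euler_genus 1 \<mu> \<or> dec ?P 2 \<mu>)"
    unfolding weak_genus_plus_hoppers_def Un_iff mem_Collect_eq crit D using assms(1) by blast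
  have "criterion x y G1 G2 \<mu> \<longleftrightarrow>
    (eta x y G1 G2 = 0 \<longrightarrow> dec ?P 1 \<mu>) \<and>
    (eta x y G1 G2 = 1 \<longrightarrow> dec ?P 1 \<mu> \<or> dec euler_genus 2 \<mu>) \<and>
    (eta x y G1 G2 = 2 \<longrightarrow> dec ?P 1 \<mu> \<or> dec euler_genus 1 \<mu>) \<and>
    (eta x y G1 G2 = 3 \<longrightarrow> dec euler_genus 1 \<mu> \<or> dec ?P 2 \<mu>) \<and>
    (eta x y G1 G2 = 4 \<longrightarrow> dec euler_genus 1 \<mu>)" for \<mu>
    unfolding criterion_def[OF assms] dec_def Let_def by simp
  then show ?thesis
    unfolding tight_iff[OF assms] h c h' crit by blast
qed

end
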